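(* Let $T>0$. Let $q$ be a distribution on $\mathbb{R}^d$ with $q\ge0$ (meaning that all regularisations of $q$ considered are non-negative functions), let $u_0\in H^1(\mathbb{R}^d)$, and assume that their regularisations are moderate: there exist $N,N_0\in\mathbb{N}_0$ and constants $C,C_0>0$ such that $\Vert q_\varepsilon\Vert_{L^\infty}\le C\omega(\varepsilon)^{-N}$ and $\Vert u_{0,\varepsilon}\Vert_{H^1}\le C_0\omega(\varepsilon)^{-N_0}$ for all $\varepsilon\in(0,1]$. Then the very weak solution to the Cauchy problem $$\partial_t u-\Delta u+q(x)u=0\ \text{ on }(0,T)\times\mathbb{R}^d,\qquad u(0,x)=u_0(x),$$ is unique in the following sense. For all families $(q_\varepsilon)_\varepsilon,(\tilde q_\varepsilon)_\varepsilon$ of regularisations of $q$ and $(u_{0,\varepsilon})_\varepsilon,(\tilde u_{0,\varepsilon})_\varepsilon$ of regularisations of $u_0$ satisfying $$\Vert q_\varepsilon-\tilde q_\varepsilon\Vert_{L^\infty}\le C_k\varepsilon^k\ \text{ for all }k>0,\qquad \Vert u_{0,\varepsilon}-\tilde u_{0,\varepsilon}\Vert_{L^2}\le C_l\varepsilon^l\ \text{ for all }l>0,$$ one has, for every $N>0$, with some constant $C_N>0$, $$\Vert u_\varepsilon(t,\cdot)-\tilde u_\varepsilon(t,\cdot)\Vert_{L^2}\le C_N\varepsilon^N\qquad\text{for all }t\in[0,T],\ \varepsilon\in(0,1],$$ where $u_\varepsilon$ and $\tilde u_\varepsilon$ solve, respectively, $\partial_t u_\varepsilon-\Delta u_\varepsilon+q_\varepsilon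 u_\varepsilon=0$, $u_\varepsilon(0,\cdot)=u_{0,\varepsilon}$, and $\partial_t\tilde u_\varepsilon-\Delta\tilde u_\varepsilon+\tilde q_\varepsilon\tilde u_\varepsilon=0$, $\tilde u_\varepsilon(0,\cdot)=\tilde u_{0,\varepsilon}$, on $[0,T]\times\mathbb{R}^d$.
   Context: $\omega(\varepsilon)$, $\varepsilon\in(0,1]$, is a positive function with $\omega(\varepsilon)\to0$ as $\varepsilon\to0$. A Friedrichs mollifier is a function $\psi\in C_0^\infty(\mathbb{R}^d)$ with $\psi\ge0$, $\int\psi=1$. Regularisations are obtained by convolution: for Friedrichs mollifiers $\psi,\tilde\psi$, put $\psi_\varepsilon(x)=\omega(\varepsilon)^{-d}\psi(x/\omega(\varepsilon))$, $\tilde\psi_\varepsilon(x)=\omega(\varepsilon)^{-d}\tilde\psi(x/\omega(\varepsilon))$, and $q_\varepsilon=q\ast\psi_\varepsilon$, $u_{0,\varepsilon}=u_0\ast\psi_\varepsilon$, $\tilde q_\varepsilon=q\ast\tilde\psi_\varepsilon$, $\tilde u_{0,\varepsilon}=u_0\ast\tilde\psi_\varepsilon$. The moderateness assumption is imposed on both the families with and without tilde. *)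

theory Defs
  imports "HOL-Analysis.Analysis" "HOL-Probability.Essential_Supremum"
begin

definition dir_deriv :: "'a::euclidean_space \<Rightarrow> ('a \<Rightarrow> real) \<Rightarrow> 'a \<Rightarrow> real" where
  "dir_deriv b f x = frechet_derivative f (at x) b"

primrec iter_deriv :: "'a::euclidean_space list \<Rightarrow> ('a \<Rightarrow> real) \<Rightarrow> 'a \<Rightarrow> real" where
  "iter_deriv [] f = f"
| "iter_deriv (b # bs) f = dir_deriv b (iter_deriv bs f)"

definition smooth :: "('a::euclidean_space \<Rightarrow> real) \<Rightarrow> bool" where
  "smooth f \<longleftrightarrow> (\<forall>bs. set bs \<subseteq> Basis \<longrightarrow> (\<forall>x. iter_deriv bs f differentiable (at x)))"

definition supp :: "('a::euclidean_space \<Rightarrow> real) \<Rightarrow> 'a set" where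
  "supp f = closure {x. f x \<noteq> 0}"

definition test_fun_on :: "'a::euclidean_space set \<Rightarrow> ('a \<Rightarrow> real) \<Rightarrow> bool" where
  "test_fun_on \<Omega> \<phi> \<longleftrightarrow> smooth \<phi> \<and> compact (supp \<phi>) \<and> supp \<phi> \<subseteq> \<Omega>"

abbreviation test_fun :: "('a::euclidean_space \<Rightarrow> real) \<Rightarrow> bool" where
  "test_fun \<equiv> test_fun_on UNIV"

text \<open>A (real) distribution is a linear functional on test functions that is sequentially
  continuous for the usual convergence of test functions: supports in a common compact set,
  and uniform convergence of every partial derivative. A distribution \<open>q \<ge> 0\<close> is necessarily
  real. Values of \<open>q\<close> on functions that are not test functions carry no meaning.\<close>

definition is_distribution :: "(('a::euclidean_space \<Rightarrow> real) \<Rightarrow> real) \<Rightarrow> bool" where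
  "is_distribution q \<longleftrightarrow>
     (\<forall>\<phi> \<theta>. test_fun \<phi> \<and> test_fun \<theta> \<longrightarrow> q (\<lambda>x. \<phi> x + \<theta> x) = q \<phi> + q \<theta>) \<and>
     (\<forall>c \<phi>. test_fun \<phi> \<longrightarrow> q (\<lambda>x. c * \<phi> x) = c * q \<phi>) \<and>
     (\<forall>\<phi> :: nat \<Rightarrow> 'a \<Rightarrow> real.
        (\<forall>n. test_fun (\<phi> n)) \<and>
        (\<exists>K. compact K \<and> (\<forall>n. supp (\<phi> n) \<subseteq> K)) \<and>
        (\<forall>bs. set bs \<subseteq> Basis \<longrightarrow>
           uniform_limit UNIV (\<lambda>n. iter_deriv bs (\<phi> n)) (\<lambda>_. 0) sequentially)
        \<longrightarrow> (\<lambda>n. q (\<phi> n)) \<longlonglongrightarrow> 0)"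

definition friedrichs_mollifier :: "('a::euclidean_space \<Rightarrow> real) \<Rightarrow> bool" where
  "friedrichs_mollifier \<psi> \<longleftrightarrow>
     test_fun \<psi> \<and> (\<forall>x. 0 \<le> \<psi> x) \<and> (\<integral>x. \<psi> x \<partial>lborel) = 1"

definition scaled :: "(real \<Rightarrow> real) \<Rightarrow> ('a::euclidean_space \<Rightarrow> real) \<Rightarrow> real \<Rightarrow> 'a \<Rightarrow> real" where
  "scaled \<omega> \<psi> \<epsilon> x = \<omega> \<epsilon> powi (- int DIM('a)) * \<psi> (x /\<^sub>R \<omega> \<epsilon>)"

definition distr_conv ::
    "(('a::euclidean_space \<Rightarrow> real) \<Rightarrow> real) \<Rightarrow> ('a \<Rightarrow> real) \<Rightarrow> 'a \<Rightarrow> real" where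
  "distr_conv q \<rho> x = q (\<lambda>y. \<rho> (x - y))"

definition fun_conv :: "('a::euclidean_space \<Rightarrow> complex) \<Rightarrow> ('a \<Rightarrow> real) \<Rightarrow> 'a \<Rightarrow> complex" where
  "fun_conv f \<rho> x = (\<integral>y. \<rho> (x - y) *\<^sub>R f y \<partial>lborel)"

definition Linf_norm :: "('a::euclidean_space \<Rightarrow> real) \<Rightarrow> ereal" where
  "Linf_norm f = esssup lborel (\<lambda>x. ereal \<bar>f x\<bar>)"

definition in_L2 :: "('a::euclidean_space \<Rightarrow> complex) \<Rightarrow> bool" where
  "in_L2 f \<longleftrightarrow> f \<in> borel_measurable lborel \<and> integrable lborel (\<lambda>x. (norm (f x))\<^sup>2)"

text \<open>The real-valued norms \<open>L2_norm\<close> and \<open>H1_norm\<close> are meaningful only on \<open>in_L2\<close> and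
  \<open>in_H1\<close>, respectively.\<close>

definition L2_norm :: "('a::euclidean_space \<Rightarrow> complex) \<Rightarrow> real" where
  "L2_norm f = sqrt (\<integral>x. (norm (f x))\<^sup>2 \<partial>lborel)"

text \<open>Real test functions suffice for complex-valued \<open>f\<close> by linearity of the integral. The
  weak derivative is determined up to a null set, so \<open>H1_norm\<close> does not depend on the choice
  made in \<open>weak_deriv\<close>.\<close>

definition is_weak_deriv ::
    "'a::euclidean_space \<Rightarrow> ('a \<Rightarrow> complex) \<Rightarrow> ('a \<Rightarrow> complex) \<Rightarrow> bool" where
  "is_weak_deriv b f g \<longleftrightarrow>
     (\<forall>\<phi>. test_fun \<phi> \<longrightarrow>
        (\<integral>x. dir_deriv b \<phi> x *\<^sub>R f x \<partial>lborel) = - (\<integral>x. \<phi> x *\<^sub>R g x \<partial>lborel))"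

definition weak_deriv :: "'a::euclidean_space \<Rightarrow> ('a \<Rightarrow> complex) \<Rightarrow> 'a \<Rightarrow> complex" where
  "weak_deriv b f = (SOME g. in_L2 g \<and> is_weak_deriv b f g)"

definition in_H1 :: "('a::euclidean_space \<Rightarrow> complex) \<Rightarrow> bool" where
  "in_H1 f \<longleftrightarrow> in_L2 f \<and> (\<forall>b\<in>Basis. \<exists>g. in_L2 g \<and> is_weak_deriv b f g)"

definition H1_norm :: "('a::euclidean_space \<Rightarrow> complex) \<Rightarrow> real" where
  "H1_norm f = sqrt ((L2_norm f)\<^sup>2 + (\<Sum>b\<in>Basis. (L2_norm (weak_deriv b f))\<^sup>2))"

definition continuous_in_H1 :: "real \<Rightarrow> (real \<Rightarrow> 'a::euclidean_space \<Rightarrow> complex) \<Rightarrow> bool" where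
  "continuous_in_H1 T u \<longleftrightarrow>
     (\<forall>t\<in>{0..T}. in_H1 (u t)) \<and>
     (\<forall>t\<in>{0..T}. ((\<lambda>s. H1_norm (\<lambda>x. u s x - u t x)) \<longlongrightarrow> 0) (at t within {0..T}))"

text \<open>The transposed operator \<open>-\<partial>\<^sub>t \<phi> - \<Delta> \<phi> + p \<phi>\<close> for \<open>\<phi>\<close> on space-time.\<close>

definition heat_transpose ::
    "('a::euclidean_space \<Rightarrow> real) \<Rightarrow> (real \<times> 'a \<Rightarrow> real) \<Rightarrow> real \<times> 'a \<Rightarrow> real" where
  "heat_transpose p \<phi> z =
     - dir_deriv (1, 0) \<phi> z - (\<Sum>b\<in>Basis. iter_deriv [(0, b), (0, b)] \<phi> z) + p (snd z) * \<phi> z"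

text \<open>\<open>u \<in> C([0,T]; H\<^sup>1)\<close> solves \<open>\<partial>\<^sub>t u - \<Delta> u + p u = 0\<close> in the sense of distributions on
  \<open>(0,T) \<times> \<real>\<^sup>d\<close>, with \<open>u(0,\<cdot>) = v\<close> almost everywhere. The integral is iterated because
  \<open>u \<in> C([0,T]; H\<^sup>1)\<close> does not make the chosen representatives jointly measurable.\<close>

definition heat_solution ::
    "real \<Rightarrow> ('a::euclidean_space \<Rightarrow> real) \<Rightarrow> ('a \<Rightarrow> complex) \<Rightarrow> (real \<Rightarrow> 'a \<Rightarrow> complex) \<Rightarrow> bool" where
  "heat_solution T p v u \<longleftrightarrow>
     continuous_in_H1 T u \<and>
     (\<forall>\<phi>. test_fun_on ({0<..<T} \<times> UNIV) \<phi> \<longrightarrow>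
        (LINT t:{0..T}|lborel. (\<integral>x. heat_transpose p \<phi> (t, x) *\<^sub>R u t x \<partial>lborel)) = 0) \<and>
     (AE x in lborel. u 0 x = v x)"

definition moderate_Linf :: "(real \<Rightarrow> real) \<Rightarrow> (real \<Rightarrow> 'a::euclidean_space \<Rightarrow> real) \<Rightarrow> bool" where
  "moderate_Linf \<omega> p \<longleftrightarrow>
     (\<exists>(N::nat) C. C > 0 \<and>
        (\<forall>\<epsilon>\<in>{0<..1}. Linf_norm (p \<epsilon>) \<le> ereal (C * \<omega> \<epsilon> powi (- int N))))"

definition moderate_H1 :: "(real \<Rightarrow> real) \<Rightarrow> (real \<Rightarrow> 'a::euclidean_space \<Rightarrow> complex) \<Rightarrow> bool" where
  "moderate_H1 \<omega> v \<longleftrightarrow>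
     (\<exists>(N::nat) C. C > 0 \<and>
        (\<forall>\<epsilon>\<in>{0<..1}. in_H1 (v \<epsilon>) \<and> H1_norm (v \<epsilon>) \<le> C * \<omega> \<epsilon> powi (- int N)))"

end

theory Submission
  imports Defs
begin

text \<open>
  A solution \<open>u \<in> C([0,T]; H\<^sup>1)\<close> in the sense of distributions is first mollified in time against
  tensor products \<open>\<eta>(c - t) \<theta>(x)\<close>, which gives the time-integrated equation tested with every
  test function \<open>\<theta>\<close>, and then, by density, with every \<open>v \<in> H\<^sup>1\<close>. Taking \<open>v = w(s) + w(t)\<close> on a
  short interval \<open>[s,t]\<close> yields the energy inequality without differentiating \<open>w\<close> in time.
  Applied to a single solution it gives \<open>\<parallel>u(t)\<parallel> \<le> \<parallel>u(0)\<parallel>\<close>, and \<open>\<parallel>u(0)\<parallel> \<le> \<parallel>u\<^sub>0\<parallel>\<close> by Young's inequality,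
  uniformly in \<open>\<epsilon>\<close>. Applied to the difference \<open>w = u - u'\<close>, which solves the equation for \<open>q\<close> with
  right-hand side \<open>-(q - q') u'\<close>, it gives
  \<open>\<parallel>w(t)\<parallel>\<^sup>2 \<le> \<parallel>w(0)\<parallel>\<^sup>2 + 4 t \<parallel>q - q'\<parallel>\<^sub>\<infinity> \<parallel>u\<^sub>0\<parallel>\<^sup>2\<close>. All bump functions needed along the way, the cut-offs
  and the mollifiers on the time axis included, are rescalings or restrictions of the given mollifier.
\<close>

section \<open>Smooth functions and test functions\<close>

lemma has_derivative_dir_deriv:
  assumes "f differentiable (at x)"
  shows "(f has_derivative (\<lambda>h. \<Sum>b\<in>Basis. (h \<bullet> b) * dir_deriv b f x)) (at x)"
proof -
  have d: "(f has_derivative frechet_derivative f (at x)) (at x)"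
    using assms frechet_derivative_works by blast
  then interpret bounded_linear "frechet_derivative f (at x)"
    by (rule has_derivative_bounded_linear)
  have "frechet_derivative f (at x) = (\<lambda>h. \<Sum>b\<in>Basis. (h \<bullet> b) * dir_deriv b f x)"
  proof
    fix h
    have "frechet_derivative f (at x) (\<Sum>b\<in>Basis. (h \<bullet> b) *\<^sub>R b) = (\<Sum>b\<in>Basis. (h \<bullet> b) * dir_deriv b f x)"
      by (simp add: sum scaleR dir_deriv_def)
    then show "frechet_derivative f (at x) h = (\<Sum>b\<in>Basis. (h \<bullet> b) * dir_deriv b f x)"
      by (simp add: euclidean_representation)
  qed
  with d show ?thesis by simp
qed

lemma dir_deriv_eqI:
  assumes "(f has_derivative D) (at x)"
  shows "dir_deriv b f x = D b"
  unfolding dir_deriv_def using frechet_derivative_at[OF assms] by simp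

lemma dir_deriv_add:
  assumes "\<And>x. f differentiable (at x)" "\<And>x. g differentiable (at x)"
  shows "dir_deriv b (\<lambda>x. f x + g x) = (\<lambda>x. dir_deriv b f x + dir_deriv b g x)"
proof
  fix x
  from dir_deriv_eqI[OF has_derivative_add[OF has_derivative_dir_deriv[OF assms(1)] has_derivative_dir_deriv[OF assms(2)]], of b x]
  show "dir_deriv b (\<lambda>x. f x + g x) x = dir_deriv b f x + dir_deriv b g x"
    using dir_deriv_eqI[OF has_derivative_dir_deriv[OF assms(1)], of b x]
      dir_deriv_eqI[OF has_derivative_dir_deriv[OF assms(2)], of b x] by simp
qed

lemma dir_deriv_mult:
  assumes "\<And>x. f differentiable (at x)" "\<And>x. g differentiable (at x)"
  shows "dir_deriv b (\<lambda>x. f x * g x) = (\<lambda>x. f x * dir_deriv b g x + dir_deriv b f x * g x)"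
proof
  fix x
  from dir_deriv_eqI[OF has_derivative_mult[OF has_derivative_dir_deriv[OF assms(1)] has_derivative_dir_deriv[OF assms(2)]], of b x]
  show "dir_deriv b (\<lambda>x. f x * g x) x = f x * dir_deriv b g x + dir_deriv b f x * g x"
    using dir_deriv_eqI[OF has_derivative_dir_deriv[OF assms(1)], of b x]
      dir_deriv_eqI[OF has_derivative_dir_deriv[OF assms(2)], of b x] by simp
qed

lemma differentiable_affine:
  fixes L :: "'b::euclidean_space \<Rightarrow> 'a::euclidean_space"
  assumes "linear L" "\<And>x. f differentiable (at x)"
  shows "(\<lambda>x. f (L x + c)) differentiable (at x)"
  by (rule differentiable_compose[of f "\<lambda>x. L x + c"])
    (use assms linear_imp_differentiable in \<open>auto intro!: differentiable_add\<close>)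

lemma dir_deriv_affine:
  fixes L :: "'b::euclidean_space \<Rightarrow> 'a::euclidean_space"
  assumes L: "linear L" and f: "\<And>x. f differentiable (at x)"
  shows "dir_deriv e (\<lambda>x. f (L x + c)) = (\<lambda>x. \<Sum>b\<in>Basis. (L e \<bullet> b) * dir_deriv b f (L x + c))"
proof
  fix x
  have 1: "((\<lambda>x. L x + c) has_derivative L) (at x)"
    using L linear_imp_has_derivative has_derivative_add_const by blast
  have "((\<lambda>x. f (L x + c)) has_derivative (\<lambda>h. \<Sum>b\<in>Basis. (L h \<bullet> b) * dir_deriv b f (L x + c))) (at x)"
    using has_derivative_compose[OF 1 has_derivative_dir_deriv[OF f]] by simp
  from dir_deriv_eqI[OF this] show "dir_deriv e (\<lambda>x. f (L x + c)) x = (\<Sum>b\<in>Basis. (L e \<bullet> b) * dir_deriv b f (L x + c))"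
    by simp
qed

text \<open>\<open>iter_deriv\<close> puts each new derivative outermost, whereas the sum, product
  and chain rules speak about the derivative taken first. This recursion peels off that innermost
  derivative, so closure properties follow by induction on \<open>k\<close> with \<open>f\<close>
  arbitrary.\<close>

primrec differentiable_order :: "nat \<Rightarrow> ('a::euclidean_space \<Rightarrow> real) \<Rightarrow> bool" where
  "differentiable_order 0 f \<longleftrightarrow> (\<forall>x. f differentiable (at x))"
| "differentiable_order (Suc k) f \<longleftrightarrow>
     (\<forall>x. f differentiable (at x)) \<and> (\<forall>b\<in>Basis. differentiable_order k (dir_deriv b f))"

lemma iter_deriv_append: "iter_deriv (bs @ cs) f = iter_deriv bs (iter_deriv cs f)"
  by (induction bs) auto

lemma differentiable_order_iff:
  "differentiable_order k f \<longleftrightarrow>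
     (\<forall>bs. set bs \<subseteq> Basis \<and> length bs \<le> k \<longrightarrow> (\<forall>x. iter_deriv bs f differentiable (at x)))"
proof (induction k arbitrary: f)
  case (Suc k)
  show ?case
  proof
    assume *: "differentiable_order (Suc k) f"
    show "\<forall>bs. set bs \<subseteq> Basis \<and> length bs \<le> Suc k \<longrightarrow> (\<forall>x. iter_deriv bs f differentiable (at x))"
    proof (intro allI impI)
      fix bs :: "'a list" and x
      assume bs: "set bs \<subseteq> Basis \<and> length bs \<le> Suc k"
      show "iter_deriv bs f differentiable (at x)"
      \<comment> \<open>The last list entry is the derivative taken first; splitting it off leaves a
        case of the induction hypothesis for \<open>dir_deriv b f\<close>.\<close>
      proof (cases bs rule: rev_cases)
        case (snoc cs b)
        with bs * Suc.IH[of "dir_deriv b f"] show ?thesis by (auto simp: iter_deriv_append)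
      qed (use * in auto)
    qed
  next
    assume *: "\<forall>bs. set bs \<subseteq> Basis \<and> length bs \<le> Suc k \<longrightarrow> (\<forall>x. iter_deriv bs f differentiable (at x))"
    have "differentiable_order k (dir_deriv b f)" if "b \<in> Basis" for b
      unfolding Suc.IH
    proof (intro allI impI)
      fix bs :: "'a list" and x
      assume "set bs \<subseteq> Basis \<and> length bs \<le> k"
      then show "iter_deriv bs (dir_deriv b f) differentiable (at x)"
        using *[rule_format, of "bs @ [b]" x] that by (auto simp: iter_deriv_append)
    qed
    with *[rule_format, of "[]"] show "differentiable_order (Suc k) f" by auto
  qed
qed auto

lemma smooth_iff_order: "smooth f \<longleftrightarrow> (\<forall>k. differentiable_order k f)"
  unfolding smooth_def differentiable_order_iff by auto

lemma smooth_imp_differentiable: "smooth f \<Longrightarrow> f differentiable (at x)"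
  unfolding smooth_def by (metis empty_subsetI empty_set iter_deriv.simps(1))

lemma smooth_imp_continuous: "smooth f \<Longrightarrow> continuous_on S f"
  by (simp add: continuous_at_imp_continuous_on differentiable_imp_continuous_within smooth_imp_differentiable)

lemma smooth_dir_deriv: "smooth f \<Longrightarrow> b \<in> Basis \<Longrightarrow> smooth (dir_deriv b f)"
  unfolding smooth_iff_order by (metis differentiable_order.simps(2))

lemma differentiable_order_SucD: "differentiable_order (Suc k) f \<Longrightarrow> differentiable_order k f"
  unfolding differentiable_order_iff by auto

lemma differentiable_order_const: "differentiable_order k (\<lambda>_. c)"
proof (induction k arbitrary: c)
  case (Suc k)
  have "dir_deriv b (\<lambda>_. c) = (\<lambda>_. 0)" for b :: 'a
    using dir_deriv_eqI[OF has_derivative_const[of c]] by blast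
  with Suc show ?case by simp
qed simp

lemma differentiable_order_add:
  "differentiable_order k f \<Longrightarrow> differentiable_order k g \<Longrightarrow> differentiable_order k (\<lambda>x. f x + g x)"
proof (induction k arbitrary: f g)
  case (Suc k)
  then have "f differentiable (at x)" "g differentiable (at x)" for x by auto
  with Suc show ?case by (auto simp: dir_deriv_add)
qed auto

lemma differentiable_order_mult:
  "differentiable_order k f \<Longrightarrow> differentiable_order k g \<Longrightarrow> differentiable_order k (\<lambda>x. f x * g x)"
proof (induction k arbitrary: f g)
  case (Suc k)
  then have "f differentiable (at x)" "g differentiable (at x)" for x by auto
  \<comment> \<open>The product rule leaves one factor undifferentiated, and that factor is needed
    at order \<open>k\<close> as well.\<close>
  moreover have "differentiable_order k f" "differentiable_order k g"
    using Suc.prems differentiable_order_SucD by blast+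
  ultimately show ?case
    using Suc by (simp add: dir_deriv_mult differentiable_order_add)
qed auto

lemma differentiable_order_sum:
  "finite A \<Longrightarrow> (\<And>a. a \<in> A \<Longrightarrow> differentiable_order k (f a)) \<Longrightarrow> differentiable_order k (\<lambda>x. \<Sum>a\<in>A. f a x)"
  by (induction A rule: finite_induct) (auto intro: differentiable_order_add differentiable_order_const)

text \<open>The spaces on both sides of \<open>L\<close> may differ, so one lemma covers
  reflections, dilations, the projections \<open>fst\<close> and \<open>snd\<close> of space-time
  and the embedding of a line. Each partial derivative of the composition is a combination, with
  constant coefficients, of partial derivatives of \<open>f\<close> composed with the same
  map.\<close>

lemma differentiable_order_affine:
  fixes L :: "'b::euclidean_space \<Rightarrow> 'a::euclidean_space"
  assumes L: "linear L"
  shows "differentiable_order k f \<Longrightarrow> differentiable_order k (\<lambda>x. f (L x + c))"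
proof (induction k arbitrary: f)
  case 0
  then show ?case using differentiable_affine[OF L, of f] by simp
next
  case (Suc k)
  then have d: "\<And>x. f differentiable (at x)" by auto
  show ?case
    using Suc differentiable_affine[OF L d]
    by (auto simp: dir_deriv_affine[OF L d]
        intro!: differentiable_order_sum differentiable_order_mult[OF differentiable_order_const])
qed

lemma smooth_const: "smooth (\<lambda>_. c)"
  and smooth_mult: "smooth f \<Longrightarrow> smooth g \<Longrightarrow> smooth (\<lambda>x. f x * g x)"
  by (auto simp: smooth_iff_order differentiable_order_const differentiable_order_mult)

lemma smooth_affine:
  fixes L :: "'b::euclidean_space \<Rightarrow> 'a::euclidean_space"
  shows "linear L \<Longrightarrow> smooth f \<Longrightarrow> smooth (\<lambda>x. f (L x + c))"
  by (auto simp: smooth_iff_order differentiable_order_affine)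

lemma smooth_reflect: "smooth f \<Longrightarrow> smooth (\<lambda>y. f (x - y))"
  using smooth_affine[OF linear_uminus, of f x] by simp

lemma sum_inner_Basis:
  assumes "e \<in> Basis"
  shows "(\<Sum>b\<in>Basis. (e \<bullet> b) * F b) = (F e :: real)"
proof -
  have "(\<Sum>b\<in>Basis. (e \<bullet> b) * F b) = (\<Sum>b\<in>Basis. if e = b then F b else 0)"
    using assms by (intro sum.cong) (auto simp: inner_Basis)
  with assms show ?thesis by simp
qed

lemma dir_deriv_reflect:
  assumes f: "\<And>x. f differentiable (at x)" and b: "b \<in> Basis"
  shows "dir_deriv b (\<lambda>y. f (x - y)) = (\<lambda>y. - dir_deriv b f (x - y))"
proof
  fix y
  have "dir_deriv b (\<lambda>y. f (- y + x)) y = (\<Sum>b'\<in>Basis. (- b \<bullet> b') * dir_deriv b' f (- y + x))"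
    by (subst dir_deriv_affine[of uminus f b x, OF linear_uminus f]) simp
  also have "\<dots> = - (\<Sum>b'\<in>Basis. (b \<bullet> b') * dir_deriv b' f (- y + x))"
    by (simp add: sum_negf)
  also have "\<dots> = - dir_deriv b f (- y + x)"
    by (subst sum_inner_Basis[OF b]) simp
  finally show "dir_deriv b (\<lambda>y. f (x - y)) y = - dir_deriv b f (x - y)" by simp
qed

section \<open>Supports and bounds of test functions\<close>

lemma test_fun_smooth: "test_fun_on S f \<Longrightarrow> smooth f"
  by (simp add: test_fun_on_def)

lemma test_fun_continuous: "test_fun_on S f \<Longrightarrow> continuous_on A f"
  using smooth_imp_continuous test_fun_smooth by blast

lemma nonzero_in_supp: "f x \<noteq> 0 \<Longrightarrow> x \<in> supp f"
  unfolding supp_def by (rule subsetD[OF closure_subset]) simp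

lemma test_fun_outside_ball:
  assumes "test_fun_on S f"
  obtains R where "R > 0" "\<And>x. norm x \<ge> R \<Longrightarrow> f x = 0"
proof -
  have "bounded (supp f)" using assms compact_imp_bounded by (auto simp: test_fun_on_def)
  then obtain R where R: "R > 0" "\<And>x. x \<in> supp f \<Longrightarrow> norm x \<le> R"
    by (auto simp: bounded_pos)
  \<comment> \<open>Points of the support may have norm equal to \<open>R\<close>; adding 1 permits
    the non-strict inequality.\<close>
  have "f x = 0" if "norm x \<ge> R + 1" for x
  proof (rule ccontr)
    assume "f x \<noteq> 0"
    then have "x \<in> supp f" by (rule nonzero_in_supp)
    with R(2) that show False by force
  qed
  with R(1) that[of "R + 1"] show thesis by simp
qed

text \<open>Together with \<open>test_fun_outside_ball\<close> this replaces the closure in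
  \<open>supp\<close> by a radius, which reflections, products and dilations transform
  explicitly.\<close>

lemma test_fun_outside_ballI:
  assumes "smooth f" "\<And>x. norm x \<ge> R \<Longrightarrow> f x = 0"
  shows "test_fun f"
proof -
  have "{x. f x \<noteq> 0} \<subseteq> cball 0 R" using assms(2) by (force simp: not_le)
  then have "bounded {x. f x \<noteq> 0}" using bounded_cball bounded_subset by blast
  then show ?thesis using assms(1) by (auto simp: test_fun_on_def supp_def)
qed

lemma test_fun_bounded:
  assumes "test_fun_on S f"
  obtains B where "B > 0" "\<And>x. \<bar>f x\<bar> \<le> B"
proof -
  obtain R where R: "\<And>x. norm x \<ge> R \<Longrightarrow> f x = 0" using test_fun_outside_ball[OF assms] by blast
  have "bounded (f ` cball 0 R)"
    by (intro compact_imp_bounded compact_continuous_image test_fun_continuous[OF assms]) simp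
  then obtain B where B: "B > 0" "\<And>x. norm x \<le> R \<Longrightarrow> \<bar>f x\<bar> \<le> B"
    unfolding bounded_pos by auto
  have "\<bar>f x\<bar> \<le> B" for x
    using B(1) B(2)[of x] R[of x] by (cases "norm x \<le> R") auto
  with B(1) that show thesis by blast
qed

lemma dir_deriv_zero_on_open:
  assumes "open U" "x \<in> U" "\<And>y. y \<in> U \<Longrightarrow> f y = 0"
  shows "dir_deriv b f x = 0"
proof -
  have "(f has_derivative (\<lambda>_. 0)) (at x)"
    by (rule has_derivative_transform_within_open[OF has_derivative_const[of 0] assms(1,2)]) (use assms(3) in auto)
  from dir_deriv_eqI[OF this] show ?thesis .
qed

text \<open>Off the closed set \<open>supp f\<close> the function vanishes on a neighbourhood, so
  its derivatives vanish there too.\<close>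

lemma test_fun_dir_deriv:
  assumes f: "test_fun_on S f" and b: "b \<in> Basis"
  shows "test_fun_on S (dir_deriv b f)"
proof -
  have "dir_deriv b f x = 0" if "x \<notin> supp f" for x
  proof (rule dir_deriv_zero_on_open[of "- supp f"])
    show "f y = 0" if "y \<in> - supp f" for y
      using that nonzero_in_supp by blast
  qed (use that in \<open>auto simp: supp_def\<close>)
  then have "supp (dir_deriv b f) \<subseteq> supp f"
    unfolding supp_def[of "dir_deriv b f"] by (intro closure_minimal) (auto simp: supp_def)
  moreover have "closed (supp (dir_deriv b f))" by (simp add: supp_def)
  ultimately show ?thesis
    using f smooth_dir_deriv[OF _ b] unfolding test_fun_on_def
    by (metis compact_Int_closed inf.absorb2 subset_trans)
qed

lemma test_fun_reflect:
  assumes "test_fun f" shows "test_fun (\<lambda>y. f (x - y))"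
proof -
  obtain R where R: "\<And>x. norm x \<ge> R \<Longrightarrow> f x = 0" using test_fun_outside_ball[OF assms] by blast
  show ?thesis
  proof (rule test_fun_outside_ballI[where R = "R + norm x"])
    show "smooth (\<lambda>y. f (x - y))" using assms smooth_reflect test_fun_smooth by blast
    show "f (x - y) = 0" if "R + norm x \<le> norm y" for y
      using R[of "x - y"] norm_triangle_sub[of y x] that by (auto simp: norm_minus_commute)
  qed
qed

lemma test_fun_mult_smooth:
  assumes "test_fun f" "smooth g" shows "test_fun (\<lambda>x. f x * g x)"
proof -
  obtain R where R: "\<And>x. norm x \<ge> R \<Longrightarrow> f x = 0" using test_fun_outside_ball[OF assms(1)] by blast
  show ?thesis
    using R by (intro test_fun_outside_ballI[where R = R] smooth_mult test_fun_smooth[OF assms(1)] assms(2)) auto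
qed

section \<open>Tensor products on space-time\<close>

lemma dir_deriv_fst:
  assumes a: "\<And>t. a differentiable (at t)"
  shows "dir_deriv (c, d) (\<lambda>z. a (fst z)) = (\<lambda>z. c * dir_deriv (1::real) a (fst z))"
  using dir_deriv_affine[of fst a "(c, d)" 0, OF linear_fst a] by simp

lemma dir_deriv_snd:
  fixes \<theta> :: "'a::euclidean_space \<Rightarrow> real" and c :: "'b::euclidean_space"
  assumes th: "\<And>x. \<theta> differentiable (at x)" and b: "b \<in> Basis"
  shows "dir_deriv (c, b) (\<lambda>z. \<theta> (snd z)) = (\<lambda>z. dir_deriv b \<theta> (snd z))"
proof
  fix z :: "'b \<times> 'a"
  have "dir_deriv (c, b) (\<lambda>z. \<theta> (snd z + 0)) z = (\<Sum>b'\<in>Basis. (b \<bullet> b') * dir_deriv b' \<theta> (snd z))"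
    by (subst dir_deriv_affine[OF linear_snd th]) simp
  then show "dir_deriv (c, b) (\<lambda>z. \<theta> (snd z)) z = dir_deriv b \<theta> (snd z)"
    by (subst (asm) sum_inner_Basis[OF b]) simp
qed

lemma dir_deriv_snd_0:
  assumes th: "\<And>x. \<theta> differentiable (at x)"
  shows "dir_deriv (c, 0) (\<lambda>z. \<theta> (snd z)) = (\<lambda>z. 0)"
  using dir_deriv_affine[of snd \<theta> "(c, 0)" 0, OF linear_snd th] by simp

lemma smooth_fst: "smooth a \<Longrightarrow> smooth (\<lambda>z. a (fst z))"
  using smooth_affine[OF linear_fst, of a 0] by simp

lemma smooth_snd: "smooth a \<Longrightarrow> smooth (\<lambda>z. a (snd z))"
  using smooth_affine[OF linear_snd, of a 0] by simp

text \<open>Tensor products are the only space-time test functions that the proof feeds into the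
  equation. Each directional derivative sees one of the factors as a constant, which separates the
  time derivative from the Laplacian.\<close>

lemma heat_transpose_tensor:
  fixes a :: "real \<Rightarrow> real" and \<theta> :: "'a::euclidean_space \<Rightarrow> real"
  assumes a: "smooth a" and th: "smooth \<theta>"
  shows "heat_transpose p (\<lambda>z. a (fst z) * \<theta> (snd z)) (t, x) =
    - dir_deriv 1 a t * \<theta> x - a t * (\<Sum>b\<in>Basis. dir_deriv b (dir_deriv b \<theta>) x) + p x * (a t * \<theta> x)"
proof -
  have da: "\<And>t. a differentiable (at t)" and dth: "\<And>x. \<theta> differentiable (at x)"
    using a th smooth_imp_differentiable by blast+
  have da': "\<And>z. (\<lambda>z::real \<times> 'a. a (fst z)) differentiable (at z)"
    using a smooth_fst smooth_imp_differentiable by blast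
  have ds: "\<And>z. (\<lambda>z::real \<times> 'a. \<theta> (snd z)) differentiable (at z)" if "smooth \<theta>" for \<theta>
    using that smooth_snd smooth_imp_differentiable by blast
  \<comment> \<open>Stated for an arbitrary smooth second factor because it is applied twice, to
    \<open>\<theta>\<close> and then to \<open>dir_deriv b \<theta>\<close>.\<close>
  have 1: "dir_deriv (0, b) (\<lambda>z. a (fst z) * \<theta> (snd z)) = (\<lambda>z. a (fst z) * dir_deriv b \<theta> (snd z))"
    if "b \<in> Basis" "smooth \<theta>" for b :: 'a and \<theta>
    unfolding dir_deriv_mult[OF da' ds[OF that(2)]] dir_deriv_fst[OF da]
      dir_deriv_snd[of \<theta>, OF smooth_imp_differentiable[OF that(2)] that(1)] by simp
  have 2: "dir_deriv (1, 0) (\<lambda>z. a (fst z) * \<theta> (snd z)) (t, x) = dir_deriv 1 a t * \<theta> x"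
    unfolding dir_deriv_mult[OF da' ds[OF th]] dir_deriv_fst[OF da] dir_deriv_snd_0[OF dth] by simp
  have "iter_deriv [(0, b), (0, b)] (\<lambda>z. a (fst z) * \<theta> (snd z)) (t, x) = a t * dir_deriv b (dir_deriv b \<theta>) x"
    if "b \<in> Basis" for b
    using 1[OF that th] 1[OF that smooth_dir_deriv[OF th that]] by simp
  then have "(\<Sum>b\<in>Basis. iter_deriv [(0, b), (0, b)] (\<lambda>z. a (fst z) * \<theta> (snd z)) (t, x))
      = a t * (\<Sum>b\<in>Basis. dir_deriv b (dir_deriv b \<theta>) x)"
    by (simp add: sum_distrib_left)
  then show ?thesis unfolding heat_transpose_def 2 by simp
qed

lemma test_fun_tensor:
  fixes a :: "real \<Rightarrow> real" and \<theta> :: "'a::euclidean_space \<Rightarrow> real"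
  assumes a: "test_fun_on S a" and th: "test_fun \<theta>"
  shows "test_fun_on (S \<times> UNIV) (\<lambda>z. a (fst z) * \<theta> (snd z))"
proof -
  have "supp (\<lambda>z. a (fst z) * \<theta> (snd z)) \<subseteq> supp a \<times> supp \<theta>" (is "supp ?f \<subseteq> ?K")
    unfolding supp_def[of ?f]
  proof (rule closure_minimal)
    show "closed ?K" by (simp add: supp_def closed_Times)
  qed (auto simp: nonzero_in_supp)
  moreover have "compact ?K" using a th by (auto simp: test_fun_on_def compact_Times)
  moreover have "closed (supp ?f)" by (simp add: supp_def)
  ultimately have "compact (supp ?f)" using compact_Int_closed[of ?K "supp ?f"] by (simp add: inf.absorb2)
  moreover have "smooth ?f" using a th by (intro smooth_mult smooth_fst smooth_snd test_fun_smooth)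
  moreover have "supp ?f \<subseteq> S \<times> UNIV"
    using \<open>supp ?f \<subseteq> ?K\<close> a by (auto simp: test_fun_on_def)
  ultimately show ?thesis by (simp add: test_fun_on_def)
qed

section \<open>The space of square-integrable functions\<close>

lemma integrable_mult_of_squares:
  fixes a b :: "'a \<Rightarrow> real"
  assumes [measurable]: "a \<in> borel_measurable M" "b \<in> borel_measurable M"
    and a: "integrable M (\<lambda>x. (a x)\<^sup>2)" and b: "integrable M (\<lambda>x. (b x)\<^sup>2)"
  shows "integrable M (\<lambda>x. a x * b x)"
proof (rule Bochner_Integration.integrable_bound)
  show "integrable M (\<lambda>x. (a x)\<^sup>2 + (b x)\<^sup>2)" using a b by auto
  show "AE x in M. norm (a x * b x) \<le> norm ((a x)\<^sup>2 + (b x)\<^sup>2)"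
  proof (rule AE_I2)
    fix x
    have "0 \<le> (\<bar>a x\<bar> - \<bar>b x\<bar>)\<^sup>2" by simp
    then have "2 * (\<bar>a x\<bar> * \<bar>b x\<bar>) \<le> (a x)\<^sup>2 + (b x)\<^sup>2" by (simp add: power2_diff)
    moreover have "0 \<le> \<bar>a x\<bar> * \<bar>b x\<bar>" by simp
    ultimately have "\<bar>a x\<bar> * \<bar>b x\<bar> \<le> (a x)\<^sup>2 + (b x)\<^sup>2" by linarith
    then show "norm (a x * b x) \<le> norm ((a x)\<^sup>2 + (b x)\<^sup>2)" by (simp add: abs_mult)
  qed
qed simp

text \<open>The quadratic polynomial \<open>q\<close> in \<open>l\<close> is the integral of the
  square of \<open>l * a x + b x\<close>, hence nonnegative; a good choice of \<open>l\<close>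
  bounds its discriminant.\<close>

lemma integral_Cauchy_Schwarz:
  fixes a b :: "'a \<Rightarrow> real"
  assumes [measurable]: "a \<in> borel_measurable M" "b \<in> borel_measurable M"
    and a: "integrable M (\<lambda>x. (a x)\<^sup>2)" and b: "integrable M (\<lambda>x. (b x)\<^sup>2)"
  shows "\<bar>\<integral>x. a x * b x \<partial>M\<bar> \<le> sqrt (\<integral>x. (a x)\<^sup>2 \<partial>M) * sqrt (\<integral>x. (b x)\<^sup>2 \<partial>M)"
proof -
  define A B I where "A = (\<integral>x. (a x)\<^sup>2 \<partial>M)" "B = (\<integral>x. (b x)\<^sup>2 \<partial>M)" "I = (\<integral>x. a x * b x \<partial>M)"
  note ab = integrable_mult_of_squares[OF assms]
  have q: "0 \<le> l\<^sup>2 * A + 2 * l * I + B" for l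
  proof -
    have "0 \<le> (\<integral>x. (l * a x + b x)\<^sup>2 \<partial>M)" by simp
    also have "\<dots> = (\<integral>x. l\<^sup>2 * (a x)\<^sup>2 + 2 * l * (a x * b x) + (b x)\<^sup>2 \<partial>M)"
      by (rule Bochner_Integration.integral_cong) (auto simp: power2_eq_square algebra_simps)
    also have "\<dots> = l\<^sup>2 * A + 2 * l * I + B" using a b ab by (simp add: A_B_I_def)
    finally show ?thesis .
  qed
  have AB: "A \<ge> 0" "B \<ge> 0" by (auto simp: A_B_I_def)
  have "I\<^sup>2 \<le> A * B"
  proof (cases "A = 0")
    case True
    have "I = 0"
    proof (rule ccontr)
      assume "I \<noteq> 0"
      \<comment> \<open>For \<open>A = 0\<close> the polynomial is affine in \<open>l\<close>, and
        this argument gives it the value -1.\<close>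
      with q[of "- (B + 1) / (2 * I)"] True AB show False by (simp add: field_simps)
    qed
    with True show ?thesis by simp
  next
    case False
    \<comment> \<open>The minimiser of the polynomial is \<open>- I / A\<close>.\<close>
    have "(- I / A)\<^sup>2 * A + 2 * (- I / A) * I + B = B - I\<^sup>2 / A"
      using False by (simp add: field_simps power2_eq_square)
    with q[of "- I / A"] have "I\<^sup>2 / A \<le> B" by linarith
    with False AB show ?thesis by (simp add: field_simps)
  qed
  then have "\<bar>I\<bar> \<le> sqrt (A * B)" using real_le_rsqrt[of "\<bar>I\<bar>"] by simp
  then show ?thesis by (simp add: A_B_I_def real_sqrt_mult)
qed

text \<open>On complex numbers the inner product is the real part of \<open>f x * cnj (g x)\<close>.
  This is therefore the real part of the Hermitian product: real bilinear, symmetric, and with the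
  squared L2 norm on the diagonal.\<close>

definition L2_inner :: "('a::euclidean_space \<Rightarrow> complex) \<Rightarrow> ('a \<Rightarrow> complex) \<Rightarrow> real" where
  "L2_inner f g = (\<integral>x. f x \<bullet> g x \<partial>lborel)"

lemma in_L2_measurable: "in_L2 f \<Longrightarrow> f \<in> borel_measurable borel"
  by (simp add: in_L2_def)

lemma in_L2_norm_integrable: "in_L2 f \<Longrightarrow> integrable lborel (\<lambda>x. (norm (f x))\<^sup>2)"
  by (simp add: in_L2_def)

lemma in_L2_bound:
  assumes "f \<in> borel_measurable borel" and "integrable lborel g"
    and "AE x in lborel. (norm (f x))\<^sup>2 \<le> g x"
  shows "in_L2 f"
proof -
  note [measurable] = assms(1)
  have "integrable lborel (\<lambda>x. (norm (f x))\<^sup>2)"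
    by (rule Bochner_Integration.integrable_bound[OF assms(2)]) (use assms(3) in auto)
  then show ?thesis using assms(1) by (simp add: in_L2_def)
qed

lemma norm_add_square_le:
  fixes x y :: "'a::real_inner"
  shows "(norm (x + y))\<^sup>2 \<le> 2 * (norm x)\<^sup>2 + 2 * (norm y)\<^sup>2"
proof -
  have "0 \<le> (norm (x - y))\<^sup>2" by simp
  then show ?thesis by (simp add: power2_norm_eq_inner inner_simps inner_commute)
qed

lemma in_L2_add:
  assumes "in_L2 f" "in_L2 g" shows "in_L2 (\<lambda>x. f x + g x)"
proof (rule in_L2_bound)
  show "integrable lborel (\<lambda>x. 2 * (norm (f x))\<^sup>2 + 2 * (norm (g x))\<^sup>2)"
    using assms[THEN in_L2_norm_integrable] by simp
qed (use assms[THEN in_L2_measurable] norm_add_square_le in auto)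

lemma in_L2_bounded_mult:
  assumes f: "in_L2 f" and m: "m \<in> borel_measurable borel" "AE x in lborel. \<bar>m x\<bar> \<le> B"
  shows "in_L2 (\<lambda>x. m x *\<^sub>R f x)"
proof (rule in_L2_bound)
  show "integrable lborel (\<lambda>x. B\<^sup>2 * (norm (f x))\<^sup>2)"
    using f in_L2_norm_integrable by auto
  show "AE x in lborel. (norm (m x *\<^sub>R f x))\<^sup>2 \<le> B\<^sup>2 * (norm (f x))\<^sup>2"
    using m(2)
  proof eventually_elim
    case (elim x)
    then have "(m x)\<^sup>2 \<le> B\<^sup>2" using power_mono[of "\<bar>m x\<bar>" B 2] by simp
    then show ?case by (simp add: power_mult_distrib mult_right_mono)
  qed
qed (use m in_L2_measurable[OF f] in auto)

lemma in_L2_scaleR: "in_L2 f \<Longrightarrow> in_L2 (\<lambda>x. c *\<^sub>R f x)"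
  by (rule in_L2_bounded_mult[where B = "\<bar>c\<bar>"]) auto

lemma in_L2_diff: "in_L2 f \<Longrightarrow> in_L2 g \<Longrightarrow> in_L2 (\<lambda>x. f x - g x)"
  using in_L2_add[of f "\<lambda>x. (-1) *\<^sub>R g x"] in_L2_scaleR[of g "-1"] by simp

lemma in_L2_zero: "in_L2 (\<lambda>_. 0)"
  by (simp add: in_L2_def)

lemma integrable_norm_mult_L2:
  assumes "in_L2 f" "in_L2 g" shows "integrable lborel (\<lambda>x. norm (f x) * norm (g x))"
  using assms in_L2_measurable by (intro integrable_mult_of_squares) (auto simp: in_L2_def)

lemma integral_norm_mult_L2_le:
  assumes "in_L2 f" "in_L2 g"
  shows "(\<integral>x. norm (f x) * norm (g x) \<partial>lborel) \<le> L2_norm f * L2_norm g"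
  using integral_Cauchy_Schwarz[of "\<lambda>x. norm (f x)" lborel "\<lambda>x. norm (g x)"] assms in_L2_measurable
  by (auto simp: in_L2_def L2_norm_def)

lemma integrable_L2_inner:
  assumes "in_L2 f" "in_L2 g" shows "integrable lborel (\<lambda>x. f x \<bullet> g x)"
  by (rule Bochner_Integration.integrable_bound[OF integrable_norm_mult_L2[OF assms]])
    (use assms[THEN in_L2_measurable] Cauchy_Schwarz_ineq2 in \<open>auto simp: abs_mult\<close>)

lemma L2_norm_nonneg: "0 \<le> L2_norm f"
  by (simp add: L2_norm_def)

lemma L2_inner_self: "L2_inner f f = (L2_norm f)\<^sup>2"
  by (simp add: L2_inner_def L2_norm_def power2_norm_eq_inner)

lemma L2_inner_commute: "L2_inner f g = L2_inner g f"
  by (simp add: L2_inner_def inner_commute)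

lemma L2_inner_le:
  assumes "in_L2 f" "in_L2 g" shows "\<bar>L2_inner f g\<bar> \<le> L2_norm f * L2_norm g"
proof -
  have "\<bar>L2_inner f g\<bar> \<le> (\<integral>x. norm (f x) * norm (g x) \<partial>lborel)"
    unfolding L2_inner_def real_norm_def[symmetric]
    by (rule Bochner_Integration.integral_norm_bound_integral[OF integrable_L2_inner[OF assms] integrable_norm_mult_L2[OF assms]])
      (simp add: Cauchy_Schwarz_ineq2)
  also note integral_norm_mult_L2_le[OF assms]
  finally show ?thesis .
qed

lemma L2_inner_add_left:
  "in_L2 f \<Longrightarrow> in_L2 g \<Longrightarrow> in_L2 h \<Longrightarrow> L2_inner (\<lambda>x. f x + g x) h = L2_inner f h + L2_inner g h"
  by (simp add: L2_inner_def inner_add_left integrable_L2_inner)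

lemma L2_inner_diff_left:
  "in_L2 f \<Longrightarrow> in_L2 g \<Longrightarrow> in_L2 h \<Longrightarrow> L2_inner (\<lambda>x. f x - g x) h = L2_inner f h - L2_inner g h"
  by (simp add: L2_inner_def inner_diff_left integrable_L2_inner)

lemma L2_inner_add_right:
  "in_L2 f \<Longrightarrow> in_L2 g \<Longrightarrow> in_L2 h \<Longrightarrow> L2_inner h (\<lambda>x. f x + g x) = L2_inner h f + L2_inner h g"
  by (simp add: L2_inner_def inner_add_right integrable_L2_inner)

lemma L2_inner_diff_right:
  "in_L2 f \<Longrightarrow> in_L2 g \<Longrightarrow> in_L2 h \<Longrightarrow> L2_inner h (\<lambda>x. f x - g x) = L2_inner h f - L2_inner h g"
  by (simp add: L2_inner_def inner_diff_right integrable_L2_inner)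

lemma L2_norm_triangle:
  assumes "in_L2 f" "in_L2 g" shows "L2_norm (\<lambda>x. f x + g x) \<le> L2_norm f + L2_norm g"
proof -
  note fg = in_L2_add[OF assms]
  have "(L2_norm (\<lambda>x. f x + g x))\<^sup>2 = (L2_norm f)\<^sup>2 + 2 * L2_inner f g + (L2_norm g)\<^sup>2"
    unfolding L2_inner_self[symmetric]
    using assms fg by (simp add: L2_inner_add_left L2_inner_add_right L2_inner_commute[of g f])
  also have "\<dots> \<le> (L2_norm f + L2_norm g)\<^sup>2"
    using L2_inner_le[OF assms] by (simp add: power2_sum)
  finally show ?thesis
    by (rule power2_le_imp_le) (simp add: L2_norm_nonneg)
qed

lemma L2_norm_minus_commute: "L2_norm (\<lambda>x. f x - g x) = L2_norm (\<lambda>x. g x - f x)"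
  by (simp add: L2_norm_def norm_minus_commute)

lemma L2_norm_triangle_diff:
  assumes "in_L2 f" "in_L2 g" "in_L2 h"
  shows "L2_norm (\<lambda>x. f x - h x) \<le> L2_norm (\<lambda>x. f x - g x) + L2_norm (\<lambda>x. g x - h x)"
  using L2_norm_triangle[OF in_L2_diff[OF assms(1,2)] in_L2_diff[OF assms(2,3)]] by simp

lemma L2_norm_minus_le:
  assumes "in_L2 f" "in_L2 g" shows "L2_norm (\<lambda>x. f x - g x) \<le> L2_norm f + L2_norm g"
  using L2_norm_triangle_diff[OF assms(1) in_L2_zero assms(2)] by (simp add: L2_norm_def)

lemma L2_norm_abs_diff_le:
  assumes "in_L2 f" "in_L2 g" shows "\<bar>L2_norm f - L2_norm g\<bar> \<le> L2_norm (\<lambda>x. f x - g x)"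
  using L2_norm_triangle_diff[OF assms(1,2) in_L2_zero] L2_norm_triangle_diff[OF assms(2,1) in_L2_zero]
    L2_norm_minus_commute[of f g] by auto

lemma L2_norm_bounded_mult:
  assumes f: "in_L2 f" and m: "m \<in> borel_measurable borel" "AE x in lborel. \<bar>m x\<bar> \<le> B" and B: "B \<ge> 0"
  shows "L2_norm (\<lambda>x. m x *\<^sub>R f x) \<le> B * L2_norm f"
proof -
  have "(\<integral>x. (norm (m x *\<^sub>R f x))\<^sup>2 \<partial>lborel) \<le> (\<integral>x. B\<^sup>2 * (norm (f x))\<^sup>2 \<partial>lborel)"
  proof (rule integral_mono_AE)
    show "integrable lborel (\<lambda>x. (norm (m x *\<^sub>R f x))\<^sup>2)"
      by (rule in_L2_norm_integrable[OF in_L2_bounded_mult[OF f m]])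
    show "AE x in lborel. (norm (m x *\<^sub>R f x))\<^sup>2 \<le> B\<^sup>2 * (norm (f x))\<^sup>2"
      using m(2)
    proof eventually_elim
      case (elim x)
      then have "(m x)\<^sup>2 \<le> B\<^sup>2" using power_mono[of "\<bar>m x\<bar>" B 2] by simp
      then show ?case by (simp add: power_mult_distrib mult_right_mono)
    qed
  qed (use f in_L2_norm_integrable in auto)
  then have "L2_norm (\<lambda>x. m x *\<^sub>R f x) \<le> sqrt (B\<^sup>2 * (\<integral>x. (norm (f x))\<^sup>2 \<partial>lborel))"
    unfolding L2_norm_def by (intro real_sqrt_le_mono) simp
  then show ?thesis using B by (simp add: L2_norm_def real_sqrt_mult)
qed

lemma L2_norm_cong_AE:
  assumes "f \<in> borel_measurable borel" "g \<in> borel_measurable borel" "AE x in lborel. f x = g x"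
  shows "L2_norm f = L2_norm g"
  unfolding L2_norm_def using assms by (auto intro!: arg_cong[where f = sqrt] integral_cong_AE)

lemma in_L2_of_continuous:
  fixes f :: "'a::euclidean_space \<Rightarrow> complex"
  assumes f: "continuous_on (cball 0 R) f" "f \<in> borel_measurable borel" and R: "\<And>x. norm x > R \<Longrightarrow> f x = 0"
  shows "in_L2 f"
proof -
  have "bounded (f ` cball 0 R)"
    by (intro compact_imp_bounded compact_continuous_image f) simp
  then obtain B where B: "B > 0" "\<And>x. norm x \<le> R \<Longrightarrow> norm (f x) \<le> B"
    unfolding bounded_pos by auto
  show ?thesis
  proof (rule in_L2_bound[OF f(2)])
    show "integrable lborel (\<lambda>x::'a. B\<^sup>2 * indicator (cball 0 R) x)"
      by (intro integrable_mult_right integrable_real_indicator) (auto intro: emeasure_lborel_cball_finite[unfolded infinity_ennreal_def])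
    show "AE x in lborel. (norm (f x))\<^sup>2 \<le> B\<^sup>2 * indicator (cball 0 R) x"
      using B R by (auto simp: indicator_def not_le intro!: power_mono)
  qed
qed

lemma test_fun_measurable: "test_fun_on S f \<Longrightarrow> f \<in> borel_measurable borel"
  by (simp add: borel_measurable_continuous_onI test_fun_continuous)

lemma in_L2_test_fun:
  assumes "test_fun_on S \<phi>" shows "in_L2 (\<lambda>x. complex_of_real (\<phi> x))"
proof -
  obtain R where R: "\<And>x. norm x \<ge> R \<Longrightarrow> \<phi> x = 0" using test_fun_outside_ball[OF assms] by blast
  show ?thesis
  proof (rule in_L2_of_continuous[where R = R])
    show "continuous_on (cball 0 R) (\<lambda>x. complex_of_real (\<phi> x))"
      using test_fun_continuous[OF assms] by (intro continuous_on_of_real)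
  qed (use test_fun_measurable[OF assms] R in auto)
qed

lemma integrable_test_fun_L2:
  assumes "test_fun_on S \<phi>" "in_L2 f" shows "integrable lborel (\<lambda>x. \<phi> x *\<^sub>R f x)"
  by (rule Bochner_Integration.integrable_bound[OF integrable_norm_mult_L2[OF in_L2_test_fun[OF assms(1)] assms(2)]])
    (use test_fun_measurable[OF assms(1)] in_L2_measurable[OF assms(2)] in auto)

lemma integrable_test_fun:
  assumes "test_fun_on S (\<phi> :: 'a::euclidean_space \<Rightarrow> real)" shows "integrable lborel \<phi>"
proof -
  obtain R where R: "\<And>x. norm x \<ge> R \<Longrightarrow> \<phi> x = 0" using test_fun_outside_ball[OF assms] by blast
  obtain B where B: "B > 0" "\<And>x. \<bar>\<phi> x\<bar> \<le> B" using test_fun_bounded[OF assms] by blast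
  show ?thesis
  proof (rule Bochner_Integration.integrable_bound)
    show "integrable lborel (\<lambda>x::'a. B * indicator (cball 0 R) x)"
      by (intro integrable_mult_right integrable_real_indicator) (auto intro: emeasure_lborel_cball_finite[unfolded infinity_ennreal_def])
    show "AE x in lborel. norm (\<phi> x) \<le> norm (B * indicator (cball 0 R) x)"
      using B R by (auto simp: indicator_def)
  qed (use test_fun_measurable[OF assms] in auto)
qed

lemma norm_integral_test_fun_L2_le:
  assumes "test_fun_on S \<phi>" "in_L2 f"
  shows "norm (\<integral>x. \<phi> x *\<^sub>R f x \<partial>lborel) \<le> L2_norm (\<lambda>x. complex_of_real (\<phi> x)) * L2_norm f"
proof -
  have "norm (\<integral>x. \<phi> x *\<^sub>R f x \<partial>lborel) \<le> (\<integral>x. norm (complex_of_real (\<phi> x)) * norm (f x) \<partial>lborel)"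
    by (rule Bochner_Integration.integral_norm_bound_integral[OF integrable_test_fun_L2[OF assms]
          integrable_norm_mult_L2[OF in_L2_test_fun[OF assms(1)] assms(2)]]) simp
  also note integral_norm_mult_L2_le[OF in_L2_test_fun[OF assms(1)] assms(2)]
  finally show ?thesis .
qed

section \<open>Convolution with test functions\<close>

lemma test_fun_has_derivative:
  "test_fun_on S f \<Longrightarrow> (f has_derivative (\<lambda>h. \<Sum>b\<in>Basis. (h \<bullet> b) * dir_deriv b f x)) (at x)"
  by (intro has_derivative_dir_deriv smooth_imp_differentiable test_fun_smooth)

lemma test_fun_lipschitz:
  assumes "test_fun f"
  obtains C where "C \<ge> 0" "\<And>x y. \<bar>f x - f y\<bar> \<le> C * norm (x - y)"
proof -
  have "\<forall>b\<in>Basis. \<exists>B. \<forall>x. \<bar>dir_deriv b f x\<bar> \<le> B"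
    using test_fun_dir_deriv[OF assms] test_fun_bounded by metis
  then obtain B where B: "\<And>b x. b \<in> Basis \<Longrightarrow> \<bar>dir_deriv b f x\<bar> \<le> B b" by metis
  define C where "C = (\<Sum>b\<in>Basis. B b)"
  have "C \<ge> 0" unfolding C_def using B by (intro sum_nonneg) (meson abs_ge_zero order_trans)
  have on: "onorm (\<lambda>h. \<Sum>b\<in>Basis. (h \<bullet> b) * dir_deriv b f x) \<le> C" for x
  proof (rule onorm_le)
    fix h :: 'a
    have "norm (\<Sum>b\<in>Basis. (h \<bullet> b) * dir_deriv b f x) \<le> (\<Sum>b\<in>Basis. B b * norm h)"
    proof (rule sum_norm_le)
      fix b :: 'a assume "b \<in> Basis"
      then show "norm ((h \<bullet> b) * dir_deriv b f x) \<le> B b * norm h"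
        using B[of b x] Basis_le_norm[of b h] mult_mono[of "\<bar>h \<bullet> b\<bar>" "norm h" "\<bar>dir_deriv b f x\<bar>" "B b"]
        by (simp add: abs_mult mult.commute)
    qed
    then show "norm (\<Sum>b\<in>Basis. (h \<bullet> b) * dir_deriv b f x) \<le> C * norm h"
      by (simp add: C_def sum_distrib_right)
  qed
  have "norm (f x - f y) \<le> C * norm (x - y)" for x y
    by (rule differentiable_bound[of UNIV f "\<lambda>x h. \<Sum>b\<in>Basis. (h \<bullet> b) * dir_deriv b f x"])
      (use on test_fun_has_derivative[OF assms] in auto)
  with \<open>C \<ge> 0\<close> that show thesis by auto
qed

text \<open>The mean value inequality is applied to \<open>f\<close> minus its linearisation at
  \<open>x\<close>. On the ball of radius \<open>norm h\<close> the derivative of that difference is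
  of order \<open>norm h\<close>, because the partial derivatives are Lipschitz. The remainder is
  uniform in \<open>x\<close>, as needed for integrating it in
  \<open>has_derivative_fun_conv\<close>.\<close>

lemma test_fun_taylor:
  assumes f: "test_fun f"
  obtains C where "C \<ge> 0"
    "\<And>x h. \<bar>f (x + h) - f x - (\<Sum>b\<in>Basis. (h \<bullet> b) * dir_deriv b f x)\<bar> \<le> C * (norm h)\<^sup>2"
proof -
  have "\<forall>b\<in>Basis. \<exists>B\<ge>0. \<forall>x y. \<bar>dir_deriv b f x - dir_deriv b f y\<bar> \<le> B * norm (x - y)"
    using test_fun_dir_deriv[OF f] test_fun_lipschitz by metis
  then obtain B where B: "\<And>b. b \<in> Basis \<Longrightarrow> B b \<ge> 0"
    "\<And>b x y. b \<in> Basis \<Longrightarrow> \<bar>dir_deriv b f x - dir_deriv b f y\<bar> \<le> B b * norm (x - y)" by metis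
  define C where "C = (\<Sum>b\<in>Basis. B b)"
  have C: "C \<ge> 0" unfolding C_def using B(1) by (intro sum_nonneg) auto
  have "\<bar>f (x + h) - f x - (\<Sum>b\<in>Basis. (h \<bullet> b) * dir_deriv b f x)\<bar> \<le> C * (norm h)\<^sup>2" for x h
  proof -
    define g where "g y = f y - (\<Sum>b\<in>Basis. ((y - x) \<bullet> b) * dir_deriv b f x)" for y
    define D where "D y = (\<lambda>k. (\<Sum>b\<in>Basis. (k \<bullet> b) * dir_deriv b f y) - (\<Sum>b\<in>Basis. (k \<bullet> b) * dir_deriv b f x))" for y
    have d: "(g has_derivative D y) (at y within cball x (norm h))" for y
    proof -
      have "((\<lambda>y. \<Sum>b\<in>Basis. ((y - x) \<bullet> b) * dir_deriv b f x) has_derivative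
          (\<lambda>k. \<Sum>b\<in>Basis. (k \<bullet> b) * dir_deriv b f x)) (at y)"
        by (auto intro!: derivative_eq_intros)
      from has_derivative_at_withinI[OF has_derivative_diff[OF test_fun_has_derivative[OF f] this]]
      show ?thesis unfolding g_def[abs_def] D_def .
    qed
    have on: "onorm (D y) \<le> C * norm h" if "y \<in> cball x (norm h)" for y
    proof (rule onorm_le)
      fix k :: 'a
      have "D y k = (\<Sum>b\<in>Basis. (k \<bullet> b) * (dir_deriv b f y - dir_deriv b f x))"
        by (simp add: D_def sum_subtractf[symmetric] algebra_simps)
      also have "norm \<dots> \<le> (\<Sum>b\<in>Basis. B b * norm h * norm k)"
      proof (rule sum_norm_le)
        fix b :: 'a assume b: "b \<in> Basis"
        have "\<bar>dir_deriv b f y - dir_deriv b f x\<bar> \<le> B b * norm (y - x)" using B(2)[OF b] .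
        also have "\<dots> \<le> B b * norm h"
          using B(1)[OF b] that by (intro mult_left_mono) (auto simp: dist_norm norm_minus_commute)
        finally show "norm ((k \<bullet> b) * (dir_deriv b f y - dir_deriv b f x)) \<le> B b * norm h * norm k"
          using Basis_le_norm[OF b, of k] mult_mono[of "\<bar>k \<bullet> b\<bar>" "norm k" "\<bar>dir_deriv b f y - dir_deriv b f x\<bar>" "B b * norm h"]
          by (simp add: abs_mult mult.commute)
      qed
      finally show "norm (D y k) \<le> C * norm h * norm k"
        by (simp add: C_def sum_distrib_right)
    qed
    have "norm (g (x + h) - g x) \<le> C * norm h * norm (x + h - x)"
      by (rule differentiable_bound[OF convex_cball d on]) (auto simp: dist_norm)
    then show ?thesis by (simp add: g_def power2_eq_square algebra_simps)
  qed
  with C that show thesis by blast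
qed

lemma integrable_fun_conv:
  assumes "test_fun \<rho>" "in_L2 f"
  shows "integrable lborel (\<lambda>y. \<rho> (x - y) *\<^sub>R f y)"
  using integrable_test_fun_L2[OF test_fun_reflect[OF assms(1)] assms(2)] .

lemma in_L2_indicator_cball: "in_L2 (\<lambda>y. complex_of_real (indicator (cball c R) y))"
proof (rule in_L2_bound)
  show "integrable lborel (indicator (cball c R) :: 'a \<Rightarrow> real)"
    by (intro integrable_real_indicator) (auto intro: emeasure_lborel_cball_finite[unfolded infinity_ennreal_def])
qed (auto simp: indicator_def)

text \<open>The uniform Taylor remainder of \<open>\<rho>\<close> is integrated against
  \<open>f\<close>. The resulting error is quadratic in \<open>norm h\<close>, so no limit has to be
  taken under the integral.\<close>

lemma has_derivative_fun_conv:
  fixes \<rho> :: "'a::euclidean_space \<Rightarrow> real"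
  assumes \<rho>: "test_fun \<rho>" and f: "in_L2 f"
  shows "(fun_conv f \<rho> has_derivative (\<lambda>h. \<Sum>b\<in>Basis. (h \<bullet> b) *\<^sub>R fun_conv f (dir_deriv b \<rho>) x)) (at x)"
    (is "(_ has_derivative ?D) _")
proof -
  obtain R where R: "R > 0" "\<And>x. norm x \<ge> R \<Longrightarrow> \<rho> x = 0" using test_fun_outside_ball[OF \<rho>] by blast
  obtain C where C: "C \<ge> 0"
    "\<And>x h. \<bar>\<rho> (x + h) - \<rho> x - (\<Sum>b\<in>Basis. (h \<bullet> b) * dir_deriv b \<rho> x)\<bar> \<le> C * (norm h)\<^sup>2"
    using test_fun_taylor[OF \<rho>] by blast
  \<comment> \<open>For \<open>norm h \<le> 1\<close> both translates of \<open>\<rho>\<close> are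
    supported in this ball around \<open>x\<close>. On it \<open>f\<close> is integrable, as the
    product of an L2 function with an L2 indicator.\<close>
  define I where "I = (\<lambda>y. indicator (cball x (R + 1)) y * norm (f y))"
  have I: "integrable lborel I"
    using integrable_norm_mult_L2[OF in_L2_indicator_cball[of x "R + 1"] f] by (simp add: I_def)
  define K where "K = C * (\<integral>y. I y \<partial>lborel)"
  have dz: "dir_deriv b \<rho> z = 0" if "norm z > R" for b z
    by (rule dir_deriv_zero_on_open[of "- cball 0 R"]) (use that R(2) in auto)
  have est: "norm (fun_conv f \<rho> (x + h) - fun_conv f \<rho> x - ?D h) \<le> K * (norm h)\<^sup>2" if h: "norm h \<le> 1" for h
  proof -
    define r where "r y = \<rho> (x + h - y) - \<rho> (x - y) - (\<Sum>b\<in>Basis. (h \<bullet> b) * dir_deriv b \<rho> (x - y))" for y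
    have i: "integrable lborel (\<lambda>y. dir_deriv b \<rho> (x - y) *\<^sub>R f y)" if "b \<in> Basis" for b
      using integrable_fun_conv[OF test_fun_dir_deriv[OF \<rho> that] f] .
    have "?D h = (\<integral>y. (\<Sum>b\<in>Basis. (h \<bullet> b) *\<^sub>R (dir_deriv b \<rho> (x - y) *\<^sub>R f y)) \<partial>lborel)"
      unfolding fun_conv_def
      by (subst Bochner_Integration.integral_sum) (auto intro!: integrable_scaleR_right i simp del: scaleR_scaleR)
    moreover have i2: "integrable lborel (\<lambda>y. \<Sum>b\<in>Basis. (h \<bullet> b) *\<^sub>R (dir_deriv b \<rho> (x - y) *\<^sub>R f y))"
      by (intro Bochner_Integration.integrable_sum integrable_scaleR_right i)
    ultimately have eq: "fun_conv f \<rho> (x + h) - fun_conv f \<rho> x - ?D h = (\<integral>y. r y *\<^sub>R f y \<partial>lborel)"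
      using integrable_fun_conv[OF \<rho> f]
      by (simp add: fun_conv_def r_def scaleR_diff_left scaleR_sum_left)
    have ir: "integrable lborel (\<lambda>y. r y *\<^sub>R f y)"
      using integrable_fun_conv[OF \<rho> f] i2
      by (simp add: r_def scaleR_diff_left scaleR_sum_left)
    have r0: "r y = 0" if "y \<notin> cball x (R + 1)" for y
    proof -
      from that have 1: "norm (x - y) > R + 1" by (simp add: dist_norm)
      moreover have "norm (x + h - y) > R"
        using 1 h norm_triangle_ineq4[of "x + h - y" h] by simp
      ultimately show ?thesis using R dz by (simp add: r_def)
    qed
    have "norm (r y *\<^sub>R f y) \<le> C * (norm h)\<^sup>2 * I y" for y
    proof (cases "y \<in> cball x (R + 1)")
      case True
      have "x - y + h = x + h - y" by simp
      then have "\<bar>r y\<bar> \<le> C * (norm h)\<^sup>2" using C(2)[of "x - y" h] unfolding r_def by metis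
      with True show ?thesis by (simp add: I_def mult_right_mono)
    qed (use r0 in \<open>simp add: I_def\<close>)
    then have "norm (\<integral>y. r y *\<^sub>R f y \<partial>lborel) \<le> (\<integral>y. C * (norm h)\<^sup>2 * I y \<partial>lborel)"
      using I by (intro Bochner_Integration.integral_norm_bound_integral[OF ir]) auto
    then show ?thesis unfolding eq by (simp add: K_def mult_ac)
  qed
  have bl: "bounded_linear ?D"
    by (intro bounded_linear_sum bounded_linear_scaleR_const[OF bounded_linear_inner_left])
  have K: "K \<ge> 0" using C(1) by (auto simp: K_def I_def intro!: mult_nonneg_nonneg integral_nonneg_AE)
  show ?thesis
    unfolding has_derivative_at_alt
  proof (intro conjI bl allI impI)
    fix e :: real assume "e > 0"
    \<comment> \<open>The bound 1 keeps \<open>est\<close> applicable; \<open>K + 1\<close> avoids a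
      division by zero when \<open>K = 0\<close>.\<close>
    define d where "d = min 1 (e / (K + 1))"
    have "d > 0" using \<open>e > 0\<close> K by (simp add: d_def)
    moreover have "norm (fun_conv f \<rho> y - fun_conv f \<rho> x - ?D (y - x)) \<le> e * norm (y - x)" if y: "norm (y - x) < d" for y
    proof -
      have "norm (fun_conv f \<rho> y - fun_conv f \<rho> x - ?D (y - x)) \<le> K * norm (y - x) * norm (y - x)"
        using est[of "y - x"] y by (simp add: d_def power2_eq_square)
      also have "K * norm (y - x) \<le> e"
      proof -
        have "K * norm (y - x) \<le> (K + 1) * (e / (K + 1))"
          using y K \<open>e > 0\<close> by (intro mult_mono) (auto simp: d_def)
        then show ?thesis using K by simp
      qed
      finally show ?thesis by (simp add: mult_right_mono)
    qed
    ultimately show "\<exists>d>0. \<forall>y. norm (y - x) < d \<longrightarrow>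
        norm (fun_conv f \<rho> y - fun_conv f \<rho> x - ?D (y - x)) \<le> e * norm (y - x)" by blast
  qed
qed

lemma continuous_fun_conv:
  assumes "test_fun \<rho>" "in_L2 f" shows "continuous_on S (fun_conv f \<rho>)"
  by (intro continuous_at_imp_continuous_on ballI has_derivative_continuous[OF has_derivative_fun_conv[OF assms]])

lemma fun_conv_measurable:
  assumes "test_fun \<rho>" "in_L2 f" shows "fun_conv f \<rho> \<in> borel_measurable borel"
  by (rule borel_measurable_continuous_onI[OF continuous_fun_conv[OF assms]])

lemma has_derivative_fun_conv_inner:
  assumes "test_fun \<rho>" "in_L2 f"
  shows "((\<lambda>x. fun_conv f \<rho> x \<bullet> e) has_derivative
    (\<lambda>h. \<Sum>b\<in>Basis. (h \<bullet> b) * (fun_conv f (dir_deriv b \<rho>) x \<bullet> e))) (at x)"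
  using has_derivative_inner_left[OF has_derivative_fun_conv[OF assms], of e]
  by (simp add: inner_sum_left)

lemma dir_deriv_fun_conv_inner:
  assumes "test_fun \<rho>" "in_L2 f" "b \<in> Basis"
  shows "dir_deriv b (\<lambda>x. fun_conv f \<rho> x \<bullet> e) = (\<lambda>x. fun_conv f (dir_deriv b \<rho>) x \<bullet> e)"
proof
  fix x
  show "dir_deriv b (\<lambda>x. fun_conv f \<rho> x \<bullet> e) x = fun_conv f (dir_deriv b \<rho>) x \<bullet> e"
    unfolding dir_deriv_eqI[OF has_derivative_fun_conv_inner[OF assms(1,2)]]
    by (rule sum_inner_Basis[OF assms(3)])
qed

text \<open>All derivatives fall on the kernel, which remains a test function, so the induction runs
  over arbitrary \<open>\<rho>\<close>. The inner product with \<open>e\<close> appears because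
  \<open>smooth\<close> concerns real functions: \<open>e = 1\<close> and \<open>e = \<i>\<close>
  select the real and the imaginary part.\<close>

lemma smooth_fun_conv_inner:
  assumes "test_fun \<rho>" "in_L2 f" shows "smooth (\<lambda>x. fun_conv f \<rho> x \<bullet> e)"
proof -
  have "differentiable_order k (\<lambda>x. fun_conv f \<rho> x \<bullet> e)" if "test_fun \<rho>" for k \<rho>
    using that
  proof (induction k arbitrary: \<rho>)
    case 0
    then show ?case
      using differentiableI[OF has_derivative_fun_conv_inner[OF _ assms(2)]] by simp
  next
    case (Suc k)
    have "(\<lambda>x. fun_conv f \<rho> x \<bullet> e) differentiable (at x)" for x
      by (rule differentiableI[OF has_derivative_fun_conv_inner[OF Suc.prems assms(2)]])
    moreover have "differentiable_order k (dir_deriv b (\<lambda>x. fun_conv f \<rho> x \<bullet> e))" if "b \<in> Basis" for b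
      unfolding dir_deriv_fun_conv_inner[OF Suc.prems assms(2) that]
      by (rule Suc.IH[OF test_fun_dir_deriv[OF Suc.prems that]])
    ultimately show ?case by simp
  qed
  with assms(1) show ?thesis by (simp add: smooth_iff_order)
qed

text \<open>The weak derivative is tested with \<open>\<rho> (x - y)\<close> as a function of
  \<open>y\<close>; the sign produced by the reflection cancels the one in
  \<open>is_weak_deriv\<close>.\<close>

lemma fun_conv_dir_deriv:
  assumes \<rho>: "test_fun \<rho>" and b: "b \<in> Basis" and w: "is_weak_deriv b f g"
  shows "fun_conv f (dir_deriv b \<rho>) = fun_conv g \<rho>"
proof
  fix x
  have "dir_deriv b (\<lambda>y. \<rho> (x - y)) = (\<lambda>y. - dir_deriv b \<rho> (x - y))"
    by (rule dir_deriv_reflect[OF smooth_imp_differentiable[OF test_fun_smooth[OF \<rho>]] b])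
  then show "fun_conv f (dir_deriv b \<rho>) x = fun_conv g \<rho> x"
    using w[unfolded is_weak_deriv_def, rule_format, OF test_fun_reflect[OF \<rho>, of x]]
    by (simp add: fun_conv_def)
qed

lemma fun_conv_diff:
  assumes "test_fun \<rho>" "in_L2 f" "in_L2 g"
  shows "fun_conv (\<lambda>x. f x - g x) \<rho> x = fun_conv f \<rho> x - fun_conv g \<rho> x"
  using integrable_fun_conv[OF assms(1,2)] integrable_fun_conv[OF assms(1,3)]
  by (simp add: fun_conv_def scaleR_diff_right)

lemma lborel_integral_affine:
  fixes f :: "'a::euclidean_space \<Rightarrow> 'b::{banach, second_countable_topology}"
  assumes c: "c \<noteq> 0" and [measurable]: "f \<in> borel_measurable borel"
  shows "(\<integral>x. f x \<partial>lborel) = \<bar>c\<bar> ^ DIM('a) *\<^sub>R (\<integral>x. f (t + c *\<^sub>R x) \<partial>lborel)"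
  by (subst lborel_affine[OF c, of t]) (simp add: integral_density integral_distr)

lemma nn_integral_reflect:
  fixes g :: "'a::euclidean_space \<Rightarrow> ennreal"
  assumes [measurable]: "g \<in> borel_measurable borel"
  shows "(\<integral>\<^sup>+x. g (x - y) \<partial>lborel) = (\<integral>\<^sup>+x. g x \<partial>lborel)"
  by (subst (2) lborel_affine[of 1 "- y"]) (simp_all add: nn_integral_density nn_integral_distr)

section \<open>Friedrichs mollifiers and their action on L2\<close>

lemma mollifier_test_fun: "friedrichs_mollifier \<rho> \<Longrightarrow> test_fun \<rho>"
  by (simp add: friedrichs_mollifier_def)

lemma mollifier_integral_reflect:
  fixes \<rho> :: "'a::euclidean_space \<Rightarrow> real"
  assumes "friedrichs_mollifier \<rho>"
  shows "(\<integral>y. \<rho> (x - y) \<partial>lborel) = 1"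
  using lborel_integral_affine[of "-1" \<rho> x] test_fun_measurable[OF mollifier_test_fun[OF assms]] assms
  by (simp add: friedrichs_mollifier_def)

text \<open>Writing the kernel as a product of two square roots, Cauchy-Schwarz and total mass one
  bound the squared modulus of the convolution pointwise by \<open>G\<close>, the convolution of the
  squared modulus of \<open>f\<close>; Tonelli then integrates \<open>G\<close>. The constant 1 does
  not depend on the scale of the mollifier, so the regularised data are bounded by
  \<open>L2_norm u0\<close> for every \<open>\<epsilon>\<close>.\<close>

lemma fun_conv_mollifier_L2:
  fixes \<rho> :: "'a::euclidean_space \<Rightarrow> real"
  assumes \<rho>: "friedrichs_mollifier \<rho>" and f: "in_L2 f"
  shows "in_L2 (fun_conv f \<rho>)" and "L2_norm (fun_conv f \<rho>) \<le> L2_norm f"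
proof -
  note t = mollifier_test_fun[OF \<rho>]
  have nn: "\<And>x. \<rho> x \<ge> 0" using \<rho> by (simp add: friedrichs_mollifier_def)
  note [measurable] = test_fun_measurable[OF t] in_L2_measurable[OF f] fun_conv_measurable[OF t f]
  obtain B where B: "B > 0" "\<And>x. \<bar>\<rho> x\<bar> \<le> B" using test_fun_bounded[OF t] by blast
  define G where "G x = (\<integral>y. \<rho> (x - y) * (norm (f y))\<^sup>2 \<partial>lborel)" for x
  have iG: "integrable lborel (\<lambda>y. \<rho> (x - y) * (norm (f y))\<^sup>2)" for x
  proof (rule Bochner_Integration.integrable_bound)
    show "integrable lborel (\<lambda>y. B * (norm (f y))\<^sup>2)" using f in_L2_norm_integrable by auto
    show "AE y in lborel. norm (\<rho> (x - y) * (norm (f y))\<^sup>2) \<le> norm (B * (norm (f y))\<^sup>2)"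
      using B by (auto simp: abs_mult intro!: mult_right_mono)
  qed simp
  have G0: "G x \<ge> 0" for x unfolding G_def using nn by (intro integral_nonneg_AE) auto
  have Gm[measurable]: "G \<in> borel_measurable borel" unfolding G_def by measurable
  have pt: "(norm (fun_conv f \<rho> x))\<^sup>2 \<le> G x" for x
  proof -
    have i1: "integrable lborel (\<lambda>y. \<rho> (x - y))"
      using integrable_test_fun[OF test_fun_reflect[OF t]] .
    have e: "sqrt (\<rho> (x - y)) * (sqrt (\<rho> (x - y)) * norm (f y)) = norm (\<rho> (x - y) *\<^sub>R f y)" for y
      using nn[of "x - y"] by (simp flip: mult.assoc)
    have "norm (fun_conv f \<rho> x) \<le> (\<integral>y. norm (\<rho> (x - y) *\<^sub>R f y) \<partial>lborel)"
      unfolding fun_conv_def by (rule integral_norm_bound)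
    also have "\<dots> = (\<integral>y. sqrt (\<rho> (x - y)) * (sqrt (\<rho> (x - y)) * norm (f y)) \<partial>lborel)"
      unfolding e ..
    also have "\<dots> \<le> sqrt (\<integral>y. (sqrt (\<rho> (x - y)))\<^sup>2 \<partial>lborel) * sqrt (\<integral>y. (sqrt (\<rho> (x - y)) * norm (f y))\<^sup>2 \<partial>lborel)"
      by (rule order_trans[OF abs_ge_self integral_Cauchy_Schwarz])
        (use i1 iG[of x] nn in \<open>auto simp: power_mult_distrib\<close>)
    also have "\<dots> = sqrt (G x)"
      using nn mollifier_integral_reflect[OF \<rho>, of x] by (simp add: G_def power_mult_distrib)
    finally have "(norm (fun_conv f \<rho> x))\<^sup>2 \<le> (sqrt (G x))\<^sup>2" by (intro power_mono) auto
    then show ?thesis using G0 by simp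
  qed
  have "(\<integral>\<^sup>+x. ennreal (G x) \<partial>lborel) = (\<integral>\<^sup>+x. \<integral>\<^sup>+y. ennreal (\<rho> (x - y) * (norm (f y))\<^sup>2) \<partial>lborel \<partial>lborel)"
    unfolding G_def using iG nn by (subst nn_integral_eq_integral) auto
  also have "\<dots> = (\<integral>\<^sup>+y. \<integral>\<^sup>+x. ennreal (\<rho> (x - y) * (norm (f y))\<^sup>2) \<partial>lborel \<partial>lborel)"
    by (rule lborel_pair.Fubini'[symmetric]) measurable
  also have "\<dots> = (\<integral>\<^sup>+y. (\<integral>\<^sup>+x. ennreal (\<rho> (x - y)) \<partial>lborel) * ennreal ((norm (f y))\<^sup>2) \<partial>lborel)"
    using nn by (subst nn_integral_multc[symmetric]) (auto simp: ennreal_mult)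
  also have "\<dots> = (\<integral>\<^sup>+y. (\<integral>\<^sup>+x. ennreal (\<rho> x) \<partial>lborel) * ennreal ((norm (f y))\<^sup>2) \<partial>lborel)"
    by (subst nn_integral_reflect) auto
  also have "(\<integral>\<^sup>+x. ennreal (\<rho> x) \<partial>lborel) = 1"
    using \<rho> nn integrable_test_fun[OF t] by (subst nn_integral_eq_integral) (auto simp: friedrichs_mollifier_def)
  also have "(\<integral>\<^sup>+y. 1 * ennreal ((norm (f y))\<^sup>2) \<partial>lborel) = ennreal (\<integral>y. (norm (f y))\<^sup>2 \<partial>lborel)"
    using in_L2_norm_integrable[OF f] by (simp add: nn_integral_eq_integral)
  finally have nG: "(\<integral>\<^sup>+x. ennreal (G x) \<partial>lborel) = ennreal (\<integral>y. (norm (f y))\<^sup>2 \<partial>lborel)" .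
  \<comment> \<open>The integrability of \<open>G\<close> is a consequence of the finite value just
    obtained by Tonelli.\<close>
  have intG: "integrable lborel G"
    by (rule integrableI_nonneg) (use G0 nG in auto)
  have eG: "(\<integral>x. G x \<partial>lborel) = (\<integral>y. (norm (f y))\<^sup>2 \<partial>lborel)"
    using nG G0 by (simp add: integral_eq_nn_integral)
  show L: "in_L2 (fun_conv f \<rho>)"
    by (rule in_L2_bound[OF _ intG]) (use pt in auto)
  have "(\<integral>x. (norm (fun_conv f \<rho> x))\<^sup>2 \<partial>lborel) \<le> (\<integral>x. G x \<partial>lborel)"
    by (rule integral_mono[OF in_L2_norm_integrable[OF L] intG pt])
  then show "L2_norm (fun_conv f \<rho>) \<le> L2_norm f" by (simp add: L2_norm_def eG)
qed

text \<open>For \<open>c = \<omega> \<epsilon>\<close> this is \<open>scaled\<close>; for small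
  \<open>c\<close> it yields mollifiers of small support.\<close>

lemma mollifier_rescale:
  fixes \<psi> :: "'a::euclidean_space \<Rightarrow> real"
  assumes \<psi>: "friedrichs_mollifier \<psi>" and c: "c > 0"
  shows "friedrichs_mollifier (\<lambda>x. c powi (- int DIM('a)) * \<psi> (x /\<^sub>R c))"
proof -
  note t = mollifier_test_fun[OF \<psi>]
  obtain R where R: "\<And>x. norm x \<ge> R \<Longrightarrow> \<psi> x = 0" using test_fun_outside_ball[OF t] by blast
  have [measurable]: "\<psi> \<in> borel_measurable borel" by (rule test_fun_measurable[OF t])
  have "smooth (\<lambda>x. \<psi> (x /\<^sub>R c + 0))"
    by (rule smooth_affine[OF _ test_fun_smooth[OF t]]) (intro linear_compose_scale_right linear_id[unfolded id_def])
  then have "test_fun (\<lambda>x. c powi (- int DIM('a)) * \<psi> (x /\<^sub>R c))"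
    using R c by (intro test_fun_outside_ballI[where R = "R * c"] smooth_mult smooth_const) (auto simp: field_simps)
  moreover have "(\<integral>x. c powi (- int DIM('a)) * \<psi> (x /\<^sub>R c) \<partial>lborel) = 1"
    using lborel_integral_affine[of c "\<lambda>x. \<psi> (x /\<^sub>R c)" 0] c \<psi>
    by (simp add: power_int_minus friedrichs_mollifier_def)
  ultimately show ?thesis
    using \<psi> c by (auto simp: friedrichs_mollifier_def)
qed

lemma mollifier_small_support:
  fixes \<psi> :: "'a::euclidean_space \<Rightarrow> real"
  assumes \<psi>: "friedrichs_mollifier \<psi>" and d: "d > 0"
  obtains \<rho> :: "'a \<Rightarrow> real" where "friedrichs_mollifier \<rho>" "\<And>x. norm x \<ge> d \<Longrightarrow> \<rho> x = 0"
proof -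
  obtain R where R: "R > 0" "\<And>x. norm x \<ge> R \<Longrightarrow> \<psi> x = 0"
    using test_fun_outside_ball[OF mollifier_test_fun[OF \<psi>]] by blast
  define c where "c = d / R"
  have c: "c > 0" using d R by (simp add: c_def)
  have "\<psi> (x /\<^sub>R c) = 0" if "norm x \<ge> d" for x
    using that d R(1) by (intro R(2)) (simp add: c_def field_simps)
  with mollifier_rescale[OF \<psi> c] that show thesis by auto
qed

section \<open>Mollification and weak derivatives\<close>

lemma L2_norm_dominated_convergence:
  fixes s :: "nat \<Rightarrow> 'a::euclidean_space \<Rightarrow> complex"
  assumes [measurable]: "\<And>n. s n \<in> borel_measurable borel" "f \<in> borel_measurable borel"
    and W: "integrable lborel W" "\<And>n. AE x in lborel. (norm (s n x - f x))\<^sup>2 \<le> W x"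
    and lim: "AE x in lborel. (\<lambda>n. s n x) \<longlonglongrightarrow> f x"
  shows "(\<lambda>n. L2_norm (\<lambda>x. s n x - f x)) \<longlonglongrightarrow> 0"
proof -
  have "(\<lambda>n. \<integral>x. (norm (s n x - f x))\<^sup>2 \<partial>lborel) \<longlonglongrightarrow> (\<integral>x. (0::real) \<partial>(lborel :: 'a measure))"
  proof (rule integral_dominated_convergence[OF _ _ W(1)])
    show "AE x in lborel. (\<lambda>n. (norm (s n x - f x))\<^sup>2) \<longlonglongrightarrow> 0"
      using lim
    proof eventually_elim
      case (elim x)
      then have "(\<lambda>n. (norm (s n x - f x))\<^sup>2) \<longlonglongrightarrow> (norm (f x - f x))\<^sup>2" by (intro tendsto_intros)
      then show ?case by simp
    qed
  qed (use W in auto)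
  then have "(\<lambda>n. sqrt (\<integral>x. (norm (s n x - f x))\<^sup>2 \<partial>lborel)) \<longlonglongrightarrow> sqrt 0"
    by (intro tendsto_real_sqrt) simp
  then show ?thesis by (simp add: L2_norm_def)
qed

lemma integrable_cball_indicator: "integrable lborel (\<lambda>x::'a::euclidean_space. c * indicator (cball a r) x :: real)"
  by (intro integrable_mult_right integrable_real_indicator) (auto intro: emeasure_lborel_cball_finite[unfolded infinity_ennreal_def])

text \<open>Truncation in value and in space at the same level; the single \<open>M\<close> acts as
  both bound and radius in \<open>L2_approx_continuous_bounded\<close>.\<close>

lemma L2_approx_bounded:
  fixes f :: "'a::euclidean_space \<Rightarrow> complex"
  assumes f: "in_L2 f" and e: "e > 0"
  obtains g and M :: real where "in_L2 g" "M > 0" "\<And>x. norm (g x) \<le> M" "\<And>x. norm x > M \<Longrightarrow> g x = 0"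
    "L2_norm (\<lambda>x. g x - f x) < e"
proof -
  note [measurable] = in_L2_measurable[OF f]
  define s where "s n x = (if norm x \<le> real n \<and> norm (f x) \<le> real n then f x else 0)" for n x
  have m[measurable]: "s n \<in> borel_measurable borel" for n unfolding s_def by measurable
  have "(\<lambda>n. L2_norm (\<lambda>x. s n x - f x)) \<longlonglongrightarrow> 0"
  proof (rule L2_norm_dominated_convergence[where W = "\<lambda>x. (norm (f x))\<^sup>2"])
    show "AE x in lborel. (\<lambda>n. s n x) \<longlonglongrightarrow> f x"
    proof (rule AE_I2)
      fix x
      obtain N where N: "norm x \<le> real N" "norm (f x) \<le> real N"
        using real_arch_simple[of "max (norm x) (norm (f x))"] by auto
      have "\<forall>\<^sub>F n in sequentially. s n x = f x"
        using eventually_ge_at_top[of N] by eventually_elim (use N in \<open>auto simp: s_def\<close>)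
      then show "(\<lambda>n. s n x) \<longlonglongrightarrow> f x" by (rule tendsto_eventually)
    qed
  qed (use in_L2_norm_integrable[OF f] in \<open>auto simp: s_def\<close>)
  from order_tendstoD(2)[OF this e] eventually_gt_at_top[of 0]
  have "\<forall>\<^sub>F n in sequentially. L2_norm (\<lambda>x. s n x - f x) < e \<and> n > 0" by eventually_elim auto
  then obtain n where n: "L2_norm (\<lambda>x. s n x - f x) < e" "n > 0"
    using eventually_happens'[OF sequentially_bot] by blast
  have "in_L2 (s n)"
    by (rule in_L2_bound[OF m in_L2_norm_integrable[OF f]]) (auto simp: s_def)
  with n show thesis by (intro that[of "s n" "real n"]) (auto simp: s_def)
qed

text \<open>Measurability provides continuous functions converging almost everywhere, without
  control on their size or support. Clipping the values to the disc of radius \<open>M\<close> and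
  cutting off between the radii \<open>M\<close> and \<open>M + 1\<close> supply both and preserve
  continuity and the limit, so dominated convergence applies.\<close>

lemma L2_approx_continuous_bounded:
  fixes f :: "'a::euclidean_space \<Rightarrow> complex"
  assumes f: "in_L2 f" and M: "M > 0" "\<And>x. norm (f x) \<le> M" "\<And>x. norm x > M \<Longrightarrow> f x = 0" and e: "e > 0"
  obtains g where "continuous_on UNIV g" "\<And>x. norm x \<ge> M + 1 \<Longrightarrow> g x = 0" "L2_norm (\<lambda>x. g x - f x) < e"
proof -
  note [measurable] = in_L2_measurable[OF f]
  have "f \<in> borel_measurable lebesgue" by (simp add: measurable_completion)
  then have "f measurable_on UNIV" by (rule lebesgue_measurable_imp_measurable_on) simp
  then obtain N g where N: "negligible N" and g: "\<And>n. continuous_on UNIV (g n)"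
    and lim: "\<And>x. x \<notin> N \<Longrightarrow> (\<lambda>n. g n x) \<longlonglongrightarrow> f x"
    unfolding measurable_on_def by auto
  \<comment> \<open>The radial retraction onto the disc of radius \<open>M\<close>; it is continuous
    because the denominator is at least \<open>M > 0\<close>.\<close>
  define clip where "clip z = (M / max M (norm z)) *\<^sub>R z" for z :: complex
  define cut where "cut x = max 0 (min 1 (M + 1 - norm x))" for x :: 'a
  define h where "h n x = cut x *\<^sub>R clip (g n x)" for n x
  have ccl: "continuous_on UNIV clip"
    unfolding clip_def using M(1) by (intro continuous_intros) auto
  have "continuous_on UNIV (\<lambda>x. clip (g n x))" for n
    by (rule continuous_on_compose2[OF ccl g]) auto
  then have ch: "continuous_on UNIV (h n)" for n
    unfolding h_def cut_def by (intro continuous_intros) auto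
  have [measurable]: "h n \<in> borel_measurable borel" for n
    by (rule borel_measurable_continuous_onI[OF ch])
  have clipM: "norm (clip z) \<le> M" for z
    using M(1) by (auto simp: clip_def field_simps max_def)
  have clipid: "clip z = z" if "norm z \<le> M" for z using that M(1) by (simp add: clip_def max_def)
  have cut: "0 \<le> cut x" "cut x \<le> 1" "norm x \<le> M \<Longrightarrow> cut x = 1" "norm x \<ge> M + 1 \<Longrightarrow> cut x = 0" for x
    by (auto simp: cut_def)
  have "(\<lambda>n. L2_norm (\<lambda>x. h n x - f x)) \<longlonglongrightarrow> 0"
  proof (rule L2_norm_dominated_convergence[OF _ _ integrable_cball_indicator])
    show "AE x in lborel. (norm (h n x - f x))\<^sup>2 \<le> (2 * M)\<^sup>2 * indicator (cball 0 (M + 1)) x" for n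
    proof (rule AE_I2)
      fix x
      have "norm (h n x - f x) \<le> 2 * M"
      proof -
        have "norm (h n x) \<le> 1 * M" unfolding h_def norm_scaleR
          using cut(1,2)[of x] clipM[of "g n x"] by (intro mult_mono) auto
        then show ?thesis using norm_triangle_ineq4[of "h n x" "f x"] M(2)[of x] by linarith
      qed
      moreover have "h n x - f x = 0" if "x \<notin> cball 0 (M + 1)"
        using that M(3)[of x] cut(4)[of x] by (simp add: h_def)
      moreover have "(norm (h n x - f x))\<^sup>2 \<le> (2 * M)\<^sup>2"
        using calculation(1) by (intro power_mono) auto
      ultimately show "(norm (h n x - f x))\<^sup>2 \<le> (2 * M)\<^sup>2 * indicator (cball 0 (M + 1)) x"
        by (cases "x \<in> cball 0 (M + 1)") auto
    qed
    have "AE x in lebesgue. x \<notin> N" using N by (auto simp: negligible_iff_null_sets intro: AE_not_in)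
    then have "AE x in lborel. x \<notin> N" by (simp add: AE_completion_iff)
    then show "AE x in lborel. (\<lambda>n. h n x) \<longlonglongrightarrow> f x"
    proof eventually_elim
      case (elim x)
      have "(\<lambda>n. h n x) \<longlonglongrightarrow> cut x *\<^sub>R clip (f x)"
        unfolding h_def
        by (intro tendsto_scaleR tendsto_const continuous_on_tendsto_compose[OF ccl lim[OF elim]]) auto
      also have "cut x *\<^sub>R clip (f x) = f x"
        using cut(3)[of x] M(3)[of x] clipid[OF M(2)[of x]] by (cases "norm x \<le> M") auto
      finally show ?case .
    qed
  qed auto
  from order_tendstoD(2)[OF this e] obtain n where "L2_norm (\<lambda>x. h n x - f x) < e"
    using eventually_happens'[OF sequentially_bot] by blast
  then show thesis using ch cut(4) by (intro that[of "h n"]) (auto simp: h_def)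
qed

lemma L2_approx_continuous:
  fixes f :: "'a::euclidean_space \<Rightarrow> complex"
  assumes f: "in_L2 f" and e: "e > 0"
  obtains g R where "R > 0" "in_L2 g" "continuous_on UNIV g" "\<And>x. norm x \<ge> R \<Longrightarrow> g x = 0"
    "L2_norm (\<lambda>x. g x - f x) < e"
proof -
  obtain h and M :: real where h: "in_L2 h" "M > 0" "\<And>x. norm (h x) \<le> M" "\<And>x. norm x > M \<Longrightarrow> h x = 0"
    "L2_norm (\<lambda>x. h x - f x) < e / 2"
    using L2_approx_bounded[OF f, of "e / 2"] e by auto
  obtain g where g: "continuous_on UNIV g" "\<And>x. norm x \<ge> M + 1 \<Longrightarrow> g x = 0" "L2_norm (\<lambda>x. g x - h x) < e / 2"
    using L2_approx_continuous_bounded[OF h(1-4), of "e / 2"] e by auto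
  have L: "in_L2 g"
    by (rule in_L2_of_continuous[where R = "M + 1"])
      (use g continuous_on_subset[OF g(1)] in \<open>auto intro: borel_measurable_continuous_onI\<close>)
  have "L2_norm (\<lambda>x. g x - f x) < e"
    using L2_norm_triangle_diff[OF L h(1) f] g(3) h(5) by linarith
  with L g h(2) show thesis by (intro that[of "M + 1" g]) auto
qed

text \<open>Convolution with a mollifier is an average, with nonnegative weights of total mass one,
  over the ball of radius \<open>d\<close>. With \<open>e = 0\<close> and \<open>c = 0\<close> it
  shows that the convolution vanishes away from the support of \<open>f\<close>; on the time axis it
  measures the convergence at a single time.\<close>

lemma fun_conv_near:
  assumes \<rho>: "friedrichs_mollifier \<rho>" "\<And>x. norm x \<ge> d \<Longrightarrow> \<rho> x = 0" and f: "in_L2 f"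
    and near: "\<And>y. norm (x - y) < d \<Longrightarrow> norm (f y - c) \<le> e"
  shows "norm (fun_conv f \<rho> x - c) \<le> e"
proof -
  note t = test_fun_reflect[OF mollifier_test_fun[OF \<rho>(1)], of x]
  have nn: "\<rho> z \<ge> 0" for z using \<rho>(1) by (simp add: friedrichs_mollifier_def)
  have i: "integrable lborel (\<lambda>y. \<rho> (x - y))" by (rule integrable_test_fun[OF t])
  have "c = (\<integral>y. \<rho> (x - y) *\<^sub>R c \<partial>lborel)"
    using mollifier_integral_reflect[OF \<rho>(1), of x] i by simp
  then have eq: "fun_conv f \<rho> x - c = (\<integral>y. \<rho> (x - y) *\<^sub>R (f y - c) \<partial>lborel)"
    using integrable_test_fun_L2[OF t f] i by (simp add: fun_conv_def scaleR_diff_right)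
  have "norm (\<integral>y. \<rho> (x - y) *\<^sub>R (f y - c) \<partial>lborel) \<le> (\<integral>y. \<rho> (x - y) * e \<partial>lborel)"
  proof (rule Bochner_Integration.integral_norm_bound_integral)
    show "integrable lborel (\<lambda>y. \<rho> (x - y) *\<^sub>R (f y - c))"
      using integrable_test_fun_L2[OF t f] i by (simp add: scaleR_diff_right)
    show "norm (\<rho> (x - y) *\<^sub>R (f y - c)) \<le> \<rho> (x - y) * e" for y
      using near[of y] \<rho>(2)[of "x - y"] nn[of "x - y"] by (cases "norm (x - y) < d") (auto intro: mult_left_mono)
  qed (use i in auto)
  also have "\<dots> = e" using mollifier_integral_reflect[OF \<rho>(1), of x] by simp
  finally show ?thesis unfolding eq .
qed

lemma mollification_converges_continuous:
  fixes g :: "'a::euclidean_space \<Rightarrow> complex"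
  assumes g: "continuous_on UNIV g" "in_L2 g" and R: "R > 0" "\<And>x. norm x \<ge> R \<Longrightarrow> g x = 0" and e: "e > 0"
  shows "\<exists>d>0. \<forall>\<rho>. friedrichs_mollifier \<rho> \<longrightarrow> (\<forall>x. norm x \<ge> d \<longrightarrow> \<rho> x = 0) \<longrightarrow>
    L2_norm (\<lambda>x. fun_conv g \<rho> x - g x) < e"
proof -
  define V where "V = measure lborel (cball (0::'a) (R + 1))"
  \<comment> \<open>Chosen so that \<open>\<eta> * sqrt (V + 1)\<close> equals \<open>e / 2\<close>;
    adding 1 to the volume keeps the denominator positive.\<close>
  define \<eta> where "\<eta> = e / (2 * sqrt (V + 1))"
  have V: "V \<ge> 0" by (simp add: V_def)
  have \<eta>: "\<eta> > 0" using e V by (simp add: \<eta>_def)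
  \<comment> \<open>Differences are estimated at points of norm at most \<open>R + 1\<close> and
    shifted by less than \<open>d \<le> 1\<close>, hence the radius \<open>R + 2\<close>. Beyond
    \<open>R + 1\<close> the shifted points still lie outside the ball of radius \<open>R\<close>,
    where \<open>g\<close> vanishes.\<close>
  have "uniformly_continuous_on (cball 0 (R + 2)) g"
    by (rule compact_uniformly_continuous) (use g(1) continuous_on_subset in auto)
  then obtain d0 where d0: "d0 > 0" "\<And>x y. norm x \<le> R + 2 \<Longrightarrow> norm y \<le> R + 2 \<Longrightarrow> dist y x < d0 \<Longrightarrow> dist (g y) (g x) < \<eta>"
    using \<eta> unfolding uniformly_continuous_on_def by auto
  define d where "d = min d0 1"
  have d: "d > 0" "d \<le> 1" "d \<le> d0" using d0 by (auto simp: d_def)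
  have "L2_norm (\<lambda>x. fun_conv g \<rho> x - g x) < e"
    if \<rho>: "friedrichs_mollifier \<rho>" "\<And>x. norm x \<ge> d \<Longrightarrow> \<rho> x = 0" for \<rho>
  proof -
    have pt: "norm (fun_conv g \<rho> x - g x) \<le> \<eta>" if x: "norm x \<le> R + 1" for x
    proof (rule fun_conv_near[OF \<rho> g(2)])
      fix y assume y: "norm (x - y) < d"
      then have "norm y \<le> R + 2" using x d norm_triangle_ineq4[of x "x - y"] by simp
      with d0(2)[of x y] x y d show "norm (g y - g x) \<le> \<eta>" by (auto simp: dist_norm norm_minus_commute)
    qed
    have pt0: "fun_conv g \<rho> x - g x = 0" if x: "norm x > R + 1" for x
    proof -
      have "norm (fun_conv g \<rho> x - 0) \<le> 0"
      proof (rule fun_conv_near[OF \<rho> g(2)])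
        fix y assume y: "norm (x - y) < d"
        then have "norm y \<ge> R" using x d norm_triangle_ineq2[of x "x - y"] by simp
        then show "norm (g y - 0) \<le> 0" using R by simp
      qed
      moreover have "g x = 0" using R x by simp
      ultimately show ?thesis by simp
    qed
    note t = mollifier_test_fun[OF \<rho>(1)]
    have L: "in_L2 (\<lambda>x. fun_conv g \<rho> x - g x)"
      by (intro in_L2_diff fun_conv_mollifier_L2 \<rho> g)
    have "(\<integral>x. (norm (fun_conv g \<rho> x - g x))\<^sup>2 \<partial>lborel) \<le> (\<integral>x. \<eta>\<^sup>2 * indicator (cball 0 (R + 1)) x \<partial>(lborel::'a measure))"
    proof (rule integral_mono[OF in_L2_norm_integrable[OF L] integrable_cball_indicator])
      fix x
      show "(norm (fun_conv g \<rho> x - g x))\<^sup>2 \<le> \<eta>\<^sup>2 * indicator (cball 0 (R + 1)) x"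
        using pt[of x] pt0[of x] by (cases "norm x \<le> R + 1") (auto intro!: power_mono)
    qed
    also have "\<dots> = \<eta>\<^sup>2 * V" by (simp add: V_def)
    also have "\<dots> \<le> \<eta>\<^sup>2 * (V + 1)" by (simp add: mult_left_mono)
    finally have "L2_norm (\<lambda>x. fun_conv g \<rho> x - g x) \<le> sqrt (\<eta>\<^sup>2 * (V + 1))"
      unfolding L2_norm_def by (rule real_sqrt_le_mono)
    also have "\<dots> = e / 2" using e V by (simp add: real_sqrt_mult \<eta>_def)
    finally show ?thesis using e by simp
  qed
  with d show ?thesis by blast
qed

text \<open>Mollification contracts L2 distances, so a continuous approximation \<open>g\<close>
  reduces the claim to \<open>g\<close>, in three steps of \<open>e / 3\<close>. The radius
  \<open>d\<close> is fixed before \<open>\<rho>\<close> so that one mollifier can later be chosen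
  for several functions at once.\<close>

lemma mollification_converges:
  fixes f :: "'a::euclidean_space \<Rightarrow> complex"
  assumes f: "in_L2 f" and e: "e > 0"
  shows "\<exists>d>0. \<forall>\<rho>. friedrichs_mollifier \<rho> \<longrightarrow> (\<forall>x. norm x \<ge> d \<longrightarrow> \<rho> x = 0) \<longrightarrow>
    L2_norm (\<lambda>x. fun_conv f \<rho> x - f x) < e"
proof -
  have e3: "e / 3 > 0" using e by simp
  obtain g R where g: "R > 0" "in_L2 g" "continuous_on UNIV g" "\<And>x. norm x \<ge> R \<Longrightarrow> g x = 0"
    "L2_norm (\<lambda>x. g x - f x) < e / 3" using L2_approx_continuous[OF f e3] by blast
  obtain d where d: "d > 0" "\<And>\<rho>. friedrichs_mollifier \<rho> \<Longrightarrow> (\<forall>x. norm x \<ge> d \<longrightarrow> \<rho> x = 0) \<Longrightarrow>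
    L2_norm (\<lambda>x. fun_conv g \<rho> x - g x) < e / 3"
    using mollification_converges_continuous[OF g(3,2,1,4) e3] by auto
  have "L2_norm (\<lambda>x. fun_conv f \<rho> x - f x) < e"
    if \<rho>: "friedrichs_mollifier \<rho>" "\<forall>x. norm x \<ge> d \<longrightarrow> \<rho> x = 0" for \<rho>
  proof -
    note t = mollifier_test_fun[OF \<rho>(1)]
    have L: "in_L2 (fun_conv f \<rho>)" "in_L2 (fun_conv g \<rho>)" using fun_conv_mollifier_L2(1)[OF \<rho>(1)] f g by auto
    have "fun_conv (\<lambda>x. f x - g x) \<rho> = (\<lambda>x. fun_conv f \<rho> x - fun_conv g \<rho> x)"
      using fun_conv_diff[OF t f g(2)] by blast
    then have "L2_norm (\<lambda>x. fun_conv f \<rho> x - fun_conv g \<rho> x) \<le> L2_norm (\<lambda>x. f x - g x)"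
      using fun_conv_mollifier_L2(2)[OF \<rho>(1) in_L2_diff[OF f g(2)]] by simp
    then show ?thesis
      using L2_norm_triangle_diff[OF L(1,2) f] L2_norm_triangle_diff[OF L(2) g(2) f]
        L2_norm_minus_commute[of f g] g(5) d(2)[OF \<rho>] by linarith
  qed
  with d(1) show ?thesis by blast
qed

lemma L2_norm_zero_AE:
  assumes "in_L2 f" "L2_norm f = 0" shows "AE x in lborel. f x = 0"
proof -
  have "(\<integral>x. (norm (f x))\<^sup>2 \<partial>lborel) = 0" using assms(2) by (simp add: L2_norm_def)
  then show ?thesis
    using integral_nonneg_eq_0_iff_AE[OF in_L2_norm_integrable[OF assms(1)]] by auto
qed

text \<open>Each value of \<open>fun_conv g \<rho>\<close> is a pairing of \<open>g\<close> with a
  test function and hence zero, while these convolutions approximate \<open>g\<close>. The mollifier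
  \<open>\<psi>\<close> is rescaled to obtain \<open>\<rho>\<close> with small support.\<close>

lemma L2_fundamental_lemma:
  fixes g :: "'a::euclidean_space \<Rightarrow> complex"
  assumes \<psi>: "friedrichs_mollifier (\<psi> :: 'a \<Rightarrow> real)" and g: "in_L2 g"
    and zero: "\<And>\<phi>. test_fun \<phi> \<Longrightarrow> (\<integral>x. \<phi> x *\<^sub>R g x \<partial>lborel) = 0"
  shows "AE x in lborel. g x = 0"
proof -
  have "L2_norm g \<le> e" if e: "e > 0" for e
  proof -
    obtain d where d: "d > 0" "\<And>\<rho>. friedrichs_mollifier \<rho> \<Longrightarrow> (\<forall>x. norm x \<ge> d \<longrightarrow> \<rho> x = 0) \<Longrightarrow>
      L2_norm (\<lambda>x. fun_conv g \<rho> x - g x) < e" using mollification_converges[OF g e] by blast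
    obtain \<rho> :: "'a \<Rightarrow> real" where \<rho>: "friedrichs_mollifier \<rho>" "\<And>x. norm x \<ge> d \<Longrightarrow> \<rho> x = 0"
      using mollifier_small_support[OF \<psi> d(1)] by blast
    have "fun_conv g \<rho> x = 0" for x
      unfolding fun_conv_def by (rule zero[OF test_fun_reflect[OF mollifier_test_fun[OF \<rho>(1)]]])
    with d(2)[of \<rho>] \<rho> show ?thesis by (simp add: L2_norm_def)
  qed
  then have "L2_norm g \<le> 0" by (rule field_le_epsilon[of _ 0, simplified])
  with L2_norm_zero_AE[OF g] L2_norm_nonneg[of g] show ?thesis by simp
qed

section \<open>Weak derivatives and H1\<close>

lemma is_weak_deriv_diff:
  assumes "is_weak_deriv b f F" "is_weak_deriv b g G" "in_L2 f" "in_L2 F" "in_L2 g" "in_L2 G" "b \<in> Basis"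
  shows "is_weak_deriv b (\<lambda>x. f x - g x) (\<lambda>x. F x - G x)"
  unfolding is_weak_deriv_def
proof (intro allI impI)
  fix \<phi> :: "'a \<Rightarrow> real" assume \<phi>: "test_fun \<phi>"
  note i = integrable_test_fun_L2[OF \<phi>] integrable_test_fun_L2[OF test_fun_dir_deriv[OF \<phi> assms(7)]]
  show "(\<integral>x. dir_deriv b \<phi> x *\<^sub>R (f x - g x) \<partial>lborel) = - (\<integral>x. \<phi> x *\<^sub>R (F x - G x) \<partial>lborel)"
    using assms(1,2) \<phi> i assms(3-6) by (simp add: is_weak_deriv_def scaleR_diff_right)
qed

lemma is_weak_deriv_add:
  assumes "is_weak_deriv b f F" "is_weak_deriv b g G" "in_L2 f" "in_L2 F" "in_L2 g" "in_L2 G" "b \<in> Basis"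
  shows "is_weak_deriv b (\<lambda>x. f x + g x) (\<lambda>x. F x + G x)"
  unfolding is_weak_deriv_def
proof (intro allI impI)
  fix \<phi> :: "'a \<Rightarrow> real" assume \<phi>: "test_fun \<phi>"
  note i = integrable_test_fun_L2[OF \<phi>] integrable_test_fun_L2[OF test_fun_dir_deriv[OF \<phi> assms(7)]]
  show "(\<integral>x. dir_deriv b \<phi> x *\<^sub>R (f x + g x) \<partial>lborel) = - (\<integral>x. \<phi> x *\<^sub>R (F x + G x) \<partial>lborel)"
    using assms(1,2) \<phi> i assms(3-6) by (simp add: is_weak_deriv_def scaleR_add_right)
qed

lemma is_weak_deriv_unique:
  fixes f :: "'a::euclidean_space \<Rightarrow> complex"
  assumes \<psi>: "friedrichs_mollifier (\<psi> :: 'a \<Rightarrow> real)"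
    and "is_weak_deriv b f F" "is_weak_deriv b f G" "in_L2 F" "in_L2 G"
  shows "AE x in lborel. F x = G x"
proof -
  have "AE x in lborel. F x - G x = 0"
  proof (rule L2_fundamental_lemma[OF \<psi>])
    fix \<phi> :: "'a \<Rightarrow> real" assume \<phi>: "test_fun \<phi>"
    have "(\<integral>x. \<phi> x *\<^sub>R F x \<partial>lborel) = (\<integral>x. \<phi> x *\<^sub>R G x \<partial>lborel)"
      using assms(2,3) \<phi> unfolding is_weak_deriv_def by (metis minus_minus)
    then show "(\<integral>x. \<phi> x *\<^sub>R (F x - G x) \<partial>lborel) = 0"
      using integrable_test_fun_L2[OF \<phi>] assms(4,5) by (simp add: scaleR_diff_right)
  qed (use assms in_L2_diff in auto)
  then show ?thesis by simp
qed

lemma in_H1_L2: "in_H1 f \<Longrightarrow> in_L2 f"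
  by (simp add: in_H1_def)

lemma in_H1_weak_deriv:
  assumes "in_H1 f" "b \<in> Basis"
  shows "in_L2 (weak_deriv b f)" "is_weak_deriv b f (weak_deriv b f)"
proof -
  have "\<exists>g. in_L2 g \<and> is_weak_deriv b f g" using assms by (simp add: in_H1_def)
  from someI_ex[OF this] show "in_L2 (weak_deriv b f)" "is_weak_deriv b f (weak_deriv b f)"
    by (auto simp: weak_deriv_def)
qed

lemma in_H1_diff:
  assumes "in_H1 f" "in_H1 g" shows "in_H1 (\<lambda>x. f x - g x)"
  unfolding in_H1_def
proof (intro conjI ballI)
  show "\<exists>G. in_L2 G \<and> is_weak_deriv b (\<lambda>x. f x - g x) G" if "b \<in> Basis" for b
    using that assms
    by (intro exI[of _ "\<lambda>x. weak_deriv b f x - weak_deriv b g x"] conjI is_weak_deriv_diff in_L2_diff in_H1_weak_deriv in_H1_L2)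
qed (use assms in_L2_diff in_H1_L2 in auto)

text \<open>The choice behind \<open>weak_deriv\<close> need not be linear; uniqueness restores
  linearity almost everywhere, which is all that L2 norms see.\<close>

lemma weak_deriv_diff_AE:
  fixes f :: "'a::euclidean_space \<Rightarrow> complex"
  assumes \<psi>: "friedrichs_mollifier (\<psi> :: 'a \<Rightarrow> real)" and "in_H1 f" "in_H1 g" "b \<in> Basis"
  shows "AE x in lborel. weak_deriv b (\<lambda>x. f x - g x) x = weak_deriv b f x - weak_deriv b g x"
  using assms
  by (intro is_weak_deriv_unique[OF \<psi>, of b "\<lambda>x. f x - g x"] is_weak_deriv_diff in_L2_diff in_H1_weak_deriv in_H1_L2 in_H1_diff)

lemma L2_norm_weak_deriv_diff:
  fixes f :: "'a::euclidean_space \<Rightarrow> complex"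
  assumes \<psi>: "friedrichs_mollifier (\<psi> :: 'a \<Rightarrow> real)" and H: "in_H1 f" "in_H1 g" and b: "b \<in> Basis"
  shows "L2_norm (weak_deriv b (\<lambda>x. f x - g x)) = L2_norm (\<lambda>x. weak_deriv b f x - weak_deriv b g x)"
  using H b
  by (intro L2_norm_cong_AE[OF _ _ weak_deriv_diff_AE[OF \<psi> H b]] in_L2_measurable in_L2_diff in_H1_weak_deriv in_H1_diff)

lemma L2_norm_le_H1: "L2_norm f \<le> H1_norm f"
  unfolding H1_norm_def by (rule real_le_rsqrt) (simp add: sum_nonneg)

lemma L2_norm_weak_deriv_le_H1:
  assumes "b \<in> Basis" shows "L2_norm (weak_deriv b f) \<le> H1_norm f"
proof -
  have "(L2_norm (weak_deriv b f))\<^sup>2 \<le> (\<Sum>b\<in>Basis. (L2_norm (weak_deriv b f))\<^sup>2)"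
    using assms by (intro member_le_sum) auto
  then show ?thesis unfolding H1_norm_def by (intro real_le_rsqrt) (simp add: add_increasing)
qed

lemma continuous_in_H1_L2:
  assumes "continuous_in_H1 T u" "t \<in> {0..T}"
  shows "((\<lambda>s. L2_norm (\<lambda>x. u s x - u t x)) \<longlongrightarrow> 0) (at t within {0..T})"
  by (rule tendsto_sandwich[OF _ _ tendsto_const, of _ _ _ "\<lambda>s. H1_norm (\<lambda>x. u s x - u t x)"])
    (use assms in \<open>auto simp: continuous_in_H1_def L2_norm_nonneg L2_norm_le_H1\<close>)

text \<open>\<open>continuous_in_H1\<close> speaks of the chosen derivative of a difference; here it
  is turned into the difference of the chosen derivatives.\<close>

lemma continuous_in_H1_weak_deriv:
  fixes u :: "real \<Rightarrow> 'a::euclidean_space \<Rightarrow> complex"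
  assumes \<psi>: "friedrichs_mollifier (\<psi> :: 'a \<Rightarrow> real)"
    and u: "continuous_in_H1 T u" and t: "t \<in> {0..T}" and b: "b \<in> Basis"
  shows "((\<lambda>s. L2_norm (\<lambda>x. weak_deriv b (u s) x - weak_deriv b (u t) x)) \<longlongrightarrow> 0) (at t within {0..T})"
proof (rule tendsto_sandwich[OF _ _ tendsto_const, of _ _ _ "\<lambda>s. H1_norm (\<lambda>x. u s x - u t x)"])
  have "L2_norm (\<lambda>x. weak_deriv b (u s) x - weak_deriv b (u t) x) \<le> H1_norm (\<lambda>x. u s x - u t x)"
    if s: "s \<in> {0..T}" for s
  proof -
    have "in_H1 (u s)" "in_H1 (u t)" using u s t by (auto simp: continuous_in_H1_def)
    from L2_norm_weak_deriv_diff[OF \<psi> this b] L2_norm_weak_deriv_le_H1[OF b, of "\<lambda>x. u s x - u t x"]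
    show ?thesis by simp
  qed
  then show "\<forall>\<^sub>F s in at t within {0..T}. L2_norm (\<lambda>x. weak_deriv b (u s) x - weak_deriv b (u t) x) \<le> H1_norm (\<lambda>x. u s x - u t x)"
    by (simp add: eventually_at_filter)
qed (use u t in \<open>auto simp: continuous_in_H1_def L2_norm_nonneg\<close>)

section \<open>Density of test functions\<close>

lemma mollifier_positive_point:
  assumes "friedrichs_mollifier \<psi>" obtains x0 where "\<psi> x0 > 0"
proof -
  have "\<exists>x. \<psi> x \<noteq> 0"
  proof (rule ccontr)
    assume "\<nexists>x. \<psi> x \<noteq> 0"
    then have "\<psi> = (\<lambda>_. 0)" by auto
    with assms show False by (simp add: friedrichs_mollifier_def)
  qed
  with assms that show thesis unfolding friedrichs_mollifier_def by (metis less_le)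
qed

lemma linear_scaleR_self: "linear (\<lambda>x. c *\<^sub>R x)"
  by (simp add: linear_iff scaleR_add_right)

text \<open>The cut-offs are \<open>\<psi>\<close> recentred at a point \<open>x0\<close> where it
  is positive, divided by \<open>\<psi> x0\<close> and stretched by \<open>Suc n\<close>. They need
  not equal 1 on any ball: the pointwise limit 1, the uniform bound and gradients of order
  \<open>1 / Suc n\<close> suffice for dominated convergence.\<close>

lemma test_fun_cutoff_sequence:
  fixes \<psi> :: "'a::euclidean_space \<Rightarrow> real"
  assumes \<psi>: "friedrichs_mollifier \<psi>"
  obtains cut :: "nat \<Rightarrow> 'a \<Rightarrow> real" and B where "\<And>n. test_fun (cut n)" "\<And>n x. \<bar>cut n x\<bar> \<le> B"
    "\<And>n b x. b \<in> Basis \<Longrightarrow> \<bar>dir_deriv b (cut n) x\<bar> \<le> B / Suc n" "\<And>x. (\<lambda>n. cut n x) \<longlonglongrightarrow> 1"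
proof -
  note t = mollifier_test_fun[OF \<psi>]
  obtain x0 where x0: "\<psi> x0 > 0" using mollifier_positive_point[OF \<psi>] .
  define cut where "cut n x = inverse (\<psi> x0) * \<psi> (inverse (real (Suc n)) *\<^sub>R x + x0)" for n x
  obtain R where R: "R > 0" "\<And>x. norm x \<ge> R \<Longrightarrow> \<psi> x = 0" using test_fun_outside_ball[OF t] by blast
  obtain B0 where B0: "\<And>x. \<bar>\<psi> x\<bar> \<le> B0" using test_fun_bounded[OF t] by blast
  have "\<forall>b\<in>Basis. \<exists>B. \<forall>x. \<bar>dir_deriv b \<psi> x\<bar> \<le> B"
    using test_fun_dir_deriv[OF t] test_fun_bounded by metis
  then obtain B1 where B1: "\<And>b x. b \<in> Basis \<Longrightarrow> \<bar>dir_deriv b \<psi> x\<bar> \<le> B1 b" by metis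
  define B where "B = inverse (\<psi> x0) * (B0 + (\<Sum>b\<in>Basis. B1 b))"
  have B00: "B0 \<ge> 0" using B0[of 0] by linarith
  have B10: "B1 b \<ge> 0" if "b \<in> Basis" for b using B1[OF that, of 0] by linarith
  have sB: "B1 b \<le> (\<Sum>b\<in>Basis. B1 b)" if "b \<in> Basis" for b
    using that B10 by (intro member_le_sum) auto
  have s: "smooth (\<lambda>x. \<psi> (inverse (real (Suc n)) *\<^sub>R x + x0))" for n
    by (rule smooth_affine[OF linear_scaleR_self test_fun_smooth[OF t]])
  have 1: "test_fun (cut n)" for n
  proof (rule test_fun_outside_ballI[where R = "real (Suc n) * (R + norm x0)"])
    show "smooth (cut n)" unfolding cut_def[abs_def] by (intro smooth_mult smooth_const s)
    show "cut n x = 0" if "real (Suc n) * (R + norm x0) \<le> norm x" for x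
    proof -
      have "R + norm x0 \<le> norm (inverse (real (Suc n)) *\<^sub>R x)"
        using that by (simp add: field_simps)
      then have "R \<le> norm (inverse (real (Suc n)) *\<^sub>R x + x0)"
        using norm_triangle_ineq4[of "inverse (real (Suc n)) *\<^sub>R x + x0" x0] by simp
      then show ?thesis using R by (simp add: cut_def)
    qed
  qed
  have 2: "\<bar>cut n x\<bar> \<le> B" for n x
  proof -
    have "\<bar>cut n x\<bar> \<le> inverse (\<psi> x0) * B0"
      using B0 x0 by (auto simp: cut_def abs_mult intro!: mult_left_mono)
    also have "\<dots> \<le> B" unfolding B_def using x0 B10 by (intro mult_left_mono) (auto intro: sum_nonneg)
    finally show ?thesis .
  qed
  have 3: "\<bar>dir_deriv b (cut n) x\<bar> \<le> B / Suc n" if b: "b \<in> Basis" for n b x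
  proof -
    let ?z = "inverse (real (Suc n)) *\<^sub>R x + x0"
    have "((\<lambda>x. inverse (real (Suc n)) *\<^sub>R x + x0) has_derivative (\<lambda>h. inverse (real (Suc n)) *\<^sub>R h)) (at x)"
      by (auto intro!: derivative_eq_intros)
    from has_derivative_compose[OF this test_fun_has_derivative[OF t]]
    have "(cut n has_derivative (\<lambda>h. inverse (\<psi> x0) * (\<Sum>c\<in>Basis. ((inverse (real (Suc n)) *\<^sub>R h) \<bullet> c) * dir_deriv c \<psi> ?z))) (at x)"
      unfolding cut_def[abs_def] by (intro has_derivative_mult_right)
    from dir_deriv_eqI[OF this, of b]
    have "dir_deriv b (cut n) x = inverse (\<psi> x0) * (inverse (real (Suc n)) * (\<Sum>c\<in>Basis. (b \<bullet> c) * dir_deriv c \<psi> ?z))"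
      by (simp add: sum_distrib_left mult_ac)
    also have "(\<Sum>c\<in>Basis. (b \<bullet> c) * dir_deriv c \<psi> ?z) = dir_deriv b \<psi> ?z"
      by (rule sum_inner_Basis[OF b])
    finally have "\<bar>dir_deriv b (cut n) x\<bar> = inverse (real (Suc n)) * (inverse (\<psi> x0) * \<bar>dir_deriv b \<psi> ?z\<bar>)"
      using x0 by (simp add: abs_mult mult_ac)
    also have "\<dots> \<le> inverse (real (Suc n)) * B"
      unfolding B_def using B1[OF b, of ?z] sB[OF b] B00 x0 by (intro mult_left_mono) auto
    finally show ?thesis by (simp add: field_simps)
  qed
  have 4: "(\<lambda>n. cut n x) \<longlonglongrightarrow> 1" for x
  proof -
    have "(\<lambda>n. inverse (real (Suc n)) *\<^sub>R x + x0) \<longlonglongrightarrow> 0 *\<^sub>R x + x0"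
      by (intro tendsto_intros LIMSEQ_inverse_real_of_nat)
    then have "(\<lambda>n. \<psi> (inverse (real (Suc n)) *\<^sub>R x + x0)) \<longlonglongrightarrow> \<psi> x0"
      using continuous_on_tendsto_compose[OF test_fun_continuous[OF t, of UNIV]] by auto
    then have "(\<lambda>n. inverse (\<psi> x0) * \<psi> (inverse (real (Suc n)) *\<^sub>R x + x0)) \<longlonglongrightarrow> inverse (\<psi> x0) * \<psi> x0"
      by (intro tendsto_intros)
    then show ?thesis using x0 by (simp add: cut_def)
  qed
  from that[OF 1 2 3 4] show thesis .
qed

text \<open>The shape is that of the product rule: \<open>m n\<close> is a cut-off,
  \<open>k n\<close> one of its partial derivatives, and \<open>f\<close> the corresponding
  derivative of \<open>g\<close>. With \<open>k n = 0\<close> and \<open>f = g\<close> it covers the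
  function itself.\<close>

lemma cutoff_L2_converges:
  fixes f g :: "'a::euclidean_space \<Rightarrow> complex" and m k :: "nat \<Rightarrow> 'a \<Rightarrow> real"
  assumes f: "in_L2 f" and g: "in_L2 g"
    and [measurable]: "\<And>n. m n \<in> borel_measurable borel" "\<And>n. k n \<in> borel_measurable borel"
    and B: "\<And>n x. \<bar>m n x\<bar> \<le> B" "\<And>n x. \<bar>k n x\<bar> \<le> B"
    and lim: "\<And>x. (\<lambda>n. m n x) \<longlonglongrightarrow> 1" "\<And>x. (\<lambda>n. k n x) \<longlonglongrightarrow> 0"
  shows "(\<lambda>n. L2_norm (\<lambda>x. (m n x *\<^sub>R f x + k n x *\<^sub>R g x) - f x)) \<longlonglongrightarrow> 0"
proof (rule L2_norm_dominated_convergence[where W = "\<lambda>x. 2 * ((B + 1)\<^sup>2 * (norm (f x))\<^sup>2) + 2 * (B\<^sup>2 * (norm (g x))\<^sup>2)"])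
  note [measurable] = in_L2_measurable[OF f] in_L2_measurable[OF g]
  show "(\<lambda>x. m n x *\<^sub>R f x + k n x *\<^sub>R g x) \<in> borel_measurable borel" for n by measurable
  show "f \<in> borel_measurable borel" by measurable
  show "integrable lborel (\<lambda>x. 2 * ((B + 1)\<^sup>2 * (norm (f x))\<^sup>2) + 2 * (B\<^sup>2 * (norm (g x))\<^sup>2))"
    using in_L2_norm_integrable[OF f] in_L2_norm_integrable[OF g] by simp
  show "AE x in lborel. (norm (m n x *\<^sub>R f x + k n x *\<^sub>R g x - f x))\<^sup>2
      \<le> 2 * ((B + 1)\<^sup>2 * (norm (f x))\<^sup>2) + 2 * (B\<^sup>2 * (norm (g x))\<^sup>2)" for n
  proof (rule AE_I2)
    fix x
    have e: "m n x *\<^sub>R f x + k n x *\<^sub>R g x - f x = (m n x - 1) *\<^sub>R f x + k n x *\<^sub>R g x"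
      by (simp add: scaleR_diff_left)
    have "(m n x - 1)\<^sup>2 \<le> (B + 1)\<^sup>2" using B(1)[of n x] by (intro power2_le_iff_abs_le[THEN iffD2]) auto
    then have "(norm ((m n x - 1) *\<^sub>R f x))\<^sup>2 \<le> (B + 1)\<^sup>2 * (norm (f x))\<^sup>2"
      by (simp add: power_mult_distrib mult_right_mono)
    moreover have "(k n x)\<^sup>2 \<le> B\<^sup>2" using B(2)[of n x] by (intro power2_le_iff_abs_le[THEN iffD2]) auto
    then have "(norm (k n x *\<^sub>R g x))\<^sup>2 \<le> B\<^sup>2 * (norm (g x))\<^sup>2"
      by (simp add: power_mult_distrib mult_right_mono)
    ultimately show "(norm (m n x *\<^sub>R f x + k n x *\<^sub>R g x - f x))\<^sup>2
      \<le> 2 * ((B + 1)\<^sup>2 * (norm (f x))\<^sup>2) + 2 * (B\<^sup>2 * (norm (g x))\<^sup>2)"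
      unfolding e using norm_add_square_le[of "(m n x - 1) *\<^sub>R f x" "k n x *\<^sub>R g x"] by linarith
  qed
  show "AE x in lborel. (\<lambda>n. m n x *\<^sub>R f x + k n x *\<^sub>R g x) \<longlonglongrightarrow> f x"
  proof (rule AE_I2)
    fix x
    have "(\<lambda>n. m n x *\<^sub>R f x + k n x *\<^sub>R g x) \<longlonglongrightarrow> 1 *\<^sub>R f x + 0 *\<^sub>R g x"
      by (intro tendsto_intros lim)
    then show "(\<lambda>n. m n x *\<^sub>R f x + k n x *\<^sub>R g x) \<longlonglongrightarrow> f x" by simp
  qed
qed

lemma finite_positive_lower_bound:
  fixes d :: "'b \<Rightarrow> real"
  assumes "finite A" "\<And>a. a \<in> A \<Longrightarrow> d a > 0"
  obtains d0 where "d0 > 0" "\<And>a. a \<in> A \<Longrightarrow> d0 \<le> d a"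
proof
  show "Min (insert 1 (d ` A)) > 0" using assms by auto
  show "Min (insert 1 (d ` A)) \<le> d a" if "a \<in> A" for a using assms(1) that by (intro Min_le) auto
qed

text \<open>Mollification makes \<open>f\<close> smooth and a cut-off makes it compactly supported;
  each costs less than \<open>e / 2\<close>. One mollifier and one cut-off must serve
  \<open>f\<close> and all its partial derivatives. The result is a pair of functions because
  \<open>test_fun\<close> concerns real functions.\<close>

lemma test_fun_dense_H1:
  fixes f :: "'a::euclidean_space \<Rightarrow> complex" and F :: "'a \<Rightarrow> 'a \<Rightarrow> complex"
  assumes \<psi>: "friedrichs_mollifier (\<psi> :: 'a \<Rightarrow> real)" and f: "in_L2 f"
    and F: "\<And>b. b \<in> Basis \<Longrightarrow> in_L2 (F b)" "\<And>b. b \<in> Basis \<Longrightarrow> is_weak_deriv b f (F b)" and e: "e > 0"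
  obtains \<phi> \<theta> :: "'a \<Rightarrow> real" where "test_fun \<phi>" "test_fun \<theta>"
    "L2_norm (\<lambda>x. Complex (\<phi> x) (\<theta> x) - f x) < e"
    "\<And>b. b \<in> Basis \<Longrightarrow> L2_norm (\<lambda>x. Complex (dir_deriv b \<phi> x) (dir_deriv b \<theta> x) - F b x) < e"
proof -
  have e2: "e / 2 > 0" using e by simp
  obtain df where df: "df > 0" "\<And>\<rho>. friedrichs_mollifier \<rho> \<Longrightarrow> (\<forall>x. norm x \<ge> df \<longrightarrow> \<rho> x = 0) \<Longrightarrow>
      L2_norm (\<lambda>x. fun_conv f \<rho> x - f x) < e / 2" using mollification_converges[OF f e2] by blast
  have "\<forall>b\<in>Basis. \<exists>d>0. \<forall>\<rho>. friedrichs_mollifier \<rho> \<longrightarrow> (\<forall>x. norm x \<ge> d \<longrightarrow> \<rho> x = 0) \<longrightarrow>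
      L2_norm (\<lambda>x. fun_conv (F b) \<rho> x - F b x) < e / 2"
    using mollification_converges[OF F(1) e2] by blast
  then obtain dF where dF: "\<And>b. b \<in> Basis \<Longrightarrow> dF b > 0"
    "\<And>b \<rho>. b \<in> Basis \<Longrightarrow> friedrichs_mollifier \<rho> \<Longrightarrow> (\<forall>x. norm x \<ge> dF b \<longrightarrow> \<rho> x = 0) \<Longrightarrow>
      L2_norm (\<lambda>x. fun_conv (F b) \<rho> x - F b x) < e / 2" by metis
  obtain d0 where d0: "d0 > 0" "\<And>b. b \<in> Basis \<Longrightarrow> d0 \<le> dF b"
    using finite_positive_lower_bound[of Basis dF] dF(1) by auto
  \<comment> \<open>A support radius that suits \<open>f\<close> and every
    \<open>F b\<close>.\<close>
  have "min d0 df > 0" using d0 df by simp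
  then obtain \<rho> :: "'a \<Rightarrow> real" where \<rho>: "friedrichs_mollifier \<rho>" "\<And>x. norm x \<ge> min d0 df \<Longrightarrow> \<rho> x = 0"
    using mollifier_small_support[OF \<psi>] by blast
  note t = mollifier_test_fun[OF \<rho>(1)]
  define g where "g = fun_conv f \<rho>"
  define G where "G b = fun_conv (F b) \<rho>" for b
  have g: "in_L2 g" "L2_norm (\<lambda>x. g x - f x) < e / 2"
    unfolding g_def using fun_conv_mollifier_L2[OF \<rho>(1) f] df(2)[OF \<rho>(1)] \<rho>(2) by auto
  have G: "in_L2 (G b)" "L2_norm (\<lambda>x. G b x - F b x) < e / 2" if b: "b \<in> Basis" for b
  proof -
    have "\<rho> x = 0" if "norm x \<ge> dF b" for x using that d0(2)[OF b] by (intro \<rho>(2)) linarith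
    then show "in_L2 (G b)" "L2_norm (\<lambda>x. G b x - F b x) < e / 2"
      unfolding G_def using fun_conv_mollifier_L2[OF \<rho>(1) F(1)[OF b]] dF(2)[OF b \<rho>(1)] by auto
  qed
  obtain cut :: "nat \<Rightarrow> 'a \<Rightarrow> real" and B where cut: "\<And>n. test_fun (cut n)" "\<And>n x. \<bar>cut n x\<bar> \<le> B"
    "\<And>n b x. b \<in> Basis \<Longrightarrow> \<bar>dir_deriv b (cut n) x\<bar> \<le> B / Suc n" "\<And>x. (\<lambda>n. cut n x) \<longlonglongrightarrow> 1"
    using test_fun_cutoff_sequence[OF \<psi>] by blast
  have cutm: "cut n \<in> borel_measurable borel" for n using test_fun_measurable[OF cut(1)] .
  have B: "B \<ge> 0" using cut(2)[of 0 0] by linarith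
  \<comment> \<open>The zero summand fits the function itself into the pattern of
    \<open>cutoff_L2_converges\<close>.\<close>
  have lim1: "(\<lambda>n. L2_norm (\<lambda>x. (cut n x *\<^sub>R g x + 0 *\<^sub>R g x) - g x)) \<longlonglongrightarrow> 0"
    by (rule cutoff_L2_converges[where B = B]) (use g cut cutm B in auto)
  have lim2: "(\<lambda>n. L2_norm (\<lambda>x. (cut n x *\<^sub>R G b x + dir_deriv b (cut n) x *\<^sub>R g x) - G b x)) \<longlonglongrightarrow> 0"
    if b: "b \<in> Basis" for b
  proof (rule cutoff_L2_converges[where B = B])
    show "\<bar>dir_deriv b (cut n) x\<bar> \<le> B" for n x
    proof (rule order_trans[OF cut(3)[OF b]])
      have "B / real (Suc n) \<le> B / 1" using B by (intro divide_left_mono) auto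
      then show "B / real (Suc n) \<le> B" by simp
    qed
    show "(\<lambda>n. dir_deriv b (cut n) x) \<longlonglongrightarrow> 0" for x
    proof (rule tendsto_rabs_zero_cancel, rule tendsto_sandwich[OF _ _ tendsto_const])
      show "(\<lambda>n. B / Suc n) \<longlonglongrightarrow> 0"
        using tendsto_mult_right_zero[OF LIMSEQ_inverse_real_of_nat, of B] by (simp add: field_simps)
    qed (use cut(3)[OF b] in auto)
    show "dir_deriv b (cut n) \<in> borel_measurable borel" for n
      using test_fun_measurable[OF test_fun_dir_deriv[OF cut(1) b]] .
  qed (use g G[OF b] cut cutm in auto)
  have "\<forall>\<^sub>F n in sequentially. \<forall>b\<in>Basis. L2_norm (\<lambda>x. (cut n x *\<^sub>R G b x + dir_deriv b (cut n) x *\<^sub>R g x) - G b x) < e / 2"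
    by (intro eventually_ball_finite ballI order_tendstoD(2)[OF lim2 e2]) auto
  with order_tendstoD(2)[OF lim1 e2]
  have "\<forall>\<^sub>F n in sequentially. L2_norm (\<lambda>x. (cut n x *\<^sub>R g x + 0 *\<^sub>R g x) - g x) < e / 2 \<and>
    (\<forall>b\<in>Basis. L2_norm (\<lambda>x. (cut n x *\<^sub>R G b x + dir_deriv b (cut n) x *\<^sub>R g x) - G b x) < e / 2)"
    by eventually_elim auto
  then obtain n where n: "L2_norm (\<lambda>x. cut n x *\<^sub>R g x - g x) < e / 2"
    "\<And>b. b \<in> Basis \<Longrightarrow> L2_norm (\<lambda>x. (cut n x *\<^sub>R G b x + dir_deriv b (cut n) x *\<^sub>R g x) - G b x) < e / 2"
    using eventually_happens'[OF sequentially_bot] by fastforce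
  \<comment> \<open>\<open>z = 1\<close> and \<open>z = \<i>\<close> give the real and the imaginary
    part of the cut-off mollification.\<close>
  define \<phi> where "\<phi> z x = cut n x * (g x \<bullet> z)" for z x
  have sm: "smooth (\<lambda>x. g x \<bullet> z)" for z
    unfolding g_def by (rule smooth_fun_conv_inner[OF t f])
  have tf: "test_fun (\<phi> z)" for z
    unfolding \<phi>_def[abs_def] by (rule test_fun_mult_smooth[OF cut(1) sm])
  have dd: "dir_deriv b (\<phi> z) x = (cut n x *\<^sub>R G b x + dir_deriv b (cut n) x *\<^sub>R g x) \<bullet> z" if b: "b \<in> Basis" for b z x
  proof -
    have "dir_deriv b (\<lambda>x. g x \<bullet> z) = (\<lambda>x. G b x \<bullet> z)"
      unfolding g_def G_def dir_deriv_fun_conv_inner[OF t f b] fun_conv_dir_deriv[OF t b F(2)[OF b]] ..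
    then show ?thesis
      unfolding \<phi>_def[abs_def]
      by (subst dir_deriv_mult[OF smooth_imp_differentiable[OF test_fun_smooth[OF cut(1)]] smooth_imp_differentiable[OF sm]])
        (simp add: inner_add_left)
  qed
  have C: "Complex (w \<bullet> 1) (w \<bullet> \<i>) = w" for w by (simp add: complex_eq_iff inner_complex_def)
  have e1: "(\<lambda>x. Complex (\<phi> 1 x) (\<phi> \<i> x) - f x) = (\<lambda>x. cut n x *\<^sub>R g x - f x)"
    using C[of "cut n x *\<^sub>R g x" for x] by (simp add: \<phi>_def)
  have m: "cut n \<in> borel_measurable borel" "AE x in lborel. \<bar>cut n x\<bar> \<le> B" using cut cutm by auto
  show thesis
  proof (rule that[OF tf[of 1] tf[of \<i>]])
    show "L2_norm (\<lambda>x. Complex (\<phi> 1 x) (\<phi> \<i> x) - f x) < e"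
      unfolding e1
      using L2_norm_triangle_diff[OF in_L2_bounded_mult[OF g(1) m] g(1) f] n(1) g(2) by linarith
    show "L2_norm (\<lambda>x. Complex (dir_deriv b (\<phi> 1) x) (dir_deriv b (\<phi> \<i>) x) - F b x) < e" if b: "b \<in> Basis" for b
    proof -
      obtain B' where "\<And>x. \<bar>dir_deriv b (cut n) x\<bar> \<le> B'"
        using test_fun_bounded[OF test_fun_dir_deriv[OF cut(1) b]] by blast
      then have "in_L2 (\<lambda>x. dir_deriv b (cut n) x *\<^sub>R g x)"
        using test_fun_measurable[OF test_fun_dir_deriv[OF cut(1) b]]
        by (intro in_L2_bounded_mult[OF g(1), where B = B']) auto
      then have L: "in_L2 (\<lambda>x. cut n x *\<^sub>R G b x + dir_deriv b (cut n) x *\<^sub>R g x)"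
        by (intro in_L2_add in_L2_bounded_mult[OF G(1)[OF b] m])
      show ?thesis
        unfolding dd[OF b] C
        using L2_norm_triangle_diff[OF L G(1)[OF b] F(1)[OF b]] n(2)[OF b] G(2)[OF b] by linarith
    qed
  qed
qed

text \<open>The restriction of \<open>\<psi>\<close> to a line through a point where it is positive
  can be normalised: if its integral were zero, this nonnegative function would vanish almost
  everywhere, but by continuity it is nonzero on a nonempty open set.\<close>

lemma mollifier_on_line:
  fixes \<psi> :: "'a::euclidean_space \<Rightarrow> real"
  assumes \<psi>: "friedrichs_mollifier \<psi>"
  obtains \<eta> :: "real \<Rightarrow> real" where "friedrichs_mollifier \<eta>"
proof -
  note t = mollifier_test_fun[OF \<psi>]
  obtain x0 where x0: "\<psi> x0 > 0" using mollifier_positive_point[OF \<psi>] .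
  obtain b :: 'a where b: "b \<in> Basis" using nonempty_Basis by blast
  define k where "k t = \<psi> (t *\<^sub>R b + x0)" for t :: real
  obtain R where R: "R > 0" "\<And>x. norm x \<ge> R \<Longrightarrow> \<psi> x = 0" using test_fun_outside_ball[OF t] by blast
  have tk: "test_fun k"
  proof (rule test_fun_outside_ballI[where R = "R + norm x0"])
    show "smooth k" unfolding k_def[abs_def]
      by (rule smooth_affine[OF _ test_fun_smooth[OF t]]) (simp add: linear_iff scaleR_add_left)
    show "k s = 0" if "R + norm x0 \<le> norm s" for s
    proof -
      have "R \<le> norm (s *\<^sub>R b + x0)"
        using norm_triangle_ineq4[of "s *\<^sub>R b + x0" x0] that norm_Basis[OF b] by simp
      then show ?thesis using R by (simp add: k_def)
    qed
  qed
  have nn: "k t \<ge> 0" for t using \<psi> by (simp add: k_def friedrichs_mollifier_def)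
  have "(\<integral>t. k t \<partial>lborel) \<noteq> 0"
  proof
    assume "(\<integral>t. k t \<partial>lborel) = 0"
    then have "AE t in lborel. k t = 0"
      using integral_nonneg_eq_0_iff_AE[OF integrable_test_fun[OF tk]] nn by auto
    then have "AE t in lebesgue. k t = 0" by (simp add: AE_completion_iff)
    then have "{t. k t \<noteq> 0} \<in> null_sets lebesgue"
      using test_fun_measurable[OF tk] by (auto simp: AE_iff_null_sets)
    then have "negligible {t. k t \<noteq> 0}" by (simp add: negligible_iff_null_sets)
    moreover have "open {t. k t \<noteq> 0}"
      using test_fun_continuous[OF tk, of UNIV] by (intro open_Collect_neq) auto
    moreover have "0 \<in> {t. k t \<noteq> 0}" using x0 by (simp add: k_def)
    ultimately show False using open_not_negligible by blast
  qed
  moreover have "(\<integral>t. k t \<partial>lborel) \<ge> 0" using nn by (intro integral_nonneg_AE) auto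
  ultimately have pos: "(\<integral>t. k t \<partial>lborel) > 0" by simp
  have "friedrichs_mollifier (\<lambda>t. k t * inverse (\<integral>t. k t \<partial>lborel))"
    using pos nn test_fun_mult_smooth[OF tk smooth_const] by (auto simp: friedrichs_mollifier_def)
  with that show thesis .
qed

section \<open>The equation integrated in time\<close>

text \<open>The weak formulation treats the solution, its partial derivatives and the lower-order
  term as separate curves; continuity in L2 is what they have in common.\<close>

definition continuous_in_L2 :: "real \<Rightarrow> (real \<Rightarrow> 'a::euclidean_space \<Rightarrow> complex) \<Rightarrow> bool" where
  "continuous_in_L2 T u \<longleftrightarrow>
     (\<forall>t\<in>{0..T}. in_L2 (u t)) \<and>
     (\<forall>t\<in>{0..T}. ((\<lambda>s. L2_norm (\<lambda>x. u s x - u t x)) \<longlongrightarrow> 0) (at t within {0..T}))"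

lemma continuous_in_L2D: "continuous_in_L2 T u \<Longrightarrow> t \<in> {0..T} \<Longrightarrow> in_L2 (u t)"
  by (simp add: continuous_in_L2_def)

lemma continuous_in_H1_imp_L2: "continuous_in_H1 T u \<Longrightarrow> continuous_in_L2 T u"
  using continuous_in_H1_L2[of T u] by (auto simp: continuous_in_L2_def continuous_in_H1_def in_H1_L2)

lemma continuous_in_H1_imp_L2_weak_deriv:
  fixes u :: "real \<Rightarrow> 'a::euclidean_space \<Rightarrow> complex"
  assumes "friedrichs_mollifier (\<psi> :: 'a \<Rightarrow> real)" "continuous_in_H1 T u" "b \<in> Basis"
  shows "continuous_in_L2 T (\<lambda>t. weak_deriv b (u t))"
  using continuous_in_H1_weak_deriv[OF assms(1,2) _ assms(3)] assms(2,3)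
  by (auto simp: continuous_in_L2_def continuous_in_H1_def in_H1_weak_deriv)

lemma continuous_on_of_L2:
  fixes F :: "('a::euclidean_space \<Rightarrow> complex) \<Rightarrow> 'b::real_normed_vector"
  assumes u: "continuous_in_L2 T u"
    and F: "\<And>f g. in_L2 f \<Longrightarrow> in_L2 g \<Longrightarrow> norm (F f - F g) \<le> C * L2_norm (\<lambda>x. f x - g x)"
  shows "continuous_on {0..T} (\<lambda>t. F (u t))"
  unfolding continuous_on_def
proof
  fix t assume t: "t \<in> {0..T}"
  have "((\<lambda>s. F (u s) - F (u t)) \<longlongrightarrow> 0) (at t within {0..T})"
  proof (rule Lim_null_comparison)
    show "\<forall>\<^sub>F s in at t within {0..T}. norm (F (u s) - F (u t)) \<le> C * L2_norm (\<lambda>x. u s x - u t x)"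
      using F continuous_in_L2D[OF u] t by (auto simp: eventually_at_filter)
    show "((\<lambda>s. C * L2_norm (\<lambda>x. u s x - u t x)) \<longlongrightarrow> 0) (at t within {0..T})"
      using u t by (auto simp: continuous_in_L2_def intro: tendsto_mult_right_zero)
  qed
  then show "((\<lambda>s. F (u s)) \<longlongrightarrow> F (u t)) (at t within {0..T})"
    by (simp add: LIM_zero_iff)
qed

lemma continuous_on_L2_norm: "continuous_in_L2 T u \<Longrightarrow> continuous_on {0..T} (\<lambda>t. L2_norm (u t))"
  by (rule continuous_on_of_L2[where C = 1]) (auto simp: L2_norm_abs_diff_le)

lemma continuous_on_L2_inner:
  assumes "continuous_in_L2 T u" "in_L2 v" shows "continuous_on {0..T} (\<lambda>t. L2_inner (u t) v)"
proof (rule continuous_on_of_L2[OF assms(1), where C = "L2_norm v"])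
  show "norm (L2_inner f v - L2_inner g v) \<le> L2_norm v * L2_norm (\<lambda>x. f x - g x)" if "in_L2 f" "in_L2 g" for f g
    using L2_inner_le[OF in_L2_diff[OF that] assms(2)] L2_inner_diff_left[OF that assms(2)] by (simp add: mult.commute)
qed

lemma continuous_on_test_pairing:
  assumes "continuous_in_L2 T u" "test_fun \<phi>"
  shows "continuous_on {0..T} (\<lambda>t. \<integral>x. \<phi> x *\<^sub>R u t x \<partial>lborel)"
proof (rule continuous_on_of_L2[OF assms(1)])
  show "norm ((\<integral>x. \<phi> x *\<^sub>R f x \<partial>lborel) - (\<integral>x. \<phi> x *\<^sub>R g x \<partial>lborel))
    \<le> L2_norm (\<lambda>x. complex_of_real (\<phi> x)) * L2_norm (\<lambda>x. f x - g x)" if "in_L2 f" "in_L2 g" for f g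
    using norm_integral_test_fun_L2_le[OF assms(2) in_L2_diff[OF that]] integrable_test_fun_L2[OF assms(2)] that
    by (simp add: scaleR_diff_right)
qed

lemma continuous_in_L2_bounded:
  assumes "continuous_in_L2 T u" obtains M where "M \<ge> 0" "\<And>t. t \<in> {0..T} \<Longrightarrow> L2_norm (u t) \<le> M"
proof -
  have "bounded ((\<lambda>t. L2_norm (u t)) ` {0..T})"
    by (intro compact_imp_bounded compact_continuous_image continuous_on_L2_norm[OF assms]) simp
  then obtain M where "M > 0" "\<And>t. t \<in> {0..T} \<Longrightarrow> \<bar>L2_norm (u t)\<bar> \<le> M" by (auto simp: bounded_pos)
  with that[of M] show thesis by force
qed

lemma continuous_in_L2_mult:
  assumes u: "continuous_in_L2 T u" and p: "p \<in> borel_measurable borel" "AE x in lborel. \<bar>p x\<bar> \<le> P"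
  shows "continuous_in_L2 T (\<lambda>t x. p x *\<^sub>R u t x)"
  unfolding continuous_in_L2_def
proof (intro conjI ballI)
  fix t assume t: "t \<in> {0..T}"
  show "in_L2 (\<lambda>x. p x *\<^sub>R u t x)" using in_L2_bounded_mult[OF continuous_in_L2D[OF u t] p] .
  \<comment> \<open>The norm bound asks for a nonnegative factor, and the sign of \<open>P\<close>
    is not given.\<close>
  have P: "AE x in lborel. \<bar>p x\<bar> \<le> max P 0" using p(2) by auto
  show "((\<lambda>s. L2_norm (\<lambda>x. p x *\<^sub>R u s x - p x *\<^sub>R u t x)) \<longlongrightarrow> 0) (at t within {0..T})"
  proof (rule tendsto_sandwich[OF _ _ tendsto_const])
    have "L2_norm (\<lambda>x. p x *\<^sub>R u s x - p x *\<^sub>R u t x) \<le> max P 0 * L2_norm (\<lambda>x. u s x - u t x)" if "s \<in> {0..T}" for s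
      using L2_norm_bounded_mult[OF in_L2_diff[OF continuous_in_L2D[OF u that] continuous_in_L2D[OF u t]] p(1) P]
      by (simp add: scaleR_diff_right)
    then show "\<forall>\<^sub>F s in at t within {0..T}. L2_norm (\<lambda>x. p x *\<^sub>R u s x - p x *\<^sub>R u t x) \<le> max P 0 * L2_norm (\<lambda>x. u s x - u t x)"
      by (simp add: eventually_at_filter)
    show "((\<lambda>s. max P 0 * L2_norm (\<lambda>x. u s x - u t x)) \<longlongrightarrow> 0) (at t within {0..T})"
      using u t by (auto simp: continuous_in_L2_def intro: tendsto_mult_right_zero)
  qed (simp add: L2_norm_nonneg)
qed

lemma continuous_in_L2_diff:
  assumes u: "continuous_in_L2 T u" and v: "continuous_in_L2 T v"
  shows "continuous_in_L2 T (\<lambda>t x. u t x - v t x)"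
  unfolding continuous_in_L2_def
proof (intro conjI ballI)
  fix t assume t: "t \<in> {0..T}"
  note L = continuous_in_L2D[OF u] continuous_in_L2D[OF v]
  show "in_L2 (\<lambda>x. u t x - v t x)" using L t in_L2_diff by blast
  show "((\<lambda>s. L2_norm (\<lambda>x. u s x - v s x - (u t x - v t x))) \<longlongrightarrow> 0) (at t within {0..T})"
  proof (rule tendsto_sandwich[OF _ _ tendsto_const])
    have "L2_norm (\<lambda>x. u s x - v s x - (u t x - v t x)) \<le> L2_norm (\<lambda>x. u s x - u t x) + L2_norm (\<lambda>x. v s x - v t x)"
      if s: "s \<in> {0..T}" for s
    proof -
      have "(\<lambda>x. u s x - v s x - (u t x - v t x)) = (\<lambda>x. (u s x - u t x) - (v s x - v t x))" by auto
      then show ?thesis using L2_norm_minus_le[OF in_L2_diff[OF L(1)[OF s] L(1)[OF t]] in_L2_diff[OF L(2)[OF s] L(2)[OF t]]] by simp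
    qed
    then show "\<forall>\<^sub>F s in at t within {0..T}. L2_norm (\<lambda>x. u s x - v s x - (u t x - v t x)) \<le> L2_norm (\<lambda>x. u s x - u t x) + L2_norm (\<lambda>x. v s x - v t x)"
      by (simp add: eventually_at_filter)
    show "((\<lambda>s. L2_norm (\<lambda>x. u s x - u t x) + L2_norm (\<lambda>x. v s x - v t x)) \<longlongrightarrow> 0) (at t within {0..T})"
      using u v t by (intro tendsto_add_zero) (auto simp: continuous_in_L2_def)
  qed (simp add: L2_norm_nonneg)
qed

text \<open>Extension by zero turns a curve on the closed interval into an L2 function on the line,
  to which \<open>fun_conv\<close> applies.\<close>

lemma in_L2_indicator_continuous:
  fixes g :: "real \<Rightarrow> complex"
  assumes g: "continuous_on {0..T} g"
  shows "in_L2 (\<lambda>t. indicator {0..T} t *\<^sub>R g t)"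
proof -
  have "bounded (g ` {0..T})" by (intro compact_imp_bounded compact_continuous_image g) simp
  then obtain B where B: "B > 0" "\<And>t. t \<in> {0..T} \<Longrightarrow> norm (g t) \<le> B" by (auto simp: bounded_pos)
  show ?thesis
  proof (rule in_L2_bound)
    show "integrable lborel (\<lambda>t. B\<^sup>2 * indicator (cball 0 T) t :: real)" by (rule integrable_cball_indicator)
    show "AE t in lborel. (norm (indicator {0..T} t *\<^sub>R g t))\<^sup>2 \<le> B\<^sup>2 * indicator (cball 0 T) t"
      using B by (auto simp: indicator_def intro!: power_mono)
  qed (intro borel_measurable_continuous_on_indicator g, simp)
qed

text \<open>By \<open>eq\<close>, the mollified \<open>g\<close> has the mollified \<open>h\<close>
  as its derivative at every time whose window of radius \<open>d\<close> stays inside the open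
  interval. The fundamental theorem of calculus applies to the mollified functions, and uniform
  continuity removes the mollification as the support shrinks.\<close>

lemma mollified_derivative_limit:
  fixes g h :: "real \<Rightarrow> complex"
  assumes g: "continuous_on {0..T} g" and h: "continuous_on {0..T} h"
    and \<kappa>: "friedrichs_mollifier (\<kappa> :: real \<Rightarrow> real)" and ab: "0 < a" "a \<le> b" "b < T"
    and eq: "\<And>\<eta> d c. test_fun (\<eta> :: real \<Rightarrow> real) \<Longrightarrow> (\<And>t. \<bar>t\<bar> \<ge> d \<Longrightarrow> \<eta> t = 0) \<Longrightarrow> d < c \<Longrightarrow> c + d < T \<Longrightarrow>
      fun_conv (\<lambda>t. indicator {0..T} t *\<^sub>R g t) (dir_deriv 1 \<eta>) c = fun_conv (\<lambda>t. indicator {0..T} t *\<^sub>R h t) \<eta> c"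
  shows "(h has_integral (g b - g a)) {a..b}"
proof -
  define g1 h1 where "g1 = (\<lambda>t. indicator {0..T} t *\<^sub>R g t)" and "h1 = (\<lambda>t. indicator {0..T} t *\<^sub>R h t)"
  have L: "in_L2 g1" "in_L2 h1" unfolding g1_def h1_def using in_L2_indicator_continuous g h by auto
  have hi: "h integrable_on {a..b}"
    by (rule integrable_continuous_real[OF continuous_on_subset[OF h]]) (use ab in auto)
  \<comment> \<open>One \<open>e\<close> for each end point and \<open>e * (b - a)\<close> for
    replacing \<open>h\<close> under the integral.\<close>
  have "norm (g b - g a - integral {a..b} h) \<le> (2 + (b - a)) * e" if e: "e > 0" for e
  proof -
    have ug: "uniformly_continuous_on {0..T} g" and uh: "uniformly_continuous_on {0..T} h"
      using compact_uniformly_continuous g h by auto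
    obtain d1 where d1: "d1 > 0" "\<And>s t. s \<in> {0..T} \<Longrightarrow> t \<in> {0..T} \<Longrightarrow> dist t s < d1 \<Longrightarrow> dist (g t) (g s) < e"
      using ug e unfolding uniformly_continuous_on_def by blast
    obtain d2 where d2: "d2 > 0" "\<And>s t. s \<in> {0..T} \<Longrightarrow> t \<in> {0..T} \<Longrightarrow> dist t s < d2 \<Longrightarrow> dist (h t) (h s) < e"
      using uh e unfolding uniformly_continuous_on_def by blast
    \<comment> \<open>The halves keep \<open>d\<close> strictly below the distances from
      \<open>a\<close> to 0 and from \<open>b\<close> to \<open>T\<close>, so that windows around
      points of \<open>{a..b}\<close> stay inside.\<close>
    define d where "d = min (min d1 d2) (min (a / 2) ((T - b) / 2))"
    have "d \<le> (T - b) / 2" "d \<le> a / 2" unfolding d_def by linarith+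
    with ab have d': "d < a" "b + d < T" by (auto simp: field_simps)
    have d: "d > 0" "d \<le> d1" "d \<le> d2" "d < a" "b + d < T" using d1(1) d2(1) ab d' by (auto simp: d_def)
    obtain \<eta> :: "real \<Rightarrow> real" where \<eta>: "friedrichs_mollifier \<eta>" "\<And>t. norm t \<ge> d \<Longrightarrow> \<eta> t = 0"
      using mollifier_small_support[OF \<kappa> d(1)] by blast
    note t = mollifier_test_fun[OF \<eta>(1)]
    have near: "y \<in> {0..T}" "c \<in> {0..T}" if "c \<in> {a..b}" "norm (c - y) < d" for c y
      using that d ab by (auto simp: abs_less_iff)
    have ng: "norm (fun_conv g1 \<eta> c - g c) \<le> e" if c: "c \<in> {a..b}" for c
    proof (rule fun_conv_near[OF \<eta> L(1)])
      fix y assume y: "norm (c - y) < d"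
      show "norm (g1 y - g c) \<le> e"
        using d1(2)[OF near(2,1)[OF c y]] near[OF c y] y d by (simp add: g1_def dist_norm abs_minus_commute)
    qed
    have nh: "norm (fun_conv h1 \<eta> c - h c) \<le> e" if c: "c \<in> {a..b}" for c
    proof (rule fun_conv_near[OF \<eta> L(2)])
      fix y assume y: "norm (c - y) < d"
      show "norm (h1 y - h c) \<le> e"
        using d2(2)[OF near(2,1)[OF c y]] near[OF c y] y d by (simp add: h1_def dist_norm abs_minus_commute)
    qed
    have "(fun_conv h1 \<eta> has_integral (fun_conv g1 \<eta> b - fun_conv g1 \<eta> a)) {a..b}"
    proof (rule fundamental_theorem_of_calculus[OF ab(2)])
      fix c assume c: "c \<in> {a..b}"
      have "fun_conv g1 (dir_deriv 1 \<eta>) c = fun_conv h1 \<eta> c"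
        unfolding g1_def h1_def by (rule eq[OF t]) (use \<eta>(2) c d in auto)
      then have "(fun_conv g1 \<eta> has_derivative (\<lambda>k. k *\<^sub>R fun_conv h1 \<eta> c)) (at c)"
        using has_derivative_fun_conv[OF t L(1), of c] by simp
      then show "(fun_conv g1 \<eta> has_vector_derivative fun_conv h1 \<eta> c) (at c within {a..b})"
        unfolding has_vector_derivative_def by (rule has_derivative_at_withinI)
    qed
    from has_integral_diff[OF this integrable_integral[OF hi]]
    have "((\<lambda>c. fun_conv h1 \<eta> c - h c) has_integral (fun_conv g1 \<eta> b - fun_conv g1 \<eta> a - integral {a..b} h)) {a..b}" .
    then have "norm (fun_conv g1 \<eta> b - fun_conv g1 \<eta> a - integral {a..b} h) \<le> e * measure lborel (cbox a b)"
      by (intro has_integral_bound[where f = "\<lambda>c. fun_conv h1 \<eta> c - h c"]) (use e nh in auto)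
    then have i: "norm (fun_conv g1 \<eta> b - fun_conv g1 \<eta> a - integral {a..b} h) \<le> e * (b - a)" using ab by simp
    define X Y where "X = fun_conv g1 \<eta> b - fun_conv g1 \<eta> a - integral {a..b} h"
      and "Y = (fun_conv g1 \<eta> b - g b) - (fun_conv g1 \<eta> a - g a)"
    have "norm Y \<le> e + e"
      using ng[of a] ng[of b] ab norm_triangle_ineq4[of "fun_conv g1 \<eta> b - g b" "fun_conv g1 \<eta> a - g a"]
      unfolding Y_def by auto
    with i norm_triangle_ineq4[of X Y] have "norm (X - Y) \<le> e * (b - a) + (e + e)"
      unfolding X_def by linarith
    moreover have "X - Y = g b - g a - integral {a..b} h" by (simp add: X_def Y_def)
    ultimately show ?thesis by (simp add: algebra_simps)
  qed
  note le = this
  have "norm (g b - g a - integral {a..b} h) \<le> 0 + e" if "e > 0" for e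
  proof -
    have K: "2 + (b - a) > 0" using ab by simp
    have "norm (g b - g a - integral {a..b} h) \<le> (2 + (b - a)) * (e / (2 + (b - a)))"
      using K that by (intro le divide_pos_pos)
    also have "\<dots> = e" using K by simp
    finally show ?thesis by simp
  qed
  then have "norm (g b - g a - integral {a..b} h) \<le> 0" by (rule field_le_epsilon)
  then have "integral {a..b} h = g b - g a" by simp
  with integrable_integral[OF hi] show ?thesis by simp
qed

text \<open>Testing with \<open>\<eta> (c - t) * \<theta> x\<close> turns the space-time integral
  into two convolutions evaluated at \<open>c\<close>. Differentiating the reflected factor produces
  a sign that cancels the minus of the transposed operator; what remains is the hypothesis
  \<open>eq\<close> of \<open>mollified_derivative_limit\<close>.\<close>

lemma heat_solution_time_identity:
  fixes u :: "real \<Rightarrow> 'a::euclidean_space \<Rightarrow> complex"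
  assumes \<psi>: "friedrichs_mollifier (\<psi> :: 'a \<Rightarrow> real)" and u: "heat_solution T p v u"
    and p: "p \<in> borel_measurable borel" "AE x in lborel. \<bar>p x\<bar> \<le> P"
    and \<theta>: "test_fun \<theta>" and ab: "0 < a" "a \<le> b" "b < T"
  shows "((\<lambda>t. (\<Sum>b\<in>Basis. \<integral>x. dir_deriv b (dir_deriv b \<theta>) x *\<^sub>R u t x \<partial>lborel) - (\<integral>x. \<theta> x *\<^sub>R (p x *\<^sub>R u t x) \<partial>lborel))
    has_integral (\<integral>x. \<theta> x *\<^sub>R u b x \<partial>lborel) - (\<integral>x. \<theta> x *\<^sub>R u a x \<partial>lborel)) {a..b}"
proof -
  define g where "g t = (\<integral>x. \<theta> x *\<^sub>R u t x \<partial>lborel)" for t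
  define h where "h t = (\<Sum>b\<in>Basis. \<integral>x. dir_deriv b (dir_deriv b \<theta>) x *\<^sub>R u t x \<partial>lborel) - (\<integral>x. \<theta> x *\<^sub>R (p x *\<^sub>R u t x) \<partial>lborel)" for t
  have uc: "continuous_in_L2 T u" using u by (auto simp: heat_solution_def continuous_in_H1_imp_L2)
  note pc = continuous_in_L2_mult[OF uc p]
  have t2: "test_fun (dir_deriv b (dir_deriv b \<theta>))" if "b \<in> Basis" for b
    using \<theta> that by (intro test_fun_dir_deriv)
  have gc: "continuous_on {0..T} g" unfolding g_def by (rule continuous_on_test_pairing[OF uc \<theta>])
  have hc: "continuous_on {0..T} h"
    unfolding h_def by (intro continuous_on_diff continuous_on_sum continuous_on_test_pairing[OF uc t2] continuous_on_test_pairing[OF pc \<theta>])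
  obtain \<kappa> :: "real \<Rightarrow> real" where \<kappa>: "friedrichs_mollifier \<kappa>" using mollifier_on_line[OF \<psi>] .
  have "(h has_integral (g b - g a)) {a..b}"
  proof (rule mollified_derivative_limit[OF gc hc \<kappa> ab])
    fix \<eta> :: "real \<Rightarrow> real" and d c :: real
    assume \<eta>: "test_fun \<eta>" "\<And>t. \<bar>t\<bar> \<ge> d \<Longrightarrow> \<eta> t = 0" and c: "d < c" "c + d < T"
    define al where "al t = \<eta> (c - t)" for t
    have al: "test_fun al" unfolding al_def[abs_def] by (rule test_fun_reflect[OF \<eta>(1)])
    have "supp al \<subseteq> {c - d..c + d}"
      unfolding supp_def
    proof (rule closure_minimal)
      show "{t. al t \<noteq> 0} \<subseteq> {c - d..c + d}"
      proof
        fix t assume "t \<in> {t. al t \<noteq> 0}"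
        then have "\<not> \<bar>c - t\<bar> \<ge> d" using \<eta>(2)[of "c - t"] by (auto simp: al_def)
        then show "t \<in> {c - d..c + d}" by auto
      qed
    qed simp
    \<comment> \<open>The conditions \<open>d < c\<close> and \<open>c + d < T\<close> place the
      closed window around \<open>c\<close> in the open time interval.\<close>
    then have al': "test_fun_on {0<..<T} al" using al c by (auto simp: test_fun_on_def)
    have dal: "dir_deriv 1 al t = - dir_deriv 1 \<eta> (c - t)" for t
      unfolding al_def[abs_def]
      by (subst dir_deriv_reflect[OF smooth_imp_differentiable[OF test_fun_smooth[OF \<eta>(1)]]]) auto
    have inner: "(\<integral>x. heat_transpose p (\<lambda>z. al (fst z) * \<theta> (snd z)) (t, x) *\<^sub>R u t x \<partial>lborel)
        = dir_deriv 1 \<eta> (c - t) *\<^sub>R g t - \<eta> (c - t) *\<^sub>R h t" if t: "t \<in> {0..T}" for t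
    proof -
      have ut: "in_L2 (u t)" "in_L2 (\<lambda>x. p x *\<^sub>R u t x)"
        using continuous_in_L2D[OF uc t] continuous_in_L2D[OF pc t] .
      have 1: "heat_transpose p (\<lambda>z. al (fst z) * \<theta> (snd z)) (t, x) *\<^sub>R u t x
          = dir_deriv 1 \<eta> (c - t) *\<^sub>R (\<theta> x *\<^sub>R u t x)
            - \<eta> (c - t) *\<^sub>R ((\<Sum>b\<in>Basis. dir_deriv b (dir_deriv b \<theta>) x *\<^sub>R u t x) - \<theta> x *\<^sub>R (p x *\<^sub>R u t x))" for x
        unfolding heat_transpose_tensor[OF test_fun_smooth[OF al] test_fun_smooth[OF \<theta>]] dal
        by (simp add: al_def scaleR_sum_left[symmetric] algebra_simps)
      have i: "integrable lborel (\<lambda>x. \<Sum>b\<in>Basis. dir_deriv b (dir_deriv b \<theta>) x *\<^sub>R u t x)"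
        by (intro Bochner_Integration.integrable_sum integrable_test_fun_L2[OF t2 ut(1)])
      have s: "(\<integral>x. (\<Sum>b\<in>Basis. dir_deriv b (dir_deriv b \<theta>) x *\<^sub>R u t x) \<partial>lborel)
          = (\<Sum>b\<in>Basis. \<integral>x. dir_deriv b (dir_deriv b \<theta>) x *\<^sub>R u t x \<partial>lborel)"
        by (intro Bochner_Integration.integral_sum integrable_test_fun_L2[OF t2 ut(1)])
      show ?thesis
        unfolding 1 g_def h_def s[symmetric]
        using i integrable_test_fun_L2[OF \<theta> ut(1)] integrable_test_fun_L2[OF \<theta> ut(2)]
        by (simp del: scaleR_scaleR)
    qed
    have "(LINT t:{0..T}|lborel. (\<integral>x. heat_transpose p (\<lambda>z. al (fst z) * \<theta> (snd z)) (t, x) *\<^sub>R u t x \<partial>lborel)) = 0"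
      using u test_fun_tensor[OF al' \<theta>] unfolding heat_solution_def by blast
    also have "(LINT t:{0..T}|lborel. (\<integral>x. heat_transpose p (\<lambda>z. al (fst z) * \<theta> (snd z)) (t, x) *\<^sub>R u t x \<partial>lborel))
        = (\<integral>t. dir_deriv 1 \<eta> (c - t) *\<^sub>R (indicator {0..T} t *\<^sub>R g t) - \<eta> (c - t) *\<^sub>R (indicator {0..T} t *\<^sub>R h t) \<partial>lborel)"
      unfolding set_lebesgue_integral_def
      by (rule Bochner_Integration.integral_cong) (auto simp: inner indicator_def)
    also have "\<dots> = fun_conv (\<lambda>t. indicator {0..T} t *\<^sub>R g t) (dir_deriv 1 \<eta>) c - fun_conv (\<lambda>t. indicator {0..T} t *\<^sub>R h t) \<eta> c"
      unfolding fun_conv_def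
      by (intro Bochner_Integration.integral_diff integrable_fun_conv test_fun_dir_deriv \<eta>(1) in_L2_indicator_continuous gc hc) simp
    finally show "fun_conv (\<lambda>t. indicator {0..T} t *\<^sub>R g t) (dir_deriv 1 \<eta>) c = fun_conv (\<lambda>t. indicator {0..T} t *\<^sub>R h t) \<eta> c"
      by simp
  qed
  then show ?thesis unfolding g_def h_def .
qed

text \<open>The real part of \<open>w * cnj v\<close> for \<open>v = Complex \<phi> \<theta>\<close>
  is \<open>\<phi> * Re w + \<theta> * Im w\<close>. In this way the complex identities for two real
  test functions combine into one real identity for a complex one.\<close>

lemma L2_inner_Complex:
  assumes w: "in_L2 w" and \<phi>: "test_fun \<phi>" and \<theta>: "test_fun \<theta>"
  shows "L2_inner w (\<lambda>x. Complex (\<phi> x) (\<theta> x)) =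
    Re (\<integral>x. \<phi> x *\<^sub>R w x \<partial>lborel) + Im (\<integral>x. \<theta> x *\<^sub>R w x \<partial>lborel)"
proof -
  note i = integrable_test_fun_L2[OF \<phi> w] integrable_test_fun_L2[OF \<theta> w]
  have "Re (\<integral>x. \<phi> x *\<^sub>R w x \<partial>lborel) + Im (\<integral>x. \<theta> x *\<^sub>R w x \<partial>lborel)
      = (\<integral>x. Re (\<phi> x *\<^sub>R w x) \<partial>lborel) + (\<integral>x. Im (\<theta> x *\<^sub>R w x) \<partial>lborel)"
    unfolding integral_Re[OF i(1)] integral_Im[OF i(2)] ..
  also have "\<dots> = (\<integral>x. Re (\<phi> x *\<^sub>R w x) + Im (\<theta> x *\<^sub>R w x) \<partial>lborel)"
    by (rule Bochner_Integration.integral_add[symmetric, OF integrable_Re[OF i(1)] integrable_Im[OF i(2)]])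
  also have "\<dots> = L2_inner w (\<lambda>x. Complex (\<phi> x) (\<theta> x))"
    unfolding L2_inner_def by (rule Bochner_Integration.integral_cong) (auto simp: inner_complex_def)
  finally show ?thesis ..
qed

lemma in_L2_Complex:
  assumes \<phi>: "test_fun \<phi>" and \<theta>: "test_fun \<theta>"
  shows "in_L2 (\<lambda>x. Complex (\<phi> x) (\<theta> x))"
proof -
  have 1: "in_L2 (\<lambda>x. complex_of_real (\<phi> x))" by (rule in_L2_test_fun[OF \<phi>])
  have m: "(\<lambda>x. complex_of_real (\<theta> x)) \<in> borel_measurable borel" using test_fun_measurable[OF \<theta>] by simp
  have 2: "in_L2 (\<lambda>x. \<i> * complex_of_real (\<theta> x))"
    by (rule in_L2_bound[OF _ in_L2_norm_integrable[OF in_L2_test_fun[OF \<theta>]]]) (use m in \<open>auto simp: norm_mult\<close>)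
  have "(\<lambda>x. Complex (\<phi> x) (\<theta> x)) = (\<lambda>x. complex_of_real (\<phi> x) + \<i> * complex_of_real (\<theta> x))"
    by (auto simp: complex_eq_iff)
  with in_L2_add[OF 1 2] show ?thesis by simp
qed

text \<open>\<open>\<partial>\<^sub>t w - \<Delta> w + f = 0\<close> with \<open>W b = \<partial>\<^sub>b w\<close>, tested with \<open>v \<in> H\<^sup>1\<close> that does not depend on time.\<close>

definition weak_heat ::
    "real \<Rightarrow> (real \<Rightarrow> 'a::euclidean_space \<Rightarrow> complex) \<Rightarrow> ('a \<Rightarrow> real \<Rightarrow> 'a \<Rightarrow> complex) \<Rightarrow> (real \<Rightarrow> 'a \<Rightarrow> complex) \<Rightarrow> bool" where
  "weak_heat T w W f \<longleftrightarrow>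
     continuous_in_L2 T w \<and> continuous_in_L2 T f \<and>
     (\<forall>b\<in>Basis. continuous_in_L2 T (W b) \<and> (\<forall>t\<in>{0..T}. is_weak_deriv b (w t) (W b t))) \<and>
     (\<forall>v V s t. in_L2 v \<longrightarrow> (\<forall>b\<in>Basis. in_L2 (V b) \<and> is_weak_deriv b v (V b)) \<longrightarrow> 0 < s \<longrightarrow> s \<le> t \<longrightarrow> t < T \<longrightarrow>
        ((\<lambda>\<tau>. (\<Sum>b\<in>Basis. L2_inner (W b \<tau>) (V b)) + L2_inner (f \<tau>) v)
          has_integral (L2_inner (w s) v - L2_inner (w t) v)) {s..t})"

text \<open>One of the two derivatives on the test function is moved to \<open>u\<close>, so that
  only first derivatives of the test function remain; those are what density in H1 controls. The
  real part of the identity for \<open>\<phi>\<close> and the imaginary part of that for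
  \<open>\<theta>\<close> add up to the inner product with \<open>v\<close>.\<close>

lemma heat_solution_test_identity:
  fixes u :: "real \<Rightarrow> 'a::euclidean_space \<Rightarrow> complex"
  assumes \<psi>: "friedrichs_mollifier (\<psi> :: 'a \<Rightarrow> real)" and u: "heat_solution T p v0 u"
    and p: "p \<in> borel_measurable borel" "AE x in lborel. \<bar>p x\<bar> \<le> P"
    and \<phi>: "test_fun \<phi>" and \<theta>: "test_fun \<theta>" and st: "0 < s" "s \<le> t" "t < T"
  defines "v \<equiv> \<lambda>x. Complex (\<phi> x) (\<theta> x)" and "V \<equiv> \<lambda>b x. Complex (dir_deriv b \<phi> x) (dir_deriv b \<theta> x)"
  shows "((\<lambda>\<tau>. (\<Sum>b\<in>Basis. L2_inner (weak_deriv b (u \<tau>)) (V b)) + L2_inner (\<lambda>x. p x *\<^sub>R u \<tau> x) v)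
          has_integral (L2_inner (u s) v - L2_inner (u t) v)) {s..t}"
proof -
  have uc: "continuous_in_L2 T u" using u by (auto simp: heat_solution_def continuous_in_H1_imp_L2)
  note pc = continuous_in_L2_mult[OF uc p]
  define h where "h \<theta> t = (\<Sum>b\<in>Basis. \<integral>x. dir_deriv b (dir_deriv b \<theta>) x *\<^sub>R u t x \<partial>lborel) - (\<integral>x. \<theta> x *\<^sub>R (p x *\<^sub>R u t x) \<partial>lborel)" for \<theta> t
  define g where "g \<theta> t = (\<integral>x. \<theta> x *\<^sub>R u t x \<partial>lborel)" for \<theta> t
  have "(h \<phi> has_integral (g \<phi> t - g \<phi> s)) {s..t}" "(h \<theta> has_integral (g \<theta> t - g \<theta> s)) {s..t}"
    unfolding h_def g_def using heat_solution_time_identity[OF \<psi> u p _ st] \<phi> \<theta> by auto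
  from has_integral_linear[OF this(1) bounded_linear_Re] has_integral_linear[OF this(2) bounded_linear_Im]
  have hi: "((\<lambda>\<tau>. - (Re (h \<phi> \<tau>) + Im (h \<theta> \<tau>))) has_integral - (Re (g \<phi> t - g \<phi> s) + Im (g \<theta> t - g \<theta> s))) {s..t}"
    unfolding o_def by (intro has_integral_neg has_integral_add)
  have val: "- (Re (g \<phi> t - g \<phi> s) + Im (g \<theta> t - g \<theta> s)) = L2_inner (u s) v - L2_inner (u t) v"
    using L2_inner_Complex[OF continuous_in_L2D[OF uc] \<phi> \<theta>] st by (simp add: v_def g_def)
  have int: "(\<Sum>b\<in>Basis. L2_inner (weak_deriv b (u \<tau>)) (V b)) + L2_inner (\<lambda>x. p x *\<^sub>R u \<tau> x) v = - (Re (h \<phi> \<tau>) + Im (h \<theta> \<tau>))"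
    if "\<tau> \<in> {s..t}" for \<tau>
  proof -
    have \<tau>: "\<tau> \<in> {0..T}" using that st by auto
    have H: "in_H1 (u \<tau>)" using u \<tau> by (auto simp: heat_solution_def continuous_in_H1_def)
    have w: "(\<integral>x. dir_deriv b (dir_deriv b \<theta>) x *\<^sub>R u \<tau> x \<partial>lborel) = - (\<integral>x. dir_deriv b \<theta> x *\<^sub>R weak_deriv b (u \<tau>) x \<partial>lborel)"
      if "test_fun \<theta>" "b \<in> Basis" for \<theta> b
      using in_H1_weak_deriv(2)[OF H that(2)] test_fun_dir_deriv[OF that] unfolding is_weak_deriv_def by blast
    have "L2_inner (weak_deriv b (u \<tau>)) (V b) =
        - (Re (\<integral>x. dir_deriv b (dir_deriv b \<phi>) x *\<^sub>R u \<tau> x \<partial>lborel) + Im (\<integral>x. dir_deriv b (dir_deriv b \<theta>) x *\<^sub>R u \<tau> x \<partial>lborel))"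
      if b: "b \<in> Basis" for b
      unfolding V_def w[OF \<phi> b] w[OF \<theta> b]
      by (subst L2_inner_Complex[OF in_H1_weak_deriv(1)[OF H b] test_fun_dir_deriv[OF \<phi> b] test_fun_dir_deriv[OF \<theta> b]]) simp
    then show ?thesis
      unfolding h_def v_def L2_inner_Complex[OF continuous_in_L2D[OF pc \<tau>] \<phi> \<theta>]
      by (simp add: sum_negf sum.distrib sum_subtractf)
  qed
  show ?thesis
    using has_integral_eq[OF int[symmetric] hi] unfolding val .
qed

text \<open>Both sides of the tested identity depend continuously on \<open>v\<close> and
  \<open>V\<close> in the L2 norms, uniformly over the bounded time interval, so the identity passes
  from test functions to H1.\<close>

lemma heat_solution_weak_heat:
  fixes u :: "real \<Rightarrow> 'a::euclidean_space \<Rightarrow> complex"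
  assumes \<psi>: "friedrichs_mollifier (\<psi> :: 'a \<Rightarrow> real)" and u: "heat_solution T p v0 u"
    and p: "p \<in> borel_measurable borel" "AE x in lborel. \<bar>p x\<bar> \<le> P"
  shows "weak_heat T u (\<lambda>b t. weak_deriv b (u t)) (\<lambda>t x. p x *\<^sub>R u t x)"
  unfolding weak_heat_def
proof (intro conjI ballI allI impI)
  have H: "continuous_in_H1 T u" using u by (simp add: heat_solution_def)
  show uc: "continuous_in_L2 T u" by (rule continuous_in_H1_imp_L2[OF H])
  show pc: "continuous_in_L2 T (\<lambda>t x. p x *\<^sub>R u t x)" by (rule continuous_in_L2_mult[OF uc p])
  show Wc: "continuous_in_L2 T (\<lambda>t. weak_deriv b (u t))" if "b \<in> Basis" for b
    by (rule continuous_in_H1_imp_L2_weak_deriv[OF \<psi> H that])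
  show "is_weak_deriv b (u t) (weak_deriv b (u t))" if "b \<in> Basis" "t \<in> {0..T}" for b t
    using H that by (intro in_H1_weak_deriv) (auto simp: continuous_in_H1_def)
  fix v :: "'a \<Rightarrow> complex" and V s t
  assume v: "in_L2 v" and V: "\<forall>b\<in>Basis. in_L2 (V b) \<and> is_weak_deriv b v (V b)" and st: "0 < s" "s \<le> t" "t < T"
  define I where "I v V \<tau> = (\<Sum>b\<in>Basis. L2_inner (weak_deriv b (u \<tau>)) (V b)) + L2_inner (\<lambda>x. p x *\<^sub>R u \<tau> x) v"
    for v V \<tau>
  obtain Mp where Mp: "Mp \<ge> 0" "\<And>t. t \<in> {0..T} \<Longrightarrow> L2_norm (\<lambda>x. p x *\<^sub>R u t x) \<le> Mp"
    using continuous_in_L2_bounded[OF pc] by blast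
  obtain Mu where Mu: "Mu \<ge> 0" "\<And>t. t \<in> {0..T} \<Longrightarrow> L2_norm (u t) \<le> Mu"
    using continuous_in_L2_bounded[OF uc] by blast
  have "\<exists>M. M \<ge> 0 \<and> (\<forall>t\<in>{0..T}. L2_norm (weak_deriv b (u t)) \<le> M)" if "b \<in> Basis" for b
    by (rule continuous_in_L2_bounded[OF Wc[OF that]]) auto
  then obtain MW where MW: "\<And>b. b \<in> Basis \<Longrightarrow> MW b \<ge> 0" "\<And>b t. b \<in> Basis \<Longrightarrow> t \<in> {0..T} \<Longrightarrow> L2_norm (weak_deriv b (u t)) \<le> MW b"
    by metis
  define M where "M = (\<Sum>b\<in>Basis. MW b) + Mp"
  have M: "M \<ge> 0" unfolding M_def using MW(1) Mp(1) by (intro add_nonneg_nonneg sum_nonneg) auto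
  have "continuous_on {0..T} (I v V)"
    unfolding I_def using V v by (intro continuous_on_add continuous_on_sum continuous_on_L2_inner Wc pc) auto
  then have Ii: "I v V integrable_on {s..t}"
    by (intro integrable_continuous_real, elim continuous_on_subset) (use st in auto)
  define D where "D = L2_inner (u s) v - L2_inner (u t) v - integral {s..t} (I v V)"
  \<comment> \<open>\<open>2 * Mu\<close> accounts for the two boundary terms,
    \<open>M * (t - s)\<close> for the integral.\<close>
  have "\<bar>D\<bar> \<le> (2 * Mu + M * (t - s)) * e" if e: "e > 0" for e
  proof -
    obtain \<phi> \<theta> :: "'a \<Rightarrow> real" where \<phi>: "test_fun \<phi>" and \<theta>: "test_fun \<theta>"
      and a1: "L2_norm (\<lambda>x. Complex (\<phi> x) (\<theta> x) - v x) < e"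
      and a2: "\<And>b. b \<in> Basis \<Longrightarrow> L2_norm (\<lambda>x. Complex (dir_deriv b \<phi> x) (dir_deriv b \<theta> x) - V b x) < e"
    proof -
      show thesis
        by (rule test_fun_dense_H1[OF \<psi> v _ _ e, of V]) (use V that in auto)
    qed
    define v' where "v' = (\<lambda>x. Complex (\<phi> x) (\<theta> x))"
    define V' where "V' = (\<lambda>b x. Complex (dir_deriv b \<phi> x) (dir_deriv b \<theta> x))"
    have v': "in_L2 v'" unfolding v'_def by (rule in_L2_Complex[OF \<phi> \<theta>])
    have V': "in_L2 (V' b)" if "b \<in> Basis" for b
      unfolding V'_def by (rule in_L2_Complex[OF test_fun_dir_deriv[OF \<phi> that] test_fun_dir_deriv[OF \<theta> that]])
    have est: "\<bar>L2_inner f g' - L2_inner f g\<bar> \<le> K * e"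
      if "in_L2 f" "in_L2 g" "in_L2 g'" "L2_norm f \<le> K" "L2_norm (\<lambda>x. g' x - g x) < e" for f g g' K
    proof -
      have "\<bar>L2_inner f g' - L2_inner f g\<bar> \<le> L2_norm f * L2_norm (\<lambda>x. g' x - g x)"
        using L2_inner_le[OF that(1) in_L2_diff[OF that(3,2)]] L2_inner_diff_right[OF that(3,2,1)] by simp
      also have "\<dots> \<le> K * e"
        using that L2_norm_nonneg[of f] L2_norm_nonneg[of "\<lambda>x. g' x - g x"] by (intro mult_mono) linarith+
      finally show ?thesis .
    qed
    have hi: "(I v' V' has_integral (L2_inner (u s) v' - L2_inner (u t) v')) {s..t}"
      unfolding I_def v'_def V'_def by (rule heat_solution_test_identity[OF \<psi> u p \<phi> \<theta> st])
    have Id: "\<bar>I v' V' \<tau> - I v V \<tau>\<bar> \<le> M * e" if "\<tau> \<in> {s..t}" for \<tau>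
    proof -
      have \<tau>: "\<tau> \<in> {0..T}" using that st by auto
      have "\<bar>I v' V' \<tau> - I v V \<tau>\<bar> = \<bar>(\<Sum>b\<in>Basis. L2_inner (weak_deriv b (u \<tau>)) (V' b) - L2_inner (weak_deriv b (u \<tau>)) (V b))
          + (L2_inner (\<lambda>x. p x *\<^sub>R u \<tau> x) v' - L2_inner (\<lambda>x. p x *\<^sub>R u \<tau> x) v)\<bar>"
        by (simp add: I_def sum_subtractf)
      also have "\<dots> \<le> (\<Sum>b\<in>Basis. \<bar>L2_inner (weak_deriv b (u \<tau>)) (V' b) - L2_inner (weak_deriv b (u \<tau>)) (V b)\<bar>)
          + \<bar>L2_inner (\<lambda>x. p x *\<^sub>R u \<tau> x) v' - L2_inner (\<lambda>x. p x *\<^sub>R u \<tau> x) v\<bar>"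
        by (rule order_trans[OF abs_triangle_ineq]) (intro add_mono sum_abs order_refl)
      also have "\<dots> \<le> (\<Sum>b\<in>Basis. MW b * e) + Mp * e"
      proof (intro add_mono sum_mono)
        show "\<bar>L2_inner (weak_deriv b (u \<tau>)) (V' b) - L2_inner (weak_deriv b (u \<tau>)) (V b)\<bar> \<le> MW b * e" if b: "b \<in> Basis" for b
          using V b by (intro est continuous_in_L2D[OF Wc[OF b] \<tau>] V' MW(2)[OF b \<tau>]) (auto simp: V'_def a2)
        show "\<bar>L2_inner (\<lambda>x. p x *\<^sub>R u \<tau> x) v' - L2_inner (\<lambda>x. p x *\<^sub>R u \<tau> x) v\<bar> \<le> Mp * e"
          by (intro est continuous_in_L2D[OF pc \<tau>] v v' Mp(2)[OF \<tau>]) (auto simp: v'_def a1)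
      qed
      also have "\<dots> = M * e" by (simp add: M_def sum_distrib_right distrib_right)
      finally show ?thesis .
    qed
    from has_integral_diff[OF hi integrable_integral[OF Ii]]
    have "norm ((L2_inner (u s) v' - L2_inner (u t) v') - integral {s..t} (I v V)) \<le> (M * e) * measure lborel (cbox s t)"
      by (intro has_integral_bound[where f = "\<lambda>\<tau>. I v' V' \<tau> - I v V \<tau>"]) (use M e Id in auto)
    then have 1: "\<bar>(L2_inner (u s) v' - L2_inner (u t) v') - integral {s..t} (I v V)\<bar> \<le> M * e * (t - s)"
      using st by simp
    have 2: "\<bar>L2_inner (u r) v' - L2_inner (u r) v\<bar> \<le> Mu * e" if "r \<in> {0..T}" for r
      using that by (intro est continuous_in_L2D[OF uc] v v' Mu(2)) (auto simp: v'_def a1)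
    have "\<bar>D\<bar> \<le> M * e * (t - s) + Mu * e + Mu * e"
      unfolding D_def using 1 2[of s] 2[of t] st by auto
    then show ?thesis by (simp add: algebra_simps)
  qed
  note Dle = this
  have "\<bar>D\<bar> \<le> 0 + e" if "e > 0" for e
  proof -
    have K: "2 * Mu + M * (t - s) + 1 > 0" using Mu M st by (intro add_nonneg_pos add_nonneg_nonneg mult_nonneg_nonneg) auto
    have "\<bar>D\<bar> \<le> (2 * Mu + M * (t - s)) * (e / (2 * Mu + M * (t - s) + 1))"
      using K that by (intro Dle) auto
    also have "\<dots> \<le> (2 * Mu + M * (t - s) + 1) * (e / (2 * Mu + M * (t - s) + 1))"
      using K that by (intro mult_right_mono) auto
    also have "\<dots> = e" using K by simp
    finally show ?thesis by simp
  qed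
  then have "\<bar>D\<bar> \<le> 0" by (rule field_le_epsilon)
  then have "integral {s..t} (I v V) = L2_inner (u s) v - L2_inner (u t) v" by (simp add: D_def)
  with integrable_integral[OF Ii]
  show "((\<lambda>\<tau>. (\<Sum>b\<in>Basis. L2_inner (weak_deriv b (u \<tau>)) (V b)) + L2_inner (\<lambda>x. p x *\<^sub>R u \<tau> x) v)
          has_integral (L2_inner (u s) v - L2_inner (u t) v)) {s..t}"
    by (simp add: I_def[abs_def])
qed

text \<open>\<open>weak_heat\<close> carries an arbitrary source curve instead of a potential times
  \<open>w\<close>, so that equations with two different potentials can be subtracted.\<close>

lemma weak_heat_diff:
  fixes w w' :: "real \<Rightarrow> 'a::euclidean_space \<Rightarrow> complex"
  assumes w: "weak_heat T w W f" and w': "weak_heat T w' W' f'"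
  shows "weak_heat T (\<lambda>t x. w t x - w' t x) (\<lambda>b t x. W b t x - W' b t x) (\<lambda>t x. f t x - f' t x)"
  unfolding weak_heat_def
proof (intro conjI ballI allI impI)
  have c: "continuous_in_L2 T w" "continuous_in_L2 T w'" "continuous_in_L2 T f" "continuous_in_L2 T f'"
    and cW: "\<And>b. b \<in> Basis \<Longrightarrow> continuous_in_L2 T (W b)" "\<And>b. b \<in> Basis \<Longrightarrow> continuous_in_L2 T (W' b)"
    and wd: "\<And>b t. b \<in> Basis \<Longrightarrow> t \<in> {0..T} \<Longrightarrow> is_weak_deriv b (w t) (W b t)"
      "\<And>b t. b \<in> Basis \<Longrightarrow> t \<in> {0..T} \<Longrightarrow> is_weak_deriv b (w' t) (W' b t)"
    using w w' by (auto simp: weak_heat_def)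
  show "continuous_in_L2 T (\<lambda>t x. w t x - w' t x)" "continuous_in_L2 T (\<lambda>t x. f t x - f' t x)"
    using c continuous_in_L2_diff by auto
  show "continuous_in_L2 T (\<lambda>t x. W b t x - W' b t x)" if "b \<in> Basis" for b
    using cW[OF that] by (rule continuous_in_L2_diff)
  show "is_weak_deriv b (\<lambda>x. w t x - w' t x) (\<lambda>x. W b t x - W' b t x)" if "b \<in> Basis" "t \<in> {0..T}" for b t
    using that by (intro is_weak_deriv_diff wd continuous_in_L2D[OF c(1)] continuous_in_L2D[OF c(2)]
        continuous_in_L2D[OF cW(1)] continuous_in_L2D[OF cW(2)])
  fix v :: "'a \<Rightarrow> complex" and V s t
  assume v: "in_L2 v" and V: "\<forall>b\<in>Basis. in_L2 (V b) \<and> is_weak_deriv b v (V b)" and st: "0 < s" "s \<le> t" "t < T"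
  have hi: "((\<lambda>\<tau>. ((\<Sum>b\<in>Basis. L2_inner (W b \<tau>) (V b)) + L2_inner (f \<tau>) v) - ((\<Sum>b\<in>Basis. L2_inner (W' b \<tau>) (V b)) + L2_inner (f' \<tau>) v))
      has_integral ((L2_inner (w s) v - L2_inner (w t) v) - (L2_inner (w' s) v - L2_inner (w' t) v))) {s..t}"
    using w w' v V st unfolding weak_heat_def by (intro has_integral_diff) blast+
  have val: "(L2_inner (w s) v - L2_inner (w t) v) - (L2_inner (w' s) v - L2_inner (w' t) v)
      = L2_inner (\<lambda>x. w s x - w' s x) v - L2_inner (\<lambda>x. w t x - w' t x) v"
    using st v c by (simp add: L2_inner_diff_left continuous_in_L2D)
  have int: "((\<Sum>b\<in>Basis. L2_inner (W b \<tau>) (V b)) + L2_inner (f \<tau>) v) - ((\<Sum>b\<in>Basis. L2_inner (W' b \<tau>) (V b)) + L2_inner (f' \<tau>) v)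
      = (\<Sum>b\<in>Basis. L2_inner (\<lambda>x. W b \<tau> x - W' b \<tau> x) (V b)) + L2_inner (\<lambda>x. f \<tau> x - f' \<tau> x) v" if "\<tau> \<in> {s..t}" for \<tau>
  proof -
    have \<tau>: "\<tau> \<in> {0..T}" using that st by auto
    have "(\<Sum>b\<in>Basis. L2_inner (\<lambda>x. W b \<tau> x - W' b \<tau> x) (V b)) = (\<Sum>b\<in>Basis. L2_inner (W b \<tau>) (V b) - L2_inner (W' b \<tau>) (V b))"
      using V by (intro sum.cong refl L2_inner_diff_left continuous_in_L2D[OF cW(1) \<tau>] continuous_in_L2D[OF cW(2) \<tau>]) auto
    then show ?thesis
      using L2_inner_diff_left[OF continuous_in_L2D[OF c(3) \<tau>] continuous_in_L2D[OF c(4) \<tau>] v]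
      by (simp add: sum_subtractf)
  qed
  show "((\<lambda>\<tau>. (\<Sum>b\<in>Basis. L2_inner (\<lambda>x. W b \<tau> x - W' b \<tau> x) (V b)) + L2_inner (\<lambda>x. f \<tau> x - f' \<tau> x) v)
      has_integral (L2_inner (\<lambda>x. w s x - w' s x) v - L2_inner (\<lambda>x. w t x - w' t x) v)) {s..t}"
    using has_integral_eq[OF int hi] unfolding val .
qed

section \<open>The energy inequality\<close>

lemma continuous_in_L2_ball:
  assumes "continuous_in_L2 T u" "t \<in> {0..T}" "e > 0"
  obtains d where "d > 0" "\<And>s. s \<in> {0..T} \<Longrightarrow> \<bar>s - t\<bar> < d \<Longrightarrow> L2_norm (\<lambda>x. u s x - u t x) < e"
proof -
  have "((\<lambda>s. L2_norm (\<lambda>x. u s x - u t x)) \<longlongrightarrow> 0) (at t within {0..T})"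
    using assms by (simp add: continuous_in_L2_def)
  from order_tendstoD(2)[OF this assms(3)]
  obtain d where d: "d > 0" "\<And>s. s \<in> {0..T} \<Longrightarrow> s \<noteq> t \<Longrightarrow> \<bar>s - t\<bar> < d \<Longrightarrow> L2_norm (\<lambda>x. u s x - u t x) < e"
    unfolding eventually_at by (auto simp: dist_real_def)
  \<comment> \<open>The limit at \<open>t\<close> says nothing about \<open>s = t\<close>, so this
    case is added by hand.\<close>
  have "L2_norm (\<lambda>x. u t x - u t x) = 0" by (simp add: L2_norm_def)
  with d assms(3) show thesis by (intro that[of d]) (metis)+
qed

text \<open>In the application \<open>a\<close> and \<open>b\<close> are the values at the ends of a
  short interval, \<open>g\<close> the value at a time in between and \<open>c\<close> the value at
  a fixed reference time. Passing through \<open>c\<close> puts \<open>a\<close> and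
  \<open>b\<close> within \<open>2 * e\<close> of \<open>g\<close>; two such errors paired with
  \<open>f\<close> give \<open>4 * M * e\<close>.\<close>

lemma L2_inner_sum_ge:
  assumes f: "in_L2 f" and g: "in_L2 g" "in_L2 a" "in_L2 b" "in_L2 c" and M: "L2_norm f \<le> M"
    and near: "L2_norm (\<lambda>x. a x - c x) \<le> e" "L2_norm (\<lambda>x. b x - c x) \<le> e" "L2_norm (\<lambda>x. g x - c x) \<le> e"
  shows "L2_inner f (\<lambda>x. a x + b x) \<ge> 2 * L2_inner f g - 4 * M * e"
proof -
  have "L2_norm (\<lambda>x. a x - g x) \<le> 2 * e" "L2_norm (\<lambda>x. b x - g x) \<le> 2 * e"
    using L2_norm_triangle_diff[OF g(2,4,1)] L2_norm_triangle_diff[OF g(3,4,1)] near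
      L2_norm_minus_commute[of c g] by auto
  then have 1: "L2_norm f * L2_norm (\<lambda>x. a x - g x) \<le> M * (2 * e)" "L2_norm f * L2_norm (\<lambda>x. b x - g x) \<le> M * (2 * e)"
    using M L2_norm_nonneg[of f] L2_norm_nonneg[of "\<lambda>x. a x - g x"] L2_norm_nonneg[of "\<lambda>x. b x - g x"]
    by (auto intro!: mult_mono)
  have "L2_inner f a - L2_inner f g \<ge> - (M * (2 * e))" "L2_inner f b - L2_inner f g \<ge> - (M * (2 * e))"
    using L2_inner_le[OF f in_L2_diff[OF g(2,1)]] L2_inner_le[OF f in_L2_diff[OF g(3,1)]]
      L2_inner_diff_right[OF g(2,1) f] L2_inner_diff_right[OF g(3,1) f] 1 by auto
  then show ?thesis by (simp add: L2_inner_add_right[OF g(2,3) f])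
qed

text \<open>In the boundary term the mixed products cancel by symmetry, leaving a difference of
  squared norms. Near \<open>x\<close> the integrand is, up to \<open>e\<close>, at least twice
  |grad w|^2 + <f, w>; the first part is dropped and the second is at least \<open>- K\<close>. The
  intervals are those containing \<open>x\<close>, which is the local condition of the bisection in
  \<open>weak_heat_energy_interior\<close>.\<close>

lemma weak_heat_energy_local:
  fixes w :: "real \<Rightarrow> 'a::euclidean_space \<Rightarrow> complex"
  assumes w: "weak_heat T w W f" and K: "\<And>t. t \<in> {0..T} \<Longrightarrow> L2_inner (f t) (w t) \<ge> - K"
    and x: "0 < x" "x < T" and e: "e > 0"
  obtains d where "d > 0" "\<And>s t. 0 < s \<Longrightarrow> s \<le> x \<Longrightarrow> x \<le> t \<Longrightarrow> t < T \<Longrightarrow> t - s < d \<Longrightarrow>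
    (L2_norm (w t))\<^sup>2 - (L2_norm (w s))\<^sup>2 \<le> (2 * K + e) * (t - s)"
proof -
  have c: "continuous_in_L2 T w" "continuous_in_L2 T f" and cW: "\<And>b. b \<in> Basis \<Longrightarrow> continuous_in_L2 T (W b)"
    and wd: "\<And>b t. b \<in> Basis \<Longrightarrow> t \<in> {0..T} \<Longrightarrow> is_weak_deriv b (w t) (W b t)"
    using w by (auto simp: weak_heat_def)
  note Lw = continuous_in_L2D[OF c(1)] and Lf = continuous_in_L2D[OF c(2)] and LW = continuous_in_L2D[OF cW]
  obtain Mf where Mf: "Mf \<ge> 0" "\<And>t. t \<in> {0..T} \<Longrightarrow> L2_norm (f t) \<le> Mf"
    using continuous_in_L2_bounded[OF c(2)] by blast
  have "\<exists>M. M \<ge> 0 \<and> (\<forall>t\<in>{0..T}. L2_norm (W b t) \<le> M)" if "b \<in> Basis" for b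
    by (rule continuous_in_L2_bounded[OF cW[OF that]]) auto
  then obtain MW where MW: "\<And>b. b \<in> Basis \<Longrightarrow> MW b \<ge> 0" "\<And>b t. b \<in> Basis \<Longrightarrow> t \<in> {0..T} \<Longrightarrow> L2_norm (W b t) \<le> MW b"
    by metis
  define M where "M = (\<Sum>b\<in>Basis. MW b) + Mf"
  have M: "M \<ge> 0" unfolding M_def using MW(1) Mf(1) by (intro add_nonneg_nonneg sum_nonneg) auto
  \<comment> \<open>\<open>4 * M * r\<close> is the total error of replacing the end values by those
    at the current time, summed over all gradient terms and the source; it must not exceed
    \<open>e\<close>.\<close>
  define r where "r = e / (4 * M + 1)"
  have r: "r > 0" "4 * M * r \<le> e" using e M by (auto simp: r_def field_simps)
  have xT: "x \<in> {0..T}" using x by auto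
  obtain dw where dw: "dw > 0" "\<And>s. s \<in> {0..T} \<Longrightarrow> \<bar>s - x\<bar> < dw \<Longrightarrow> L2_norm (\<lambda>y. w s y - w x y) < r"
    using continuous_in_L2_ball[OF c(1) xT r(1)] by blast
  have "\<exists>d>0. \<forall>s\<in>{0..T}. \<bar>s - x\<bar> < d \<longrightarrow> L2_norm (\<lambda>y. W b s y - W b x y) < r" if "b \<in> Basis" for b
    by (rule continuous_in_L2_ball[OF cW[OF that] xT r(1)]) auto
  then obtain dW where dW: "\<And>b. b \<in> Basis \<Longrightarrow> dW b > 0"
    "\<And>b s. b \<in> Basis \<Longrightarrow> s \<in> {0..T} \<Longrightarrow> \<bar>s - x\<bar> < dW b \<Longrightarrow> L2_norm (\<lambda>y. W b s y - W b x y) < r" by metis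
  obtain d0 where d0: "d0 > 0" "\<And>b. b \<in> Basis \<Longrightarrow> d0 \<le> dW b"
    using finite_positive_lower_bound[of Basis dW] dW(1) by auto
  define d where "d = min d0 dw"
  have nw: "L2_norm (\<lambda>y. w s y - w x y) \<le> r" if "s \<in> {0..T}" "\<bar>s - x\<bar> < d" for s
    using dw(2)[OF that(1)] that(2) by (simp add: d_def)
  have nW: "L2_norm (\<lambda>y. W b s y - W b x y) \<le> r" if "b \<in> Basis" "s \<in> {0..T}" "\<bar>s - x\<bar> < d" for b s
    using dW(2)[OF that(1,2)] that(3) d0(2)[OF that(1)] by (simp add: d_def)
  have main: "(L2_norm (w t))\<^sup>2 - (L2_norm (w s))\<^sup>2 \<le> (2 * K + e) * (t - s)"
    if st: "0 < s" "s \<le> x" "x \<le> t" "t < T" "t - s < d" for s t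
  proof -
    have sT: "s \<in> {0..T}" "t \<in> {0..T}" "s \<le> t" using st by auto
    have near: "\<tau> \<in> {0..T}" "\<bar>\<tau> - x\<bar> < d" if "\<tau> \<in> {s..t}" for \<tau> using that st by auto
    define v where "v = (\<lambda>y. w s y + w t y)"
    define V where "V = (\<lambda>b y. W b s y + W b t y)"
    define I where "I \<tau> = (\<Sum>b\<in>Basis. L2_inner (W b \<tau>) (V b)) + L2_inner (f \<tau>) v" for \<tau>
    have Lv: "in_L2 v" unfolding v_def using Lw sT by (intro in_L2_add)
    have LV: "in_L2 (V b) \<and> is_weak_deriv b v (V b)" if "b \<in> Basis" for b
      unfolding V_def v_def using that Lw LW sT wd by (intro conjI in_L2_add is_weak_deriv_add) auto
    have hi: "(I has_integral (L2_inner (w s) v - L2_inner (w t) v)) {s..t}"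
      unfolding I_def using w Lv LV st sT(3) unfolding weak_heat_def by blast
    have val: "L2_inner (w s) v - L2_inner (w t) v = (L2_norm (w s))\<^sup>2 - (L2_norm (w t))\<^sup>2"
      unfolding v_def L2_inner_self[symmetric] using Lw sT
      by (simp add: L2_inner_add_right L2_inner_commute[of "w t" "w s"])
    have low: "- (2 * K + e) \<le> I \<tau>" if \<tau>': "\<tau> \<in> {s..t}" for \<tau>
    proof -
      note \<tau> = near[OF \<tau>']
      have ns: "\<bar>s - x\<bar> < d" "\<bar>t - x\<bar> < d" using st by auto
      have 1: "L2_inner (W b \<tau>) (V b) \<ge> - (4 * MW b * r)" if b: "b \<in> Basis" for b
      proof -
        have "L2_inner (W b \<tau>) (V b) \<ge> 2 * L2_inner (W b \<tau>) (W b \<tau>) - 4 * MW b * r"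
          unfolding V_def
          by (rule L2_inner_sum_ge[where c = "W b x"])
            (use LW[OF b] sT xT \<tau> ns b MW(2)[OF b \<tau>(1)] nW[OF b] in auto)
        moreover have "L2_inner (W b \<tau>) (W b \<tau>) \<ge> 0" by (simp add: L2_inner_self)
        ultimately show ?thesis by linarith
      qed
      have 2: "L2_inner (f \<tau>) v \<ge> 2 * L2_inner (f \<tau>) (w \<tau>) - 4 * Mf * r"
        unfolding v_def
        by (rule L2_inner_sum_ge[where c = "w x"]) (use Lw Lf sT xT \<tau> ns Mf(2)[OF \<tau>(1)] nw in auto)
      have "(\<Sum>b\<in>Basis. L2_inner (W b \<tau>) (V b)) \<ge> (\<Sum>b\<in>Basis. - (4 * MW b * r))"
        using 1 by (rule sum_mono)
      also have "(\<Sum>b\<in>(Basis::'a set). - (4 * MW b * r)) = - (4 * (\<Sum>b\<in>Basis. MW b) * r)"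
        by (simp add: sum_negf sum_distrib_left sum_distrib_right)
      finally have "I \<tau> \<ge> - (4 * (\<Sum>b\<in>Basis. MW b) * r) + (- 2 * K - 4 * Mf * r)"
        unfolding I_def using 2 K[OF \<tau>(1)] by linarith
      also have "- (4 * (\<Sum>b\<in>Basis. MW b) * r) + (- 2 * K - 4 * Mf * r) = - 2 * K - 4 * M * r"
        by (simp add: M_def algebra_simps)
      finally show ?thesis using r(2) by linarith
    qed
    have "((\<lambda>_. - (2 * K + e)) has_integral (t - s) *\<^sub>R (- (2 * K + e))) {s..t}"
      using has_integral_const_real[of "- (2 * K + e)" s t] sT(3) by simp
    from has_integral_le[OF this hi low] show ?thesis
      unfolding val by (simp add: algebra_simps)
  qed
  have "d > 0" using d0 dw by (simp add: d_def)
  from that[OF this main] show thesis .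
qed

text \<open>The inequality with slope \<open>2 * K + e\<close> adds up over adjacent intervals and
  holds on short intervals around each point, so the bisection principle \<open>Bolzano\<close>
  carries it to the whole interval. This takes the place of integrating a derivative of the
  energy.\<close>

lemma weak_heat_energy_interior:
  fixes w :: "real \<Rightarrow> 'a::euclidean_space \<Rightarrow> complex"
  assumes w: "weak_heat T w W f" and K: "\<And>t. t \<in> {0..T} \<Longrightarrow> L2_inner (f t) (w t) \<ge> - K"
    and ab: "0 < a" "a \<le> b" "b < T"
  shows "(L2_norm (w b))\<^sup>2 - (L2_norm (w a))\<^sup>2 \<le> 2 * K * (b - a)"
proof -
  have le: "(L2_norm (w b))\<^sup>2 - (L2_norm (w a))\<^sup>2 \<le> (2 * K + e) * (b - a)" if e: "e > 0" for e
  proof -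
    \<comment> \<open>The local condition of the bisection ranges over intervals that may leave
      \<open>{a..b}\<close>; making \<open>P\<close> vacuous there keeps all relevant times inside
      the open interval.\<close>
    define P where "P s t \<longleftrightarrow> (a \<le> s \<longrightarrow> t \<le> b \<longrightarrow> (L2_norm (w t))\<^sup>2 - (L2_norm (w s))\<^sup>2 \<le> (2 * K + e) * (t - s))" for s t
    have "P a b"
      using ab(2)
    proof (induction rule: Bolzano)
      case (trans r s t)
      show ?case unfolding P_def
      proof (intro impI)
        assume "a \<le> r" "t \<le> b"
        with trans have "(L2_norm (w s))\<^sup>2 - (L2_norm (w r))\<^sup>2 \<le> (2 * K + e) * (s - r)"
          "(L2_norm (w t))\<^sup>2 - (L2_norm (w s))\<^sup>2 \<le> (2 * K + e) * (t - s)" by (auto simp: P_def)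
        then show "(L2_norm (w t))\<^sup>2 - (L2_norm (w r))\<^sup>2 \<le> (2 * K + e) * (t - r)"
          by (simp add: algebra_simps)
      qed
    next
      case (local x)
      then have "0 < x" "x < T" using ab by auto
      then obtain d where "d > 0" "\<And>s t. 0 < s \<Longrightarrow> s \<le> x \<Longrightarrow> x \<le> t \<Longrightarrow> t < T \<Longrightarrow> t - s < d \<Longrightarrow>
        (L2_norm (w t))\<^sup>2 - (L2_norm (w s))\<^sup>2 \<le> (2 * K + e) * (t - s)"
        using weak_heat_energy_local[OF w K _ _ e] by blast
      with ab show ?case unfolding P_def by (intro exI[of _ d]) auto
    qed
    then show ?thesis by (simp add: P_def)
  qed
  show ?thesis
  proof (rule field_le_epsilon)
    fix e :: real assume "e > 0"
    \<comment> \<open>The slope tolerance is divided by \<open>b - a + 1\<close>, so its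
      contribution is at most \<open>e\<close> and the quotient makes sense also for
      \<open>a = b\<close>.\<close>
    have "(L2_norm (w b))\<^sup>2 - (L2_norm (w a))\<^sup>2 \<le> (2 * K + e / (b - a + 1)) * (b - a)"
      using le[of "e / (b - a + 1)"] \<open>e > 0\<close> ab by simp
    also have "\<dots> = 2 * K * (b - a) + e / (b - a + 1) * (b - a)" by (simp add: distrib_right)
    also have "e / (b - a + 1) * (b - a) \<le> e" using \<open>e > 0\<close> ab by (simp add: field_simps)
    finally show "(L2_norm (w b))\<^sup>2 - (L2_norm (w a))\<^sup>2 \<le> 2 * K * (b - a) + e" by simp
  qed
qed

text \<open>The tested equation is available only at interior times. Continuity of \<open>F\<close>
  on the closed interval extends its monotonicity first to the right end \<open>t\<close> and then
  to the left end 0.\<close>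

lemma weak_heat_energy:
  fixes w :: "real \<Rightarrow> 'a::euclidean_space \<Rightarrow> complex"
  assumes w: "weak_heat T w W f" and K: "\<And>t. t \<in> {0..T} \<Longrightarrow> L2_inner (f t) (w t) \<ge> - K"
    and t: "t \<in> {0..T}"
  shows "(L2_norm (w t))\<^sup>2 \<le> (L2_norm (w 0))\<^sup>2 + 2 * K * t"
proof (cases "t = 0")
  case False
  then have t0: "0 < t" "t \<le> T" using t by auto
  define F where "F t = (L2_norm (w t))\<^sup>2 - 2 * K * t" for t
  have c: "continuous_on {0..T} F"
    unfolding F_def using w by (intro continuous_intros continuous_on_L2_norm) (simp add: weak_heat_def)
  have mono: "F t \<le> F a" if a: "0 < a" "a < t" for a
  proof (rule continuous_le_on_closure[where S = "{a<..<t}" and f = F])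
    show "continuous_on (closure {a<..<t}) F" using a t0 continuous_on_subset[OF c] by auto
    show "t \<in> closure {a<..<t}" using a by simp
    show "F r \<le> F a" if "r \<in> {a<..<t}" for r
      using weak_heat_energy_interior[OF w K, of a r] that a t0 by (simp add: F_def algebra_simps)
  qed
  have "F t \<le> F 0"
  proof (rule continuous_ge_on_closure[where S = "{0<..<t}" and f = F])
    show "continuous_on (closure {0<..<t}) F" using t0 continuous_on_subset[OF c] by auto
    show "0 \<in> closure {0<..<t}" using t0 by simp
  qed (use mono in auto)
  then show ?thesis by (simp add: F_def)
qed simp

text \<open>The essential supremum of a non-measurable function is \<open>\<infinity>\<close>, so a finite bound entails measurability.\<close>

lemma Linf_norm_le_real:
  fixes f :: "'a::euclidean_space \<Rightarrow> real"
  assumes "Linf_norm f \<le> ereal C"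
  shows "(\<lambda>x. \<bar>f x\<bar>) \<in> borel_measurable borel" "AE x in lborel. \<bar>f x\<bar> \<le> C"
proof -
  have m: "(\<lambda>x. ereal \<bar>f x\<bar>) \<in> borel_measurable lborel"
  proof (rule ccontr)
    assume "(\<lambda>x. ereal \<bar>f x\<bar>) \<notin> borel_measurable lborel"
    then have "Linf_norm f = top" unfolding Linf_norm_def by (rule esssup_non_measurable)
    with assms show False by (simp add: top_ereal_def)
  qed
  then have "(\<lambda>x. real_of_ereal (ereal \<bar>f x\<bar>)) \<in> borel_measurable lborel" by measurable
  then show "(\<lambda>x. \<bar>f x\<bar>) \<in> borel_measurable borel" by simp
  have "AE x in lborel. ereal \<bar>f x\<bar> \<le> Linf_norm f" unfolding Linf_norm_def by (rule esssup_AE)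
  then show "AE x in lborel. \<bar>f x\<bar> \<le> C"
    by eventually_elim (use assms order_trans in fastforce)
qed

section \<open>Stability under perturbation of the potential and the data\<close>

lemma heat_solution_initial_norm:
  assumes "heat_solution T p v u" "T > 0" "v \<in> borel_measurable borel"
  shows "L2_norm (u 0) = L2_norm v"
proof (rule L2_norm_cong_AE)
  have "in_H1 (u 0)" using assms by (auto simp: heat_solution_def continuous_in_H1_def)
  then show "u 0 \<in> borel_measurable borel" using in_H1_L2 in_L2_measurable by blast
qed (use assms in \<open>auto simp: heat_solution_def\<close>)

text \<open>A nonnegative potential makes the lower-order term dissipative, so the energy inequality
  applies with \<open>K = 0\<close>, however large the potential is.\<close>

lemma heat_solution_norm_le:
  fixes u :: "real \<Rightarrow> 'a::euclidean_space \<Rightarrow> complex"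
  assumes \<psi>: "friedrichs_mollifier (\<psi> :: 'a \<Rightarrow> real)" and u: "heat_solution T p v u"
    and p: "p \<in> borel_measurable borel" "AE x in lborel. \<bar>p x\<bar> \<le> P" "\<And>x. p x \<ge> 0" and t: "t \<in> {0..T}"
  shows "L2_norm (u t) \<le> L2_norm (u 0)"
proof -
  \<comment> \<open>Written with \<open>- 0\<close> to match the lower bound \<open>- K\<close> in
    \<open>weak_heat_energy\<close>.\<close>
  have "L2_inner (\<lambda>x. p x *\<^sub>R u t x) (u t) \<ge> - 0" for t
    unfolding L2_inner_def using p(3) by (simp add: integral_nonneg_AE)
  from weak_heat_energy[OF heat_solution_weak_heat[OF \<psi> u p(1,2)] this t]
  show ?thesis by (intro power2_le_imp_le[OF _ L2_norm_nonneg]) simp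
qed

text \<open>The source splits as p (u - u') + (p - p') u'. The first part pairs nonnegatively with u
  - u'; the second costs at most \<open>\<kappa> * U\<close> times the crude bound
  \<open>2 * U\<close> for the difference. Using that bound instead of the norm being estimated
  avoids a Gronwall argument. The value \<open>2 * \<kappa> * U\<^sup>2\<close> of \<open>K\<close>
  is doubled by the energy inequality, hence the factor 4.\<close>

lemma heat_solution_stability:
  fixes u u' :: "real \<Rightarrow> 'a::euclidean_space \<Rightarrow> complex"
  assumes \<psi>: "friedrichs_mollifier (\<psi> :: 'a \<Rightarrow> real)"
    and u: "heat_solution T p v u" and u': "heat_solution T p' v' u'"
    and p: "p \<in> borel_measurable borel" "AE x in lborel. \<bar>p x\<bar> \<le> P" "\<And>x. p x \<ge> 0"
    and p': "p' \<in> borel_measurable borel" "AE x in lborel. \<bar>p' x\<bar> \<le> P'" "\<And>x. p' x \<ge> 0"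
    and \<kappa>: "AE x in lborel. \<bar>p x - p' x\<bar> \<le> \<kappa>" "\<kappa> \<ge> 0"
    and U: "L2_norm (u 0) \<le> U" "L2_norm (u' 0) \<le> U" and t: "t \<in> {0..T}"
  shows "(L2_norm (\<lambda>x. u t x - u' t x))\<^sup>2 \<le> (L2_norm (\<lambda>x. u 0 x - u' 0 x))\<^sup>2 + 4 * \<kappa> * U\<^sup>2 * t"
proof -
  note wh = heat_solution_weak_heat[OF \<psi> u p(1,2)] heat_solution_weak_heat[OF \<psi> u' p'(1,2)]
  have c: "continuous_in_L2 T u" "continuous_in_L2 T u'" using wh by (auto simp: weak_heat_def)
  have U0: "U \<ge> 0" using U(1) L2_norm_nonneg order_trans by blast
  have "L2_inner (\<lambda>x. p x *\<^sub>R u r x - p' x *\<^sub>R u' r x) (\<lambda>x. u r x - u' r x) \<ge> - (2 * \<kappa> * U\<^sup>2)" if r: "r \<in> {0..T}" for r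
  proof -
    have L: "in_L2 (u r)" "in_L2 (u' r)" using c r continuous_in_L2D by auto
    have n: "L2_norm (u r) \<le> U" "L2_norm (u' r) \<le> U"
      using heat_solution_norm_le[OF \<psi> u p r] heat_solution_norm_le[OF \<psi> u' p' r] U by auto
    note Lw = in_L2_diff[OF L]
    have m: "(\<lambda>x. p x - p' x) \<in> borel_measurable borel" using p(1) p'(1) by auto
    note Lp = in_L2_bounded_mult[OF Lw p(1,2)] and Lk = in_L2_bounded_mult[OF L(2) m \<kappa>(1)]
    have e: "(\<lambda>x. p x *\<^sub>R u r x - p' x *\<^sub>R u' r x) = (\<lambda>x. p x *\<^sub>R (u r x - u' r x) + (p x - p' x) *\<^sub>R u' r x)"
      by (auto simp: algebra_simps)
    have "L2_inner (\<lambda>x. p x *\<^sub>R (u r x - u' r x)) (\<lambda>x. u r x - u' r x) \<ge> 0"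
      unfolding L2_inner_def using p(3) by (simp add: integral_nonneg_AE)
    moreover have "\<bar>L2_inner (\<lambda>x. (p x - p' x) *\<^sub>R u' r x) (\<lambda>x. u r x - u' r x)\<bar> \<le> 2 * \<kappa> * U\<^sup>2"
    proof -
      have "\<bar>L2_inner (\<lambda>x. (p x - p' x) *\<^sub>R u' r x) (\<lambda>x. u r x - u' r x)\<bar>
          \<le> L2_norm (\<lambda>x. (p x - p' x) *\<^sub>R u' r x) * L2_norm (\<lambda>x. u r x - u' r x)"
        by (rule L2_inner_le[OF Lk Lw])
      also have "\<dots> \<le> (\<kappa> * U) * (2 * U)"
      proof (rule mult_mono)
        show "L2_norm (\<lambda>x. (p x - p' x) *\<^sub>R u' r x) \<le> \<kappa> * U"
          using L2_norm_bounded_mult[OF L(2) m \<kappa>] n(2) \<kappa>(2) mult_left_mono order_trans by blast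
        show "L2_norm (\<lambda>x. u r x - u' r x) \<le> 2 * U" using L2_norm_minus_le[OF L] n by linarith
      qed (use \<kappa> U0 L2_norm_nonneg in auto)
      finally show ?thesis by (simp add: power2_eq_square)
    qed
    ultimately show ?thesis unfolding e L2_inner_add_left[OF Lp Lk Lw] by linarith
  qed
  from weak_heat_energy[OF weak_heat_diff[OF wh] this t] show ?thesis by (simp add: mult_ac)
qed

theorem theorem2p7:
  fixes T :: real
    and \<omega> :: "real \<Rightarrow> real"
    and q :: "('a::euclidean_space \<Rightarrow> real) \<Rightarrow> real"
    and u0 :: "'a \<Rightarrow> complex"
    and \<psi> \<psi>' :: "'a \<Rightarrow> real"
    and q\<epsilon> q\<epsilon>' :: "real \<Rightarrow> 'a \<Rightarrow> real"
    and u0\<epsilon> u0\<epsilon>' :: "real \<Rightarrow> 'a \<Rightarrow> complex"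
    and u u' :: "real \<Rightarrow> real \<Rightarrow> 'a \<Rightarrow> complex"
  assumes T: "T > 0"
    and \<omega>_pos: "\<And>\<epsilon>. \<epsilon> \<in> {0<..1} \<Longrightarrow> \<omega> \<epsilon> > 0"
    and \<omega>_lim: "(\<omega> \<longlongrightarrow> 0) (at_right 0)"
    and q: "is_distribution q"
    and u0: "in_H1 u0"
    and mollifiers: "friedrichs_mollifier \<psi>" "friedrichs_mollifier \<psi>'"
    and q\<epsilon>_def: "q\<epsilon> = (\<lambda>\<epsilon>. distr_conv q (scaled \<omega> \<psi> \<epsilon>))"
    and q\<epsilon>'_def: "q\<epsilon>' = (\<lambda>\<epsilon>. distr_conv q (scaled \<omega> \<psi>' \<epsilon>))"
    and u0\<epsilon>_def: "u0\<epsilon> = (\<lambda>\<epsilon>. fun_conv u0 (scaled \<omega> \<psi> \<epsilon>))"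
    and u0\<epsilon>'_def: "u0\<epsilon>' = (\<lambda>\<epsilon>. fun_conv u0 (scaled \<omega> \<psi>' \<epsilon>))"
    and q\<epsilon>_nonneg: "\<And>\<epsilon> x. \<epsilon> \<in> {0<..1} \<Longrightarrow> q\<epsilon> \<epsilon> x \<ge> 0"
    and q\<epsilon>'_nonneg: "\<And>\<epsilon> x. \<epsilon> \<in> {0<..1} \<Longrightarrow> q\<epsilon>' \<epsilon> x \<ge> 0"
    and q_moderate: "moderate_Linf \<omega> q\<epsilon>" "moderate_Linf \<omega> q\<epsilon>'"
    and u0_moderate: "moderate_H1 \<omega> u0\<epsilon>" "moderate_H1 \<omega> u0\<epsilon>'"
    and q_close: "\<And>k::real. k > 0 \<Longrightarrow>
          \<exists>C>0. \<forall>\<epsilon>\<in>{0<..1}. Linf_norm (\<lambda>x. q\<epsilon> \<epsilon> x - q\<epsilon>' \<epsilon> x) \<le> ereal (C * \<epsilon> powr k)"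
    and u0_close: "\<And>l::real. l > 0 \<Longrightarrow>
          \<exists>C>0. \<forall>\<epsilon>\<in>{0<..1}. L2_norm (\<lambda>x. u0\<epsilon> \<epsilon> x - u0\<epsilon>' \<epsilon> x) \<le> C * \<epsilon> powr l"
    and u: "\<And>\<epsilon>. \<epsilon> \<in> {0<..1} \<Longrightarrow> heat_solution T (q\<epsilon> \<epsilon>) (u0\<epsilon> \<epsilon>) (u \<epsilon>)"
    and u': "\<And>\<epsilon>. \<epsilon> \<in> {0<..1} \<Longrightarrow> heat_solution T (q\<epsilon>' \<epsilon>) (u0\<epsilon>' \<epsilon>) (u' \<epsilon>)"
  shows "\<forall>N::real. N > 0 \<longrightarrow>
          (\<exists>C>0. \<forall>t\<in>{0..T}. \<forall>\<epsilon>\<in>{0<..1}. L2_norm (\<lambda>x. u \<epsilon> t x - u' \<epsilon> t x) \<le> C * \<epsilon> powr N)"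
proof (intro allI impI)
  fix N :: real assume N: "N > 0"
  define U where "U = L2_norm u0"
  have u0L: "in_L2 u0" using u0 by (rule in_H1_L2)
  \<comment> \<open>The potentials enter the squared norm linearly, hence the exponent
    \<open>2 * N\<close>; the initial data enter squared, hence \<open>N\<close> below.\<close>
  obtain Ck where Ck: "Ck > 0"
    "\<And>\<epsilon>. \<epsilon> \<in> {0<..1} \<Longrightarrow> Linf_norm (\<lambda>x. q\<epsilon> \<epsilon> x - q\<epsilon>' \<epsilon> x) \<le> ereal (Ck * \<epsilon> powr (2 * N))"
    using q_close[of "2 * N"] N by auto
  obtain Cl where Cl: "Cl > 0"
    "\<And>\<epsilon>. \<epsilon> \<in> {0<..1} \<Longrightarrow> L2_norm (\<lambda>x. u0\<epsilon> \<epsilon> x - u0\<epsilon>' \<epsilon> x) \<le> Cl * \<epsilon> powr N"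
    using u0_close[OF N] by auto
  \<comment> \<open>Free of \<open>t\<close> and \<open>\<epsilon>\<close>: time is bounded by
    \<open>T\<close>, and both families of solutions are bounded by
    \<open>L2_norm u0\<close>.\<close>
  define C where "C = sqrt (Cl\<^sup>2 + 4 * Ck * U\<^sup>2 * T)"
  have "Cl\<^sup>2 + 4 * Ck * U\<^sup>2 * T > 0" using Cl(1) Ck(1) T by (intro add_pos_nonneg) auto
  then have C: "C > 0" "C\<^sup>2 = Cl\<^sup>2 + 4 * Ck * U\<^sup>2 * T" by (auto simp: C_def)
  have "L2_norm (\<lambda>x. u \<epsilon> t x - u' \<epsilon> t x) \<le> C * \<epsilon> powr N" if t: "t \<in> {0..T}" and \<epsilon>: "\<epsilon> \<in> {0<..1}" for t \<epsilon>
  proof -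
    have mol: "friedrichs_mollifier (scaled \<omega> \<psi> \<epsilon>)" "friedrichs_mollifier (scaled \<omega> \<psi>' \<epsilon>)"
      using mollifier_rescale[OF mollifiers(1) \<omega>_pos[OF \<epsilon>]] mollifier_rescale[OF mollifiers(2) \<omega>_pos[OF \<epsilon>]]
      by (auto simp: scaled_def[abs_def])
    have v: "in_L2 (u0\<epsilon> \<epsilon>)" "in_L2 (u0\<epsilon>' \<epsilon>)" "L2_norm (u0\<epsilon> \<epsilon>) \<le> U" "L2_norm (u0\<epsilon>' \<epsilon>) \<le> U"
      using fun_conv_mollifier_L2[OF mol(1) u0L] fun_conv_mollifier_L2[OF mol(2) u0L]
      by (auto simp: u0\<epsilon>_def u0\<epsilon>'_def U_def)
    note vm = v(1,2)[THEN in_L2_measurable]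
    \<comment> \<open>Moderateness is evaluated at a fixed \<open>\<epsilon>\<close>;
      \<open>P\<close> may depend on \<open>\<epsilon>\<close> because the stability estimate does
      not contain it.\<close>
    obtain P where "Linf_norm (q\<epsilon> \<epsilon>) \<le> ereal P" using q_moderate(1) \<epsilon> unfolding moderate_Linf_def by blast
    note p = Linf_norm_le_real[OF this]
    \<comment> \<open>The bound yields measurability of the absolute value, which by nonnegativity
      is the function itself.\<close>
    have pm: "q\<epsilon> \<epsilon> \<in> borel_measurable borel" using p(1) q\<epsilon>_nonneg[OF \<epsilon>] by simp
    obtain P' where "Linf_norm (q\<epsilon>' \<epsilon>) \<le> ereal P'" using q_moderate(2) \<epsilon> unfolding moderate_Linf_def by blast
    note p' = Linf_norm_le_real[OF this]
    have pm': "q\<epsilon>' \<epsilon> \<in> borel_measurable borel" using p'(1) q\<epsilon>'_nonneg[OF \<epsilon>] by simp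
    have n0: "L2_norm (u \<epsilon> 0) \<le> U" "L2_norm (u' \<epsilon> 0) \<le> U"
      using heat_solution_initial_norm[OF u[OF \<epsilon>] T vm(1)] heat_solution_initial_norm[OF u'[OF \<epsilon>] T vm(2)] v by auto
    have "L2_norm (\<lambda>x. u \<epsilon> 0 x - u' \<epsilon> 0 x) = L2_norm (\<lambda>x. u0\<epsilon> \<epsilon> x - u0\<epsilon>' \<epsilon> x)"
    proof (rule L2_norm_cong_AE)
      have "in_H1 (u \<epsilon> 0)" "in_H1 (u' \<epsilon> 0)"
        using u[OF \<epsilon>] u'[OF \<epsilon>] T by (auto simp: heat_solution_def continuous_in_H1_def)
      then show "(\<lambda>x. u \<epsilon> 0 x - u' \<epsilon> 0 x) \<in> borel_measurable borel"
        by (intro in_L2_measurable in_L2_diff in_H1_L2)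
      show "(\<lambda>x. u0\<epsilon> \<epsilon> x - u0\<epsilon>' \<epsilon> x) \<in> borel_measurable borel"
        by (intro in_L2_measurable in_L2_diff v)
      have "AE x in lborel. u \<epsilon> 0 x = u0\<epsilon> \<epsilon> x" "AE x in lborel. u' \<epsilon> 0 x = u0\<epsilon>' \<epsilon> x"
        using u[OF \<epsilon>] u'[OF \<epsilon>] by (auto simp: heat_solution_def)
      then show "AE x in lborel. u \<epsilon> 0 x - u' \<epsilon> 0 x = u0\<epsilon> \<epsilon> x - u0\<epsilon>' \<epsilon> x"
        by eventually_elim simp
    qed
    then have w0: "(L2_norm (\<lambda>x. u \<epsilon> 0 x - u' \<epsilon> 0 x))\<^sup>2 \<le> (Cl * \<epsilon> powr N)\<^sup>2"
      using Cl(2)[OF \<epsilon>] by (intro power_mono) (auto simp: L2_norm_nonneg)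
    have pw: "\<epsilon> powr (2 * N) = (\<epsilon> powr N)\<^sup>2" by (simp add: power2_eq_square flip: powr_add)
    have "(L2_norm (\<lambda>x. u \<epsilon> t x - u' \<epsilon> t x))\<^sup>2
        \<le> (L2_norm (\<lambda>x. u \<epsilon> 0 x - u' \<epsilon> 0 x))\<^sup>2 + 4 * (Ck * \<epsilon> powr (2 * N)) * U\<^sup>2 * t"
      by (rule heat_solution_stability[OF mollifiers(1) u[OF \<epsilon>] u'[OF \<epsilon>] pm p(2) q\<epsilon>_nonneg[OF \<epsilon>]
            pm' p'(2) q\<epsilon>'_nonneg[OF \<epsilon>] Linf_norm_le_real(2)[OF Ck(2)[OF \<epsilon>]] _ n0 t])
        (use Ck(1) in simp)
    also have "\<dots> \<le> (Cl * \<epsilon> powr N)\<^sup>2 + 4 * (Ck * \<epsilon> powr (2 * N)) * U\<^sup>2 * T"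
      using w0 t Ck(1) by (intro add_mono mult_left_mono) auto
    also have "\<dots> = (C * \<epsilon> powr N)\<^sup>2"
      unfolding pw power_mult_distrib C(2) by (simp add: algebra_simps)
    finally show ?thesis
      by (rule power2_le_imp_le) (use C in simp)
  qed
  with C(1) show "\<exists>C>0. \<forall>t\<in>{0..T}. \<forall>\<epsilon>\<in>{0<..1}. L2_norm (\<lambda>x. u \<epsilon> t x - u' \<epsilon> t x) \<le> C * \<epsilon> powr N"
    by blast
qed

end
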